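(* Let $m\geq 5$ and $n\geq 4$ be integers, and let $\sigma\in B_n$ be a half-twist. Then the normal closure of $\sigma^m$ in the braid group $B_n$ has infinite index in $B_n$.
   Context: $B_n$ is the braid group on $n$ strands, identified with the mapping class group of a disc with $n$ marked points (isotopy classes of orientation-preserving homeomorphisms preserving the set of marked points and fixing the boundary pointwise). It has the presentation with generators $\sigma_1,\dots,\sigma_{n-1}$ and relations $\sigma_i\sigma_{i+1}\sigma_i=\sigma_{i+1}\sigma_i\sigma_{i+1}$ and $\sigma_i\sigma_j=\sigma_j\sigma_i$ for $|i-j|>1$. A half-twist is a mapping class interchanging two marked points by a rotation of angle $\pi$ supported in a disc containing exactly these two marked points; each $\sigma_i$ is a half-twist (interchanging the $i$-th and $(i+1)$-st marked points). *)

theory Defs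
  imports "HOL-Analysis.Analysis" "HOL-Algebra.Coset"
begin

text \<open>The disc is the closed unit disc of the complex plane. Its \<open>k\<close>-th marked point
  (\<open>1 \<le> k \<le> n\<close>) is \<open>2 k / (n + 1) - 1\<close>, so that the marked points are evenly spaced on the real
  diameter.\<close>

definition marked_points :: "nat \<Rightarrow> complex set" where
  "marked_points n = (\<lambda>k. of_real (2 * real k / (real n + 1) - 1)) ` {1..n}"

text \<open>A homeomorphism of the disc fixing the boundary pointwise is represented by its extension by
  the identity to the whole plane, so that equality of functions is equality of homeomorphisms.
  There is no separate clause for preservation of orientation: it follows from fixing the boundary
  circle pointwise.\<close>

definition disc_homeos :: "nat \<Rightarrow> (complex \<Rightarrow> complex) set" where
  "disc_homeos n = {f. (\<exists>g. homeomorphism (cball 0 1) (cball 0 1) f g)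
                     \<and> (\<forall>z. z \<notin> ball 0 1 \<longrightarrow> f z = z)
                     \<and> f ` marked_points n = marked_points n}"

definition disc_homeo_group :: "nat \<Rightarrow> (complex \<Rightarrow> complex) monoid" where
  "disc_homeo_group n = \<lparr>carrier = disc_homeos n, mult = (\<circ>), one = id\<rparr>"

text \<open>All stages of an isotopy fix the boundary pointwise and preserve the set of marked points.\<close>

definition isotopic :: "nat \<Rightarrow> (complex \<Rightarrow> complex) \<Rightarrow> (complex \<Rightarrow> complex) \<Rightarrow> bool" where
  "isotopic n f g \<longleftrightarrow>
     homotopic_with_canon (\<lambda>h. h \<in> disc_homeos n) (cball 0 1) (cball 0 1) f g"

definition mapping_class :: "nat \<Rightarrow> (complex \<Rightarrow> complex) \<Rightarrow> (complex \<Rightarrow> complex) set" where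
  "mapping_class n f = {g. isotopic n f g}"

text \<open>The cosets of the subgroup of homeomorphisms isotopic to the identity are exactly the isotopy
  classes; see \<open>carrier_braid_group\<close> and \<open>mult_mapping_class\<close> below.\<close>

definition braid_group :: "nat \<Rightarrow> (complex \<Rightarrow> complex) set monoid" where
  "braid_group n = disc_homeo_group n Mod mapping_class n id"

text \<open>The model half-twist on the closed unit disc: the rotation by \<open>\<pi>\<close> on the disc of radius
  \<open>1/2\<close>, with the angle decreasing linearly to \<open>0\<close> towards the boundary. It interchanges \<open>1/2\<close> and
  \<open>-1/2\<close>.\<close>

definition model_twist :: "complex \<Rightarrow> complex" where
  "model_twist z = z * cis (pi * min 1 (2 - 2 * norm z))"

definition twist_along :: "(complex \<Rightarrow> complex) \<Rightarrow> complex \<Rightarrow> complex" where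
  "twist_along e z =
     (if z \<in> e ` cball 0 1 then e (model_twist (inv_into (cball 0 1) e z)) else z)"

text \<open>The disc supporting a half-twist is an arbitrary topologically embedded one. The embedding may
  reverse the orientation, so half-twists of both directions of rotation are included.\<close>

definition half_twist :: "nat \<Rightarrow> (complex \<Rightarrow> complex) set \<Rightarrow> bool" where
  "half_twist n \<sigma> \<longleftrightarrow>
     (\<exists>e. continuous_on (cball 0 1) e \<and> inj_on e (cball 0 1) \<and> e ` cball 0 1 \<subseteq> ball 0 1
        \<and> e ` cball 0 1 \<inter> marked_points n = {e (1/2), e (- 1/2)}
        \<and> \<sigma> = mapping_class n (twist_along e))"

definition normal_closure :: "('a, 'b) monoid_scheme \<Rightarrow> 'a set \<Rightarrow> 'a set" where
  "normal_closure G S = \<Inter>{N. N \<lhd> G \<and> S \<subseteq> N}"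

lemma disc_homeosI:
  assumes "continuous_on (cball 0 1) f" "inj_on f (cball 0 1)" "f ` cball 0 1 = cball 0 1"
    "\<And>z. z \<notin> ball 0 1 \<Longrightarrow> f z = z" "f ` marked_points n = marked_points n"
  shows "f \<in> disc_homeos n"
  using assms homeomorphism_compact[of "cball 0 1" f "cball 0 1"]
  unfolding disc_homeos_def by auto

lemma disc_homeosD:
  assumes "f \<in> disc_homeos n"
  shows "continuous_on (cball 0 1) f" "inj_on f (cball 0 1)" "f ` cball 0 1 = cball 0 1"
    "\<And>z. z \<notin> ball 0 1 \<Longrightarrow> f z = z" "f ` marked_points n = marked_points n"
proof -
  from assms obtain g where g: "homeomorphism (cball 0 1) (cball 0 1) f g"
    by (auto simp: disc_homeos_def)
  show "continuous_on (cball 0 1) f" "inj_on f (cball 0 1)" "f ` cball 0 1 = cball 0 1"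
    using g by (auto simp: homeomorphism_def intro: inj_on_inverseI[of _ g])
qed (use assms in \<open>auto simp: disc_homeos_def\<close>)

lemma disc_homeos_bij:
  assumes "f \<in> disc_homeos n"
  shows "bij f"
proof -
  note D = disc_homeosD[OF assms]
  have "bij_betw f (cball 0 1) (cball 0 1)"
    using D by (auto simp: bij_betw_def)
  moreover have "bij_betw f (- cball 0 1) (- cball 0 1)"
    by (rule bij_betw_cong[THEN iffD1, OF _ bij_betw_id]) (auto simp: D(4))
  ultimately have "bij_betw f (cball 0 1 \<union> - cball 0 1) (cball 0 1 \<union> - cball 0 1)"
    by (rule bij_betw_combine) auto
  then show ?thesis by simp
qed

lemma id_in_disc_homeos: "id \<in> disc_homeos n"
  by (rule disc_homeosI) auto

lemma comp_in_disc_homeos: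
  assumes "f \<in> disc_homeos n" "g \<in> disc_homeos n"
  shows "f \<circ> g \<in> disc_homeos n"
proof (rule disc_homeosI)
  note F = disc_homeosD[OF assms(1)] and G = disc_homeosD[OF assms(2)]
  show "continuous_on (cball 0 1) (f \<circ> g)"
    using F G by (intro continuous_on_compose) simp_all
  show "inj_on (f \<circ> g) (cball 0 1)"
    using F G by (auto intro: comp_inj_on)
  show "(f \<circ> g) ` cball 0 1 = cball 0 1" "(f \<circ> g) ` marked_points n = marked_points n"
    using F G by (simp_all only: image_comp[symmetric])
  show "(f \<circ> g) z = z" if "z \<notin> ball 0 1" for z
    using that F(4) G(4) by simp
qed

lemma inv_in_disc_homeos:
  assumes "f \<in> disc_homeos n"
  shows "inv_into UNIV f \<in> disc_homeos n"
proof (rule disc_homeosI)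
  note F = disc_homeosD[OF assms] and B = disc_homeos_bij[OF assms]
  have inj: "inj f" and surj: "surj f" using B by (auto simp: bij_def)
  have im: "inv_into UNIV f ` S = S" if "f ` S = S" for S
    using image_inv_f_f[OF inj, of S] that by simp
  obtain g where g: "homeomorphism (cball 0 1) (cball 0 1) f g"
    using assms by (auto simp: disc_homeos_def)
  have "inv_into UNIV f z = g z" if "z \<in> cball 0 1" for z
    using that g inj by (metis homeomorphism_def inv_f_eq)
  moreover have "continuous_on (cball 0 1) g" using g by (simp add: homeomorphism_def)
  ultimately show "continuous_on (cball 0 1) (inv_into UNIV f)"
    using continuous_on_cong[of "cball 0 1" "cball 0 1" "inv_into UNIV f" g] by blast
  show "inj_on (inv_into UNIV f) (cball 0 1)"
    using surj by (simp add: inj_on_inv_into)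
  show "inv_into UNIV f ` cball 0 1 = cball 0 1" "inv_into UNIV f ` marked_points n = marked_points n"
    using im F by auto
  show "inv_into UNIV f z = z" if "z \<notin> ball 0 1" for z
    using F(4)[OF that] inj by (metis inv_f_eq)
qed

lemma disc_homeo_group_simps [simp]:
  "carrier (disc_homeo_group n) = disc_homeos n"
  "mult (disc_homeo_group n) = (\<circ>)"
  "one (disc_homeo_group n) = id"
  by (simp_all add: disc_homeo_group_def)

lemma group_disc_homeo_group: "group (disc_homeo_group n)"
proof (rule groupI)
  fix f assume "f \<in> carrier (disc_homeo_group n)"
  then have f: "f \<in> disc_homeos n" by simp
  have "inv_into UNIV f \<circ> f = id"
    using disc_homeos_bij[OF f] by (simp add: bij_def)
  then show "\<exists>g\<in>carrier (disc_homeo_group n). g \<otimes>\<^bsub>disc_homeo_group n\<^esub> f = \<one>\<^bsub>disc_homeo_group n\<^esub>"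
    using inv_in_disc_homeos[OF f] by auto
qed (auto simp: id_in_disc_homeos comp_in_disc_homeos comp_assoc)

lemma inv_disc_homeo_group:
  assumes "f \<in> disc_homeos n"
  shows "inv\<^bsub>disc_homeo_group n\<^esub> f = inv_into UNIV f"
proof -
  interpret group "disc_homeo_group n" by (rule group_disc_homeo_group)
  have "inv_into UNIV f \<circ> f = id"
    using disc_homeos_bij[OF assms] by (simp add: bij_def)
  then show ?thesis
    using assms inv_in_disc_homeos[OF assms] by (intro inv_equality) auto
qed

lemma isotopic_refl: "f \<in> disc_homeos n \<Longrightarrow> isotopic n f f"
  using disc_homeosD[of f n] by (auto simp: isotopic_def homotopic_with_refl)

lemma isotopic_sym: "isotopic n f g \<Longrightarrow> isotopic n g f"
  by (simp add: isotopic_def homotopic_with_symD)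

lemma isotopic_trans: "isotopic n f g \<Longrightarrow> isotopic n g h \<Longrightarrow> isotopic n f h"
  unfolding isotopic_def by (rule homotopic_with_trans)

lemma isotopic_in_disc_homeos:
  assumes "isotopic n f g"
  shows "f \<in> disc_homeos n" "g \<in> disc_homeos n"
  using homotopic_with_imp_property[OF assms[unfolded isotopic_def]] by auto

lemma isotopic_comp:
  assumes "isotopic n f f'" "isotopic n g g'"
  shows "isotopic n (f \<circ> g) (f' \<circ> g')"
proof -
  have f: "f \<in> disc_homeos n" and g': "g' \<in> disc_homeos n"
    using assms isotopic_in_disc_homeos by blast+
  have "isotopic n (f \<circ> g) (f \<circ> g')"
    using assms(2) unfolding isotopic_def
    by (rule homotopic_with_compose_continuous_map_left)
       (use disc_homeosD[OF f] f in \<open>auto intro: comp_in_disc_homeos\<close>)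
  moreover have "isotopic n (f \<circ> g') (f' \<circ> g')"
    using assms(1) unfolding isotopic_def
    by (rule homotopic_with_compose_continuous_map_right)
       (use disc_homeosD[OF g'] g' in \<open>auto intro: comp_in_disc_homeos\<close>)
  ultimately show ?thesis by (rule isotopic_trans)
qed

lemma isotopic_comp_right_iff:
  assumes "f \<in> disc_homeos n" "g \<in> disc_homeos n"
  shows "isotopic n id (g \<circ> inv_into UNIV f) \<longleftrightarrow> isotopic n f g"
proof
  have c: "inv_into UNIV f \<circ> f = id" "f \<circ> inv_into UNIV f = id"
    using disc_homeos_bij[OF assms(1)] by (auto simp: bij_def surj_iff)
  show "isotopic n f g" if "isotopic n id (g \<circ> inv_into UNIV f)"
    using isotopic_comp[OF that isotopic_refl[OF assms(1)]] by (simp add: comp_assoc c)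
  show "isotopic n id (g \<circ> inv_into UNIV f)" if "isotopic n f g"
    using isotopic_comp[OF that isotopic_refl[OF inv_in_disc_homeos[OF assms(1)]]]
    by (simp add: comp_assoc c)
qed

lemma normal_mapping_class_id: "mapping_class n id \<lhd> disc_homeo_group n"
proof -
  interpret group "disc_homeo_group n" by (rule group_disc_homeo_group)
  have "subgroup (mapping_class n id) (disc_homeo_group n)"
  proof (rule subgroupI)
    fix f g assume "f \<in> mapping_class n id" "g \<in> mapping_class n id"
    then have fg: "isotopic n id f" "isotopic n id g" by (auto simp: mapping_class_def)
    show "f \<otimes>\<^bsub>disc_homeo_group n\<^esub> g \<in> mapping_class n id"
      using isotopic_comp[OF fg] by (simp add: mapping_class_def)
  next
    fix f assume "f \<in> mapping_class n id"
    then have i: "isotopic n id f" by (auto simp: mapping_class_def)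
    have f: "f \<in> disc_homeos n" by (rule isotopic_in_disc_homeos(2)[OF i])
    have "isotopic n id (inv_into UNIV f)"
      using isotopic_comp_right_iff[OF f id_in_disc_homeos] isotopic_sym[OF i] by simp
    then show "inv\<^bsub>disc_homeo_group n\<^esub> f \<in> mapping_class n id"
      by (simp add: mapping_class_def inv_disc_homeo_group[OF f])
  qed (auto simp: mapping_class_def intro: isotopic_in_disc_homeos isotopic_refl id_in_disc_homeos)
  moreover have "g \<otimes>\<^bsub>disc_homeo_group n\<^esub> f \<otimes>\<^bsub>disc_homeo_group n\<^esub> inv\<^bsub>disc_homeo_group n\<^esub> g
      \<in> mapping_class n id"
    if "g \<in> carrier (disc_homeo_group n)" "f \<in> mapping_class n id" for f g
  proof -
    have g: "g \<in> disc_homeos n" using that by simp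
    have c: "g \<circ> inv_into UNIV g = id"
      using disc_homeos_bij[OF g] by (auto simp: bij_def surj_iff)
    have "isotopic n id f" using that by (simp add: mapping_class_def)
    from isotopic_comp[OF isotopic_comp[OF isotopic_refl[OF g] this]
        isotopic_refl[OF inv_in_disc_homeos[OF g]]]
    show ?thesis by (simp add: c mapping_class_def inv_disc_homeo_group[OF g])
  qed
  ultimately show ?thesis by (simp add: normal_inv_iff)
qed

lemma coset_mapping_class_id:
  assumes "f \<in> disc_homeos n"
  shows "mapping_class n id #>\<^bsub>disc_homeo_group n\<^esub> f = mapping_class n f"
proof (intro equalityI subsetI)
  fix h assume "h \<in> mapping_class n id #>\<^bsub>disc_homeo_group n\<^esub> f"
  then obtain k where k: "isotopic n id k" "h = k \<circ> f"
    by (auto simp: r_coset_def mapping_class_def)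
  then show "h \<in> mapping_class n f"
    using isotopic_comp[OF k(1) isotopic_refl[OF assms]] by (simp add: mapping_class_def)
next
  fix h assume "h \<in> mapping_class n f"
  then have i: "isotopic n f h" by (simp add: mapping_class_def)
  have "isotopic n id (h \<circ> inv_into UNIV f)"
    using isotopic_comp_right_iff[OF assms isotopic_in_disc_homeos(2)[OF i]] i by simp
  moreover have "h = h \<circ> inv_into UNIV f \<circ> f"
    using disc_homeos_bij[OF assms] by (simp add: comp_assoc bij_def)
  ultimately show "h \<in> mapping_class n id #>\<^bsub>disc_homeo_group n\<^esub> f"
    by (auto simp: r_coset_def mapping_class_def)
qed

lemma group_braid_group: "group (braid_group n)"
  unfolding braid_group_def by (rule normal.factorgroup_is_group[OF normal_mapping_class_id])

lemma carrier_braid_group: "carrier (braid_group n) = mapping_class n ` disc_homeos n"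
  by (simp add: braid_group_def carrier_FactGroup coset_mapping_class_id cong: image_cong_simp)

lemma mult_mapping_class:
  assumes "f \<in> disc_homeos n" "g \<in> disc_homeos n"
  shows "mapping_class n f \<otimes>\<^bsub>braid_group n\<^esub> mapping_class n g = mapping_class n (f \<circ> g)"
  using normal.rcos_sum[OF normal_mapping_class_id, of f n g] assms
  by (simp add: braid_group_def coset_mapping_class_id comp_in_disc_homeos)

lemma norm_model_twist [simp]: "norm (model_twist z) = norm z"
  by (simp add: model_twist_def norm_mult)

lemma model_twist_boundary: "norm z = 1 \<Longrightarrow> model_twist z = z"
  by (simp add: model_twist_def)

lemma model_twist_half [simp]: "model_twist (1/2) = - (1/2)" "model_twist (- (1/2)) = 1/2"
  by (simp_all add: model_twist_def complex_eq_iff)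

lemma continuous_on_model_twist: "continuous_on S model_twist"
  unfolding model_twist_def cis_conv_exp by (intro continuous_intros)

lemma bij_betw_model_twist: "bij_betw model_twist (cball 0 1) (cball 0 1)"
proof (rule bij_betw_byWitness)
  let ?g = "\<lambda>z. z * cis (- (pi * min 1 (2 - 2 * norm z)))"
  have n: "norm (?g z) = norm z" for z by (simp add: norm_mult)
  show "\<forall>z\<in>cball 0 1. ?g (model_twist z) = z"
    unfolding norm_model_twist by (simp add: model_twist_def mult.assoc cis_mult)
  show "\<forall>z\<in>cball 0 1. model_twist (?g z) = z"
    unfolding model_twist_def n by (simp add: mult.assoc cis_mult)
  show "model_twist ` cball 0 1 \<subseteq> cball 0 1" by auto
  show "?g ` cball 0 1 \<subseteq> cball 0 1" by (auto simp: norm_mult)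
qed

lemma twist_along_in_disc_homeos:
  assumes e: "continuous_on (cball 0 1) e" "inj_on e (cball 0 1)" "e ` cball 0 1 \<subseteq> ball 0 1"
    and P: "e ` cball 0 1 \<inter> marked_points n = {e (1/2), e (- 1/2)}"
  shows "twist_along e \<in> disc_homeos n"
proof (rule disc_homeosI)
  let ?B = "cball 0 1 :: complex set" and ?E = "e ` cball 0 1"
  let ?h = "inv_into ?B e"
  have on: "twist_along e (e w) = e (model_twist w)" if "w \<in> ?B" for w
    using that e(2) by (simp add: twist_along_def)
  have off: "twist_along e z = z" if "z \<notin> ?E" for z
    using that by (simp add: twist_along_def)
  have hcont: "continuous_on ?E ?h"
    using e by (intro continuous_on_inv) auto
  have him: "?h z \<in> ?B" "e (?h z) = z" if "z \<in> ?E" for z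
    using that by (rule inv_into_into, rule f_inv_into_f)
  have "open (e ` ball 0 1)"
    by (rule invariance_of_domain)
       (use e in \<open>auto intro: continuous_on_subset inj_on_subset\<close>)
  then have sub: "e ` ball 0 1 \<subseteq> interior ?E"
    by (intro interior_maximal image_mono) auto
  have fix_frontier: "twist_along e z = z" if "z \<notin> interior ?E" for z
  proof (cases "z \<in> ?E")
    case True
    then obtain w where w: "w \<in> ?B" "z = e w" by auto
    with that sub have "norm w = 1" by (force simp: subset_iff)
    then show ?thesis using on[OF w(1)] w by (simp add: model_twist_boundary)
  qed (simp add: off)
  have "compact ?E" by (rule compact_continuous_image) (use e in auto)
  then have cE: "closed ?E" by (rule compact_imp_closed)
  have "continuous_on ?E (\<lambda>z. e (model_twist (?h z)))"
    by (rule continuous_on_compose2[OF e(1)], rule continuous_on_compose2[OF continuous_on_model_twist[of UNIV]])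
       (use hcont him in auto)
  then have c1: "continuous_on ?E (twist_along e)"
    by (rule continuous_on_eq) (simp add: twist_along_def)
  have c2: "continuous_on (- interior ?E) (twist_along e)"
    by (rule continuous_on_eq[OF continuous_on_id]) (simp add: fix_frontier)
  have "continuous_on (?E \<union> - interior ?E) (twist_along e)"
    by (rule continuous_on_closed_Un[OF cE _ c1 c2]) auto
  moreover have "?E \<union> - interior ?E = UNIV" using interior_subset by auto
  ultimately show "continuous_on ?B (twist_along e)" by (auto intro: continuous_on_subset)
  have tE: "bij_betw (twist_along e) ?E ?E"
  proof -
    have be: "bij_betw e ?B ?E" using e(2) by (simp add: bij_betw_def)
    have "bij_betw (e \<circ> model_twist \<circ> ?h) ?E ?E"
      by (intro bij_betw_trans[OF _ bij_betw_trans[OF bij_betw_model_twist be], unfolded comp_assoc]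
            bij_betw_inv_into be[THEN bij_betw_inv_into, unfolded comp_def]
          | simp add: comp_assoc)+
    then show ?thesis by (rule bij_betw_cong[THEN iffD1, rotated]) (simp add: twist_along_def)
  qed
  have tC: "bij_betw (twist_along e) (?B - ?E) (?B - ?E)"
    by (rule bij_betw_cong[THEN iffD1, OF _ bij_betw_id]) (auto simp: off)
  have "bij_betw (twist_along e) (?E \<union> (?B - ?E)) (?E \<union> (?B - ?E))"
    by (rule bij_betw_combine[OF tE tC]) auto
  moreover have "?E \<union> (?B - ?E) = ?B" using e(3) by force
  ultimately have "bij_betw (twist_along e) ?B ?B" by metis
  then show "inj_on (twist_along e) ?B" "twist_along e ` ?B = ?B" by (auto simp: bij_betw_def)
  show "twist_along e z = z" if "z \<notin> ball 0 1" for z using that e(3) by (intro off) auto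
  have "twist_along e (e (1/2)) = e (- 1/2)" "twist_along e (e (- 1/2)) = e (1/2)"
    using on[of "1/2"] on[of "- (1/2)"] by simp_all
  then have 1: "twist_along e ` {e (1/2), e (- 1/2)} = {e (1/2), e (- 1/2)}" by auto
  have 2: "twist_along e ` (marked_points n - ?E) = marked_points n - ?E"
    by (force simp: off)
  have "marked_points n = {e (1/2), e (- 1/2)} \<union> (marked_points n - ?E)" using P by auto
  then show "twist_along e ` marked_points n = marked_points n"
    by (metis 1 2 image_Un)
qed

lemma half_twist_in_braid_group: "half_twist n \<sigma> \<Longrightarrow> \<sigma> \<in> carrier (braid_group n)"
  by (auto simp: half_twist_def carrier_braid_group intro!: imageI twist_along_in_disc_homeos)

end

theory Submission
  imports Defs "HOL-Complex_Analysis.Complex_Analysis"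
begin

text \<open>The braid group acts on the crossed homomorphisms \<open>c\<close> of the fundamental group of the punctured
  plane with values in the rank one local system \<open>\<rho>\<close> that has monodromy \<open>q = exp (2 \<pi> i \<mu>)\<close> around
  each puncture: this is the reduced Burau representation at \<open>q\<close>, up to coboundaries. For
  \<open>\<mu> = 1/2 + 1/m\<close> a half-twist acts as a complex reflection whose nontrivial eigenvalue \<open>- q\<close> (or its
  inverse) is a primitive \<open>m\<close>-th root of unity, so the normal closure of its \<open>m\<close>-th power acts
  trivially. If this normal closure had finite index, the orbit of a crossed homomorphism would be
  finite, and summing over it would give an invariant positive semidefinite hermitian form. For three
  consecutive standard half-twists this form has, up to a factor, the Gram matrix of a path of length
  three with off-diagonal entry \<open>- 1 / (1 + q)\<close>, which is indefinite because \<open>|1 + q|\<^sup>2 < 2\<close>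
  for \<open>m \<ge> 5\<close>.\<close>

section \<open>Crossed homomorphisms of a punctured plane\<close>

text \<open>The half-twist runs along an arbitrary embedded disc, and neither a conjugacy with a
  standard generator nor a presentation of the braid group enters. That its \<open>m\<close>-th
  power acts trivially is proved for each disc directly: loops avoiding the core of the disc are not
  moved, and one further loop decides the rest. Since the embedding may reverse the orientation, the
  factor is known up to inversion only, and the estimates cover both cases. The choice of \<mu>
  gives - q = exp (2 \<pi> i / m), so |1 + q|^2 = 2 - 2 cos (2 \<pi> / m), which is less than 2 for
  m \<ge> 5. Three consecutive half-twists take four marked points, whence n \<ge> 4. The
  eigenvector of the half-twist s of the \<open>j\<close>-th disc is the functional that evaluates c
  o s - c on a loop through the \<open>j\<close>-th gap. Indefiniteness of the form only says that
  such functionals vanish on a finite orbit, so a crossed homomorphism with a nonzero value is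
  needed. It counts crossings of a half-line, weighted by the sheet of the cyclic cover in which
  they occur; a finite cover of degree 2 m suffices because q is a root of unity of order dividing 2
  m.\<close>

definition path_in :: "complex set \<Rightarrow> (real \<Rightarrow> complex) \<Rightarrow> bool" where
  "path_in S p \<longleftrightarrow> path p \<and> path_image p \<subseteq> S"

lemma path_in_join [simp]:
  "pathfinish p = pathstart q \<Longrightarrow> path_in S (p +++ q) \<longleftrightarrow> path_in S p \<and> path_in S q"
  by (auto simp: path_in_def path_image_join)

lemma path_in_reversepath [simp]: "path_in S (reversepath p) \<longleftrightarrow> path_in S p"
  by (simp add: path_in_def)

lemma path_in_linepath [simp]: "path_in S (linepath x y) \<longleftrightarrow> closed_segment x y \<subseteq> S"
  by (simp add: path_in_def)

lemma path_in_mono: "path_in S p \<Longrightarrow> S \<subseteq> T \<Longrightarrow> path_in T p"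
  by (auto simp: path_in_def)

lemma path_in_subpath:
  "path_in S p \<Longrightarrow> u \<in> {0..1} \<Longrightarrow> v \<in> {0..1} \<Longrightarrow> path_in S (subpath u v p)"
  unfolding path_in_def by (meson order_trans path_image_subpath_subset path_subpath)

lemma path_in_ends: "path_in S p \<Longrightarrow> pathstart p \<in> S \<and> pathfinish p \<in> S"
  unfolding path_in_def by (meson pathfinish_in_path_image pathstart_in_path_image subsetD)

lemma path_in_compose:
  "path_in S p \<Longrightarrow> continuous_on S f \<Longrightarrow> f ` S \<subseteq> T \<Longrightarrow> path_in T (f \<circ> p)"
  unfolding path_in_def path_image_compose
  by (meson continuous_on_subset image_mono order_trans path_continuous_image)

lemma path_in_homotopic:
  "homotopic_paths S p q \<Longrightarrow> path_in S p \<and> path_in S q"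
  unfolding path_in_def using homotopic_paths_imp_path homotopic_paths_imp_subset by blast

lemma path_connected_path_in:
  assumes "path_connected S" "x \<in> S" "y \<in> S"
  obtains p where "path_in S p" "pathstart p = x" "pathfinish p = y"
  using assms unfolding path_connected_def path_in_def by metis

lemma simply_connected_homotopic:
  assumes "simply_connected S" "path_in S p" "path_in S q"
    "pathstart p = pathstart q" "pathfinish p = pathfinish q"
  shows "homotopic_paths S p q"
  using assms unfolding simply_connected_eq_homotopic_paths path_in_def by metis

lemma path_connected_Compl_finite:
  assumes "finite (P :: complex set)" shows "path_connected (- P)"
  using path_connected_open_diff_countable[of UNIV P] assms
  by (simp add: Compl_eq_Diff_UNIV countable_finite connected_UNIV)

lemma homotopic_paths_cancel_middle:
  assumes A: "path_in S A" and t: "path_in S t" and q: "path_in S q"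
    and e: "pathfinish A = pathfinish t" "pathfinish t = pathstart q"
  shows "homotopic_paths S ((A +++ reversepath t) +++ (t +++ q)) (A +++ q)"
    (is "homotopic_paths S (?At +++ ?tq) _")
proof -
  note [simp] = e
  have P: "path A" "path_image A \<subseteq> S" "path t" "path_image t \<subseteq> S" "path q" "path_image q \<subseteq> S"
    using A t q by (auto simp: path_in_def)
  note J = subset_path_image_join
  have r: "homotopic_paths S q q" "homotopic_paths S A A"
    using P by simp_all
  have 1: "homotopic_paths S (?At +++ t) (A +++ (reversepath t +++ t))"
    by (rule homotopic_paths_sym, rule homotopic_paths_assoc) (use P in \<open>simp_all add: J\<close>)
  have 2: "homotopic_paths S (A +++ (reversepath t +++ t)) (A +++ linepath (pathfinish t) (pathfinish t))"
    by (rule homotopic_paths_join) (use P homotopic_paths_linv[of t S] in \<open>simp_all add: J\<close>)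
  have 3: "homotopic_paths S (A +++ linepath (pathfinish t) (pathfinish t)) A"
    by (rule homotopic_paths_rid') (use P in \<open>simp_all add: J\<close>)
  have 4: "homotopic_paths S (?At +++ t) A"
    using 1 2 3 homotopic_paths_trans by blast
  have 5: "homotopic_paths S (?At +++ ?tq) ((?At +++ t) +++ q)"
    by (rule homotopic_paths_assoc) (use P in \<open>simp_all add: J\<close>)
  have 6: "homotopic_paths S ((?At +++ t) +++ q) (A +++ q)"
    by (rule homotopic_paths_join[OF 4 r(1)]) auto
  show ?thesis by (rule homotopic_paths_trans[OF 5 6])
qed

text \<open>The shape of a product of two paths that were closed up by connecting paths: in the
  middle, \<open>t\<close> is run backwards and then forwards.\<close>

lemma homotopic_paths_cancel:
  assumes A: "path_in S A" and t: "path_in S t" and q: "path_in S q" and w: "path_in S w"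
    and e: "pathfinish A = pathfinish t" "pathfinish t = pathstart q" "pathfinish q = pathstart w"
  shows "homotopic_paths S ((A +++ reversepath t) +++ ((t +++ q) +++ w)) ((A +++ q) +++ w)"
    (is "homotopic_paths S (?At +++ (?tq +++ w)) _")
proof -
  note [simp] = e
  have P: "path A" "path_image A \<subseteq> S" "path t" "path_image t \<subseteq> S" "path q" "path_image q \<subseteq> S"
    "path w" "path_image w \<subseteq> S"
    using A t q w by (auto simp: path_in_def)
  note J = subset_path_image_join
  have 7: "homotopic_paths S ((?At +++ ?tq) +++ w) ((A +++ q) +++ w)"
    by (rule homotopic_paths_join[OF homotopic_paths_cancel_middle[OF A t q]]) (use P in auto)
  have 8: "homotopic_paths S (?At +++ (?tq +++ w)) ((?At +++ ?tq) +++ w)"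
    by (rule homotopic_paths_assoc) (use P in \<open>simp_all add: J\<close>)
  show ?thesis by (rule homotopic_paths_trans[OF 8 7])
qed

section \<open>The rank one local system, its crossed homomorphisms and flat sections\<close>

locale punctured_plane =
  fixes P :: "complex set" and \<mu> :: real
  assumes finite_P: "finite P"
begin

text \<open>Open paths are allowed, for which a winding number need not be an integer. Thus \<rho>
  is multiplicative on the whole fundamental groupoid: it is the factor by which a branch of the
  product of all (z - p)^\<mu> changes along the path.\<close>

definition turns :: "(real \<Rightarrow> complex) \<Rightarrow> complex" where
  "turns g = (\<Sum>p\<in>P. winding_number g p)"

definition \<rho> :: "(real \<Rightarrow> complex) \<Rightarrow> complex" where
  "\<rho> g = exp (2 * of_real pi * \<i> * of_real \<mu> * turns g)"

definition loop_at :: "complex \<Rightarrow> (real \<Rightarrow> complex) \<Rightarrow> bool" where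
  "loop_at b g \<longleftrightarrow> path_in (- P) g \<and> pathstart g = b \<and> pathfinish g = b"

definition crossed_at :: "complex \<Rightarrow> ((real \<Rightarrow> complex) \<Rightarrow> complex) \<Rightarrow> bool" where
  "crossed_at b c \<longleftrightarrow>
     (\<forall>g h. loop_at b g \<longrightarrow> loop_at b h \<longrightarrow> homotopic_paths (- P) g h \<longrightarrow> c g = c h) \<and>
     (\<forall>g h. loop_at b g \<longrightarrow> loop_at b h \<longrightarrow> c (g +++ h) = c g + \<rho> g * c h)"

text \<open>The version on the fundamental groupoid, in which a loop can be cut into open pieces and
  evaluated piece by piece.\<close>

definition crossed :: "((real \<Rightarrow> complex) \<Rightarrow> complex) \<Rightarrow> bool" where
  "crossed c \<longleftrightarrow>
     (\<forall>p q. homotopic_paths (- P) p q \<longrightarrow> c p = c q) \<and>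
     (\<forall>p q. path_in (- P) p \<longrightarrow> path_in (- P) q \<longrightarrow> pathfinish p = pathstart q \<longrightarrow>
        c (p +++ q) = c p + \<rho> p * c q)"

lemma path_in_avoid: "path_in (- P) p \<Longrightarrow> x \<in> P \<Longrightarrow> path p \<and> x \<notin> path_image p"
  by (auto simp: path_in_def)

lemma turns_homotopic: "homotopic_paths (- P) p q \<Longrightarrow> turns p = turns q"
  unfolding turns_def
  by (rule sum.cong[OF refl], rule winding_number_homotopic_paths) (auto elim: homotopic_paths_subset)

lemma \<rho>_homotopic: "homotopic_paths (- P) p q \<Longrightarrow> \<rho> p = \<rho> q"
  by (simp add: \<rho>_def turns_homotopic)

lemma turns_join:
  "path_in (- P) p \<Longrightarrow> path_in (- P) q \<Longrightarrow> pathfinish p = pathstart q \<Longrightarrow> turns (p +++ q) = turns p + turns q"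
  unfolding turns_def sum.distrib[symmetric]
  by (rule sum.cong[OF refl], rule winding_number_join) (auto dest: path_in_avoid)

lemma \<rho>_join:
  "path_in (- P) p \<Longrightarrow> path_in (- P) q \<Longrightarrow> pathfinish p = pathstart q \<Longrightarrow> \<rho> (p +++ q) = \<rho> p * \<rho> q"
  by (simp add: \<rho>_def turns_join ring_distribs exp_add)

lemma turns_reversepath: "path_in (- P) p \<Longrightarrow> turns (reversepath p) = - turns p"
  unfolding turns_def sum_negf[symmetric]
  by (rule sum.cong[OF refl], rule winding_number_reversepath) (auto dest: path_in_avoid)

lemma \<rho>_reversepath: "path_in (- P) p \<Longrightarrow> \<rho> (reversepath p) = inverse (\<rho> p)"
  by (simp add: \<rho>_def turns_reversepath exp_minus)

lemma \<rho>_nonzero [simp]: "\<rho> p \<noteq> 0" "inverse (\<rho> p) * \<rho> p = 1" "\<rho> p * inverse (\<rho> p) = 1"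
  by (simp_all add: \<rho>_def)

lemma \<rho>_const [simp]: "x \<notin> P \<Longrightarrow> \<rho> (linepath x x) = 1"
  unfolding \<rho>_def turns_def by (subst sum.neutral) (auto intro!: winding_number_trivial)

lemma loop_atD:
  "loop_at b g \<Longrightarrow> path_in (- P) g" "loop_at b g \<Longrightarrow> pathstart g = b" "loop_at b g \<Longrightarrow> pathfinish g = b"
  by (auto simp: loop_at_def)

lemma loop_at_join: "loop_at b g \<Longrightarrow> loop_at b h \<Longrightarrow> loop_at b (g +++ h)"
  by (simp add: loop_at_def)

lemma loop_at_const: "b \<notin> P \<Longrightarrow> loop_at b (linepath b b)"
  by (simp add: loop_at_def)

lemma loop_at_homotopic:
  "homotopic_paths (- P) g h \<Longrightarrow> loop_at b g \<Longrightarrow> loop_at b h"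
  unfolding loop_at_def
  by (metis path_in_homotopic homotopic_paths_imp_pathstart homotopic_paths_imp_pathfinish)

lemma crossed_at_homotopic:
  "crossed_at b c \<Longrightarrow> homotopic_paths (- P) g h \<Longrightarrow> loop_at b g \<Longrightarrow> c g = c h"
  using loop_at_homotopic unfolding crossed_at_def by metis

lemma crossed_at_join: "crossed_at b c \<Longrightarrow> loop_at b g \<Longrightarrow> loop_at b h \<Longrightarrow> c (g +++ h) = c g + \<rho> g * c h"
  unfolding crossed_at_def by blast

lemma crossed_at_const:
  assumes c: "crossed_at b c" and b: "b \<notin> P"
  shows "c (linepath b b) = 0"
proof -
  have l: "loop_at b (linepath b b)" by (rule loop_at_const[OF b])
  have "homotopic_paths (- P) (linepath b b +++ linepath b b) (linepath b b)"
    by (rule homotopic_paths_rid') (use b in auto)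
  from crossed_at_homotopic[OF c this] crossed_at_join[OF c l l] loop_at_join[OF l l]
  show ?thesis using b by simp
qed

lemma crossed_homotopic: "crossed c \<Longrightarrow> homotopic_paths (- P) p q \<Longrightarrow> c p = c q"
  unfolding crossed_def by blast

lemma crossed_join:
  "crossed c \<Longrightarrow> path_in (- P) p \<Longrightarrow> path_in (- P) q \<Longrightarrow> pathfinish p = pathstart q \<Longrightarrow>
    c (p +++ q) = c p + \<rho> p * c q"
  unfolding crossed_def by blast

lemma crossed_imp_crossed_at: "crossed c \<Longrightarrow> crossed_at b c"
  unfolding crossed_def crossed_at_def loop_at_def by metis

lemma crossed_const: "crossed c \<Longrightarrow> b \<notin> P \<Longrightarrow> c (linepath b b) = 0"
  using crossed_at_const crossed_imp_crossed_at by blast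

lemma crossed_reversepath:
  assumes c: "crossed c" and p: "path_in (- P) p"
  shows "c (reversepath p) = - inverse (\<rho> p) * c p"
proof -
  have "pathstart p \<notin> P" using path_in_ends[OF p] by simp
  moreover have "homotopic_paths (- P) (p +++ reversepath p) (linepath (pathstart p) (pathstart p))"
    by (rule homotopic_paths_rinv) (use p in \<open>auto simp: path_in_def\<close>)
  ultimately have "c p + \<rho> p * c (reversepath p) = 0"
    using crossed_join[OF c p, of "reversepath p"] crossed_homotopic[OF c] crossed_const[OF c] p by simp
  then show ?thesis by (simp add: field_simps add_eq_0_iff)
qed

text \<open>Connect \<open>b\<close> with every point \<open>x\<close> by a path \<open>t x\<close>,
  close up \<open>p\<close> to the loop \<open>L p\<close>, and divide by \<rho> of the initial
  connecting path. This normalisation turns the cocycle rule for \<open>L p\<close> and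
  \<open>L q\<close> into the one for \<open>p\<close> and \<open>q\<close>.\<close>

lemma crossed_extend:
  assumes c: "crossed_at b c" and b: "b \<notin> P"
  obtains c' where "crossed c'" "\<And>g. loop_at b g \<Longrightarrow> c' g = c g"
proof -
  \<comment> \<open>The constant path at \<open>b\<close> makes the extension agree with
    \<open>c\<close> on loops exactly, and not merely up to a coboundary.\<close>
  have "\<exists>t. path_in (- P) t \<and> pathstart t = b \<and> pathfinish t = x \<and> (x = b \<longrightarrow> t = linepath b b)"
    if "x \<notin> P" for x
  proof (cases "x = b")
    case True
    then show ?thesis using b by (intro exI[of _ "linepath b b"]) simp
  next
    case False
    then show ?thesis
      using path_connected_path_in[OF path_connected_Compl_finite[OF finite_P], of b x] b that
      by (metis ComplI)
  qed
  then obtain t where t: "\<And>x. x \<notin> P \<Longrightarrow> path_in (- P) (t x)" "\<And>x. x \<notin> P \<Longrightarrow> pathstart (t x) = b"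
    "\<And>x. x \<notin> P \<Longrightarrow> pathfinish (t x) = x" and tb: "t b = linepath b b"
    using b by metis
  define L where "L p = (t (pathstart p) +++ p) +++ reversepath (t (pathfinish p))" for p
  define c' where "c' p = c (L p) / \<rho> (t (pathstart p))" for p
  have L: "loop_at b (L p)" if "path_in (- P) p" for p
    using path_in_ends[OF that] that by (simp add: L_def loop_at_def t)
  have \<rho>L: "\<rho> (L p) = \<rho> (t (pathstart p)) * \<rho> p / \<rho> (t (pathfinish p))" if "path_in (- P) p" for p
    using path_in_ends[OF that] that
    by (simp add: L_def \<rho>_join t \<rho>_reversepath divide_inverse)
  have "crossed c'"
    unfolding crossed_def
  proof (intro conjI allI impI)
    fix p q assume pq: "homotopic_paths (- P) p q"
    have s: "pathstart p = pathstart q" "pathfinish p = pathfinish q"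
      using pq homotopic_paths_imp_pathstart homotopic_paths_imp_pathfinish by blast+
    have p: "path_in (- P) p" using path_in_homotopic[OF pq] by blast
    have "homotopic_paths (- P) (L p) (L q)"
      unfolding L_def s using path_in_ends[OF p] t pq
      by (intro homotopic_paths_join) (simp_all add: s path_in_def)
    then have "c (L p) = c (L q)" using crossed_at_homotopic[OF c _ L[OF p]] by blast
    then show "c' p = c' q" by (simp add: c'_def s)
  next
    fix p q assume p: "path_in (- P) p" and q: "path_in (- P) q" and s: "pathfinish p = pathstart q"
    note e = path_in_ends[OF p] path_in_ends[OF q]
    have "homotopic_paths (- P) (L p +++ L q) (((t (pathstart p) +++ p) +++ q) +++ reversepath (t (pathfinish q)))"
      unfolding L_def s by (rule homotopic_paths_cancel) (use p q s e t in simp_all)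
    also have "homotopic_paths (- P) \<dots> (L (p +++ q))"
      unfolding L_def pathstart_join pathfinish_join
      by (rule homotopic_paths_join[OF homotopic_paths_sym[OF homotopic_paths_assoc]])
         (use e p q s t in \<open>simp_all add: path_in_def\<close>)
    finally have "c (L (p +++ q)) = c (L p +++ L q)"
      using crossed_at_homotopic[OF c] loop_at_join[OF L[OF p] L[OF q]] by metis
    then show "c' (p +++ q) = c' p + \<rho> p * c' q"
      using crossed_at_join[OF c L[OF p] L[OF q]] \<rho>L[OF p]
      by (simp add: c'_def s field_simps)
  qed
  moreover have "c' g = c g" if g: "loop_at b g" for g
  proof -
    have l: "loop_at b (linepath b b)" by (rule loop_at_const[OF b])
    have "c' g = c ((linepath b b +++ g) +++ linepath b b)"
      using g b by (simp add: c'_def L_def loop_at_def tb)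
    also have "\<dots> = c g"
      using crossed_at_join[OF c] loop_at_join l g b crossed_at_const[OF c b] by simp
    finally show ?thesis .
  qed
  ultimately show ?thesis using that by blast
qed

text \<open>A crossed map is a local system of affine lines; \<open>flat\<close> says that \<open>a\<close> is a flat section
  of it over \<open>U\<close>.\<close>

definition flat :: "((real \<Rightarrow> complex) \<Rightarrow> complex) \<Rightarrow> complex set \<Rightarrow> (complex \<Rightarrow> complex) \<Rightarrow> bool" where
  "flat c U a \<longleftrightarrow> (\<forall>p. path_in U p \<longrightarrow> c p + \<rho> p * a (pathfinish p) = a (pathstart p))"

lemma flat_mono: "flat c U a \<Longrightarrow> V \<subseteq> U \<Longrightarrow> flat c V a"
  unfolding flat_def using path_in_mono by blast

lemma flat_cong: "flat c U a \<Longrightarrow> (\<And>x. x \<in> U \<Longrightarrow> a x = a' x) \<Longrightarrow> flat c U a'"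
  unfolding flat_def using path_in_ends by metis

lemma flat_unique:
  assumes "flat c U a" "flat c U a'" "path_connected U" "x \<in> U" "a x = a' x" "y \<in> U"
  shows "a y = a' y"
proof -
  obtain p where "path_in U p" "pathstart p = y" "pathfinish p = x"
    using path_connected_path_in[OF assms(3) assms(6,4)] .
  then show ?thesis using assms unfolding flat_def by metis
qed

text \<open>Transport \<open>a0\<close> along any path to \<open>x\<close>; the condition on the
  loops at \<open>x\<close> makes the result independent of that path.\<close>

lemma flat_exists:
  assumes c: "crossed c" and U: "path_connected U" "U \<subseteq> - P" "x \<in> U"
    and loops: "\<And>p. path_in U p \<Longrightarrow> pathstart p = x \<Longrightarrow> pathfinish p = x \<Longrightarrow> c p + \<rho> p * a0 = a0"
  obtains a where "flat c U a" "a x = a0"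
proof -
  have "\<exists>t. path_in U t \<and> pathstart t = y \<and> pathfinish t = x" if "y \<in> U" for y
    using path_connected_path_in[OF U(1) that U(3)] by blast
  then obtain t where t: "\<And>y. y \<in> U \<Longrightarrow> path_in U (t y)" "\<And>y. y \<in> U \<Longrightarrow> pathstart (t y) = y"
    "\<And>y. y \<in> U \<Longrightarrow> pathfinish (t y) = x" by metis
  define a where "a y = c (t y) + \<rho> (t y) * a0" for y
  have *: "c p + \<rho> p * a0 = a (pathstart p)" if p: "path_in U p" and f: "pathfinish p = x" for p
  proof -
    define y where "y = pathstart p"
    have y: "y \<in> U" using path_in_ends[OF p] by (simp add: y_def)
    let ?q = "reversepath p +++ t y"
    have P: "path_in (- P) p" "path_in (- P) (t y)" using p t y U(2) path_in_mono by blast+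
    have "c ?q + \<rho> ?q * a0 = a0"
      by (rule loops) (use p t y f in \<open>simp_all add: y_def\<close>)
    then have "- (inverse (\<rho> p) * c p) + inverse (\<rho> p) * c (t y) + inverse (\<rho> p) * \<rho> (t y) * a0 = a0"
      using P t y by (simp add: crossed_join[OF c] crossed_reversepath[OF c] \<rho>_join \<rho>_reversepath y_def)
    then have "inverse (\<rho> p) * (c (t y) + \<rho> (t y) * a0 - c p) = inverse (\<rho> p) * (\<rho> p * a0)"
      by (simp add: algebra_simps)
    then have "c (t y) + \<rho> (t y) * a0 - c p = \<rho> p * a0"
      by (simp only: mult_cancel_left) simp
    then show ?thesis by (simp add: a_def y_def[symmetric] algebra_simps)
  qed
  have "flat c U a"
    unfolding flat_def
  proof (intro allI impI)
    fix p assume p: "path_in U p"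
    have y: "pathfinish p \<in> U" using path_in_ends[OF p] by simp
    have P: "path_in (- P) p" "path_in (- P) (t (pathfinish p))"
      using p t y U(2) path_in_mono by blast+
    from *[of "p +++ t (pathfinish p)"] p t y
    show "c p + \<rho> p * a (pathfinish p) = a (pathstart p)"
      using P by (simp add: crossed_join[OF c] \<rho>_join a_def algebra_simps)
  qed
  moreover have "a x = a0"
    using *[of "linepath x x"] U crossed_const[OF c, of x] by auto
  ultimately show ?thesis using that by blast
qed

lemma flat_simply_connected:
  assumes c: "crossed c" and U: "simply_connected U" "U \<subseteq> - P" "x \<in> U"
  obtains a where "flat c U a" "a x = a0"
proof (rule flat_exists[OF c simply_connected_imp_path_connected[OF U(1)] U(2,3)])
  fix p assume p: "path_in U p" "pathstart p = x" "pathfinish p = x"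
  have "homotopic_paths U p (linepath x x)"
    by (rule simply_connected_homotopic[OF U(1)]) (use p U in auto)
  then have "homotopic_paths (- P) p (linepath x x)"
    using U(2) homotopic_paths_subset by blast
  then have "c p = c (linepath x x)" "\<rho> p = \<rho> (linepath x x)"
    using crossed_homotopic[OF c] \<rho>_homotopic by auto
  then show "c p + \<rho> p * a0 = a0" using U crossed_const[OF c, of x] by auto
qed

text \<open>The transport equation is compatible with concatenation and holds on short subpaths, so
  the bisection principle \<open>Bolzano\<close> gives it on the whole path.\<close>

lemma flat_local:
  assumes c: "crossed c"
    and loc: "\<And>x. x \<notin> P \<Longrightarrow> \<exists>U. open U \<and> x \<in> U \<and> flat c U a"
  shows "flat c (- P) a"
  unfolding flat_def
proof (intro allI impI)
  fix p assume p: "path_in (- P) p"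
  have sub: "path_in (- P) (subpath u v p)" if "u \<in> {0..1}" "v \<in> {0..1}" for u v
    using path_in_subpath[OF p that] .
  \<comment> \<open>\<open>Bolzano\<close> demands the local property for all small intervals around
    a point, also those that leave the unit interval; the two guards make it vacuous there.\<close>
  define Q where "Q u v \<longleftrightarrow> (0 \<le> u \<longrightarrow> v \<le> 1 \<longrightarrow> c (subpath u v p) + \<rho> (subpath u v p) * a (p v) = a (p u))" for u v
  have "Q 0 1"
  proof (rule Bolzano)
    show "(0::real) \<le> 1" by simp
  next
    fix u v w assume trans: "Q u v" "Q v w" "u \<le> v" "v \<le> w"
    show "Q u w"
      unfolding Q_def
    proof (intro impI)
      assume uw: "0 \<le> u" "w \<le> 1"
      with trans have I: "u \<in> {0..1}" "v \<in> {0..1}" "w \<in> {0..1}" by auto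
      have "homotopic_paths (- P) (subpath u v p +++ subpath v w p) (subpath u w p)"
        by (rule homotopic_join_subpaths) (use p I in \<open>auto simp: path_in_def\<close>)
      moreover have "a (p u) = c (subpath u v p) + \<rho> (subpath u v p) * (c (subpath v w p) + \<rho> (subpath v w p) * a (p w))"
        using trans uw I unfolding Q_def by simp
      ultimately
      show "c (subpath u w p) + \<rho> (subpath u w p) * a (p w) = a (p u)"
        using crossed_homotopic[OF c] \<rho>_homotopic I
          crossed_join[OF c sub sub, of u v v w] \<rho>_join[OF sub sub, of u v v w]
        by (simp add: algebra_simps)
    qed
  next
    fix x :: real assume local: "0 \<le> x" "x \<le> 1"
    have "p x \<notin> P" using p local by (auto simp: path_in_def path_image_def image_subset_iff)
    then obtain U where U: "open U" "p x \<in> U" "flat c U a" using loc by blast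
    have "continuous_on {0..1} p" using p by (simp add: path_in_def path_def)
    then have "\<exists>d>0. \<forall>y\<in>{0..1}. dist y x < d \<longrightarrow> p y \<in> U"
      using U local unfolding continuous_on_iff
      by (metis atLeastAtMost_iff open_dist)
    then obtain d where d: "d > 0" "\<And>y. y \<in> {0..1} \<Longrightarrow> dist y x < d \<Longrightarrow> p y \<in> U" by blast
    have "Q u v" if "u \<le> x" "x \<le> v" "v - u < d" for u v
      unfolding Q_def
    proof (intro impI)
      assume uv: "0 \<le> u" "v \<le> 1"
      have "path_image (subpath u v p) \<subseteq> U"
        using that uv d by (auto simp: path_image_subpath dist_real_def)
      moreover have "path (subpath u v p)" using sub[of u v] that uv by (auto simp: path_in_def)
      ultimately have "path_in U (subpath u v p)" by (simp add: path_in_def)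
      then show "c (subpath u v p) + \<rho> (subpath u v p) * a (p v) = a (p u)"
        using U(3) unfolding flat_def by force
    qed
    then show "\<exists>d>0. \<forall>u v. u \<le> x \<and> x \<le> v \<and> v - u < d \<longrightarrow> Q u v" using d by blast
  qed
  then show "c p + \<rho> p * a (pathfinish p) = a (pathstart p)"
    by (simp add: Q_def subpath_trivial pathstart_def pathfinish_def)
qed

end

section \<open>An embedded disc with two punctures\<close>

text \<open>Up to sign the common end of all test paths. It must lie outside the core of radius
  9/16; the value 7/8 also keeps the chords from - T and T to 7/8 and - 7/8 outside it, as they come
  no closer to 0 than 7 / (8 sqrt 2).\<close>

definition T :: complex where "T = Complex 0 (7/8)"

lemma T_simps [simp]: "Re T = 0" "Im T = 7/8" "norm T = 7/8"
  by (simp_all add: T_def cmod_def)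

text \<open>The three slit discs cover the disc without the punctures 1/2 and - 1/2. Each lets the
  real axis be crossed in one place only: right of both punctures, left of both, or between
  them.\<close>

definition "slit_right = ball 0 1 - {z :: complex. Im z = 0 \<and> Re z \<le> 1/2}"
definition "slit_left = ball 0 1 - {z :: complex. Im z = 0 \<and> Re z \<ge> - 1/2}"
definition "slit_both = ball 0 1 - {z :: complex. Im z = 0 \<and> \<bar>Re z\<bar> \<ge> 1/2}"

lemma slit_left_eq: "slit_left = uminus ` slit_right"
proof -
  have "z \<in> slit_left \<longleftrightarrow> - z \<in> slit_right" for z
    by (auto simp: slit_left_def slit_right_def)
  moreover have "z \<in> uminus ` slit_right \<longleftrightarrow> - z \<in> slit_right" for z
    by (force simp: image_iff intro: bexI[of _ "- z"])
  ultimately show ?thesis by blast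
qed

lemma open_slit: "open slit_right" "open slit_left" "open slit_both"
  unfolding slit_right_def slit_left_def slit_both_def
  by (intro open_Diff open_ball closed_Collect_conj closed_Collect_eq closed_Collect_le continuous_intros)+

lemma simply_connected_slit:
  "simply_connected slit_right" "simply_connected slit_left" "simply_connected slit_both"
proof -
  have R: "closed_segment (7/8) x \<subseteq> slit_right" if x: "x \<in> slit_right" for x
  proof
    fix y assume y: "y \<in> closed_segment (7/8) x"
    then obtain u where u: "0 \<le> u" "u \<le> 1" "y = (1 - u) *\<^sub>R (7/8) + u *\<^sub>R x"
      by (auto simp: in_segment)
    have "closed_segment (7/8) x \<subseteq> ball 0 1"
      using x by (intro closed_segment_subset) (auto simp: slit_right_def)
    moreover have "\<not> (Im y = 0 \<and> Re y \<le> 1/2)"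
    proof
      assume *: "Im y = 0 \<and> Re y \<le> 1/2"
      then have "u = 0 \<or> Im x = 0" using u by auto
      then show False
      proof
        assume "u = 0" then show False using * u by simp
      next
        assume "Im x = 0"
        then have "Re x > 1/2" using x by (auto simp: slit_right_def)
        have "Re y - 1/2 = (1 - u) * (3/8) + u * (Re x - 1/2)"
          unfolding u(3) by (simp add: field_simps)
        moreover have "u * (Re x - 1/2) \<ge> 0" using u \<open>Re x > 1/2\<close> by simp
        ultimately have "(1 - u) * (3/8) \<le> 0" using * by linarith
        then
        have "u = 1" using u by auto
        then show False using * u \<open>Re x > 1/2\<close> by simp
      qed
    qed
    ultimately show "y \<in> slit_right" using y by (auto simp: slit_right_def)
  qed
  have "(7/8) \<in> slit_right" by (simp add: slit_right_def)
  then have S: "starlike slit_right" unfolding starlike_def using R by blast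
  then show "simply_connected slit_right" by (rule starlike_imp_simply_connected)
  have "starlike slit_left" unfolding slit_left_eq
    using S unfolding starlike_def
    by (metis (no_types, lifting) closed_segment_linear_image image_iff image_mono linear_uminus)
  then show "simply_connected slit_left" by (rule starlike_imp_simply_connected)
  have M: "closed_segment 0 x \<subseteq> slit_both" if x: "x \<in> slit_both" for x
  proof
    fix y assume y: "y \<in> closed_segment 0 x"
    then obtain u where u: "0 \<le> u" "u \<le> 1" "y = u *\<^sub>R x"
      by (auto simp: in_segment)
    have "closed_segment 0 x \<subseteq> ball 0 1"
      using x by (intro closed_segment_subset) (auto simp: slit_both_def)
    moreover have "\<not> (Im y = 0 \<and> \<bar>Re y\<bar> \<ge> 1/2)"
    proof
      assume *: "Im y = 0 \<and> \<bar>Re y\<bar> \<ge> 1/2"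
      then have "u = 0 \<or> Im x = 0" using u by auto
      moreover have "u \<noteq> 0" using * u by auto
      ultimately have "\<bar>Re x\<bar> < 1/2" using x by (auto simp: slit_both_def)
      moreover have "\<bar>Re y\<bar> \<le> \<bar>Re x\<bar>" using u by (simp add: abs_mult mult_left_le_one_le)
      ultimately show False using * by simp
    qed
    ultimately show "y \<in> slit_both" using y by (auto simp: slit_both_def)
  qed
  have "0 \<in> slit_both" by (simp add: slit_both_def)
  then have "starlike slit_both" unfolding starlike_def using M by blast
  then show "simply_connected slit_both" by (rule starlike_imp_simply_connected)
qed

definition "slit_annulus = {z \<in> slit_right. norm z > 9/16}"

lemma path_connected_slit_annulus: "path_connected slit_annulus"
proof -
  let ?S = "{9/16<..<1 :: real} \<times> {- pi<..<pi}" and ?f = "\<lambda>(r, \<phi>). of_real r * cis \<phi>"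
  have "slit_annulus = ?f ` ?S"
  proof (intro equalityI subsetI)
    fix z assume z: "z \<in> slit_annulus"
    then have n: "norm z > 9/16" "norm z < 1" "\<not> (Im z = 0 \<and> Re z \<le> 1/2)"
      by (auto simp: slit_annulus_def slit_right_def)
    have z0: "z \<noteq> 0" using n by auto
    have e: "z = of_real (norm z) * cis (Arg z)"
      using rcis_cmod_Arg[of z] by (simp add: rcis_def)
    have "Arg z \<noteq> pi"
    proof
      assume A: "Arg z = pi"
      then have "z = - of_real (norm z)" using e by simp
      then have "Im z = 0" "Re z = - norm z" by (metis Im_complex_of_real minus_complex.simps neg_0_equal_iff_equal uminus_complex.simps(2), metis Re_complex_of_real uminus_complex.simps(1))
      then show False using n by auto
    qed
    then have "Arg z \<in> {- pi<..<pi}" using Arg_bounded[of z] by auto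
    then show "z \<in> ?f ` ?S" using n e by (intro image_eqI[of _ _ "(norm z, Arg z)"]) auto
  next
    fix z assume "z \<in> ?f ` ?S"
    then obtain r \<phi> where r: "9/16 < r" "r < 1" "- pi < \<phi>" "\<phi> < pi" and z: "z = of_real r * cis \<phi>"
      by auto
    have n: "norm z = r" using r z by (simp add: norm_mult)
    have "\<not> (Im z = 0 \<and> Re z \<le> 1/2)"
    proof
      assume *: "Im z = 0 \<and> Re z \<le> 1/2"
      then have "sin \<phi> = 0" using r z by simp
      then have "\<phi> = 0" using r by (metis sin_eq_0_pi)
      then show False using * z r by simp
    qed
    then show "z \<in> slit_annulus" using n r by (auto simp: slit_annulus_def slit_right_def)
  qed
  moreover have "path_connected ?S"
    by (intro convex_imp_path_connected convex_Times) auto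
  moreover have "continuous_on ?S ?f"
    unfolding case_prod_unfold cis_conv_exp by (intro continuous_intros)
  ultimately show ?thesis using path_connected_continuous_image by metis
qed

section \<open>Gluing flat sections around an embedded disc\<close>

locale embedded_disc = punctured_plane P \<mu> for P \<mu> +
  fixes e :: "complex \<Rightarrow> complex" and b :: complex
  assumes continuous_e: "continuous_on (cball 0 1) e" and inj_e: "inj_on e (cball 0 1)"
    and e_P: "e ` cball 0 1 \<inter> P = {e (1/2), e (- 1/2)}"
    and b: "b \<notin> P" "b \<notin> e ` cball 0 1"
begin

text \<open>The core of radius 9/16 contains both punctures of the disc, which have radius 1/2, and
  everything that the twist still moves once it is squeezed to \<open>core_twist\<close>.\<close>

definition "outside_core = - P - e ` cball 0 (9/16)"

lemma e_eq_iff: "z \<in> cball 0 1 \<Longrightarrow> w \<in> cball 0 1 \<Longrightarrow> e z = e w \<longleftrightarrow> z = w"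
  using inj_e by (auto simp: inj_on_def)

lemma e_in_P_iff: "z \<in> cball 0 1 \<Longrightarrow> e z \<in> P \<longleftrightarrow> z = 1/2 \<or> z = - 1/2"
proof -
  assume z: "z \<in> cball 0 1"
  have "e z \<in> P \<longleftrightarrow> e z = e (1/2) \<or> e z = e (- 1/2)" using z e_P by blast
  then show ?thesis using e_eq_iff z by simp
qed

lemma e_image_iff: "z \<in> cball 0 1 \<Longrightarrow> S \<subseteq> cball 0 1 \<Longrightarrow> e z \<in> e ` S \<longleftrightarrow> z \<in> S"
  using inj_e by (simp add: inj_on_image_mem_iff)

lemma slit_subset: "slit_right \<subseteq> cball 0 1" "slit_left \<subseteq> cball 0 1" "slit_both \<subseteq> cball 0 1"
  by (auto simp: slit_right_def slit_left_def slit_both_def)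

lemma punctures_notin_slit:
  "1/2 \<notin> slit_right" "- 1/2 \<notin> slit_right" "1/2 \<notin> slit_left" "- 1/2 \<notin> slit_left"
  "1/2 \<notin> slit_both" "- 1/2 \<notin> slit_both"
  by (auto simp: slit_right_def slit_left_def slit_both_def)

lemma e_slit_P: "e ` slit_right \<subseteq> - P" "e ` slit_left \<subseteq> - P" "e ` slit_both \<subseteq> - P"
  using e_in_P_iff slit_subset punctures_notin_slit by (blast dest: e_in_P_iff[THEN iffD1, rotated])+

lemma open_e: "open S \<Longrightarrow> S \<subseteq> ball 0 1 \<Longrightarrow> open (e ` S)"
  by (intro invariance_of_domain continuous_on_subset[OF continuous_e] inj_on_subset[OF inj_e])
     (use ball_subset_cball[of 0 1] in blast)+

lemma simply_connected_e: "simply_connected S \<Longrightarrow> S \<subseteq> cball 0 1 \<Longrightarrow> simply_connected (e ` S)"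
proof -
  assume S: "simply_connected S" "S \<subseteq> cball 0 1"
  have "compact (cball (0::complex) 1)" by simp
  then obtain g where "homeomorphism (cball 0 1) (e ` cball 0 1) e g"
    using homeomorphism_compact[OF _ continuous_e refl inj_e] by blast
  then have "homeomorphism S (e ` S) e g"
    by (rule homeomorphism_of_subsets) (use S in auto)
  then have "S homeomorphic e ` S" by (auto simp: homeomorphic_def)
  then show ?thesis using homeomorphic_simply_connected_eq S by blast
qed

text \<open>The substance is connectedness: an embedded compact disc does not separate the plane,
  and a connected open set stays path connected when finitely many points are removed.\<close>

lemma outside_core: "open outside_core" "path_connected outside_core" "b \<in> outside_core" "outside_core \<subseteq> - P"
proof -
  have sub: "cball 0 (9/16) \<subseteq> (cball 0 1 :: complex set)" by auto
  have c: "continuous_on (cball 0 (9/16)) e" "inj_on e (cball 0 (9/16))"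
    using continuous_on_subset[OF continuous_e sub] inj_on_subset[OF inj_e sub] by auto
  have "compact (e ` cball 0 (9/16))" using c by (intro compact_continuous_image) auto
  then have o: "open (- e ` cball 0 (9/16))" by (simp add: compact_imp_closed open_Compl)
  have eq: "outside_core = - e ` cball 0 (9/16) - P" by (auto simp: outside_core_def)
  show "open outside_core" unfolding eq using o finite_P by (simp add: finite_imp_closed open_Diff)
  have "compact (cball (0::complex) (9/16))" by simp
  then have "e ` cball 0 (9/16) homeomorphic cball (0::complex) (9/16)"
    using homeomorphism_compact[OF _ c(1) refl c(2)] homeomorphic_def homeomorphic_sym by blast
  then have "path_connected (- e ` cball 0 (9/16))"
    by (rule path_connected_complement_homeomorphic_convex_compact) auto
  then show "path_connected outside_core"
    unfolding eq using o finite_P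
    by (intro path_connected_open_diff_countable) (auto intro: path_connected_imp_connected countable_finite)
  show "b \<in> outside_core" "outside_core \<subseteq> - P" using b by (auto simp: outside_core_def)
qed

lemma e_in_outside_core: "z \<in> cball 0 1 \<Longrightarrow> norm z > 9/16 \<Longrightarrow> e z \<in> outside_core"
proof -
  assume z: "z \<in> cball 0 1" "norm z > 9/16"
  have "cball 0 (9/16) \<subseteq> (cball 0 1 :: complex set)" by auto
  then have "e z \<notin> e ` cball 0 (9/16)" using e_image_iff[of z "cball 0 (9/16)"] z by simp
  moreover have "z \<noteq> 1/2" "z \<noteq> - 1/2" using z(2) by (force simp: norm_divide)+
  ultimately show ?thesis using e_in_P_iff[of z] z by (simp add: outside_core_def)
qed

lemma T_in_slit: "T \<in> slit_right" "- T \<in> slit_right" "T \<in> slit_left" "- T \<in> slit_left"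
  "T \<in> slit_both" "- T \<in> slit_both"
  by (auto simp: slit_right_def slit_left_def slit_both_def norm_mult)

lemma e_T_outside: "e T \<in> outside_core" "e (- T) \<in> outside_core"
  by (rule e_in_outside_core; simp add: norm_mult)+

text \<open>Two different slit discs meet in the open upper and lower half-discs. These are
  connected and contain T and - T respectively, so agreement at these two points spreads to the
  whole overlap.\<close>

lemma flat_half_discs:
  assumes f: "flat c (e ` V) f" and g: "flat c (e ` W) g"
    and VW: "V \<in> {slit_right, slit_left, slit_both}" "W \<in> {slit_right, slit_left, slit_both}"
    and eq: "f (e T) = g (e T)" "f (e (- T)) = g (e (- T))"
    and z: "z \<in> V" "z \<in> W" "Im z \<noteq> 0"
  shows "f (e z) = g (e z)"
proof -
  have zb: "norm z < 1" using z VW by (auto simp: slit_right_def slit_left_def slit_both_def)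
  have *: "f (e z) = g (e z)"
    if H: "convex H" "H \<subseteq> ball 0 1" "H \<inter> {z. Im z = 0} = {}" "t \<in> H" "z \<in> H" "f (e t) = g (e t)" for H t
  proof -
    have sub: "H \<subseteq> V" "H \<subseteq> W" using H VW by (auto simp: slit_right_def slit_left_def slit_both_def)
    have "H \<subseteq> cball 0 1" using H(2) by auto
    then have "path_connected (e ` H)"
      using H(1) continuous_e continuous_on_subset
      by (intro path_connected_continuous_image convex_imp_path_connected) auto
    then show ?thesis
      using flat_unique[OF flat_mono[OF f image_mono[OF sub(1)]] flat_mono[OF g image_mono[OF sub(2)]]] H
      by blast
  qed
  show ?thesis
  proof (cases "Im z > 0")
    case True
    show ?thesis
      by (rule *[of "ball 0 1 \<inter> {z. Im z > 0}" T])
         (use True zb eq in \<open>auto simp: norm_mult convex_halfspace_Im_gt intro!: convex_Int\<close>)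
  next
    case False
    show ?thesis
      by (rule *[of "ball 0 1 \<inter> {z. Im z < 0}" "- T"])
         (use False z zb eq in \<open>auto simp: norm_mult convex_halfspace_Im_lt intro!: convex_Int\<close>)
  qed
qed

text \<open>A van Kampen argument: the loops outside the core of the disc, together with one loop passing
  between the two punctures of the disc, generate the fundamental group.\<close>

lemma crossed_vanish:
  assumes c: "crossed c"
    and out: "\<And>p. path_in outside_core p \<Longrightarrow> pathstart p = b \<Longrightarrow> pathfinish p = b \<Longrightarrow> c p = 0"
    and d: "path_in outside_core d" "pathstart d = b" "pathfinish d = e (- T)"
    and d': "path_in outside_core d'" "pathstart d' = e T" "pathfinish d' = b"
    and C: "path_in slit_both C" "pathstart C = - T" "pathfinish C = T"
    and k: "c (d +++ ((e \<circ> C) +++ d')) = 0"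
    and g: "loop_at b g"
  shows "c g = 0"
proof -
  \<comment> \<open>By \<open>out\<close>, the value 0 at \<open>b\<close> is preserved by all loops
    outside the core. The sections over the slit discs are normalised to agree with
    \<open>a0\<close> at \<open>e (- T)\<close>; their agreement at \<open>e T\<close> has to be
    proved.\<close>
  obtain a0 where a0: "flat c outside_core a0" "a0 b = 0"
    by (rule flat_exists[OF c outside_core(2,4,3), of 0]) (use out in auto)
  have sc: "simply_connected (e ` slit_right)" "simply_connected (e ` slit_left)" "simply_connected (e ` slit_both)"
    using simply_connected_e simply_connected_slit slit_subset by auto
  obtain aR where aR: "flat c (e ` slit_right) aR" "aR (e (- T)) = a0 (e (- T))"
    using flat_simply_connected[OF c sc(1) e_slit_P(1)] T_in_slit by blast
  obtain aL where aL: "flat c (e ` slit_left) aL" "aL (e (- T)) = a0 (e (- T))"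
    using flat_simply_connected[OF c sc(2) e_slit_P(2)] T_in_slit by blast
  obtain aM where aM: "flat c (e ` slit_both) aM" "aM (e (- T)) = a0 (e (- T))"
    using flat_simply_connected[OF c sc(3) e_slit_P(3)] T_in_slit by blast
  have eC: "path_in (e ` slit_both) (e \<circ> C)"
    by (rule path_in_compose[OF C(1)]) (use slit_subset continuous_e continuous_on_subset in auto)
  have P: "path_in (- P) d" "path_in (- P) d'" "path_in (- P) (e \<circ> C)"
    using path_in_mono[OF d(1) outside_core(4)] path_in_mono[OF d'(1) outside_core(4)]
      path_in_mono[OF eC e_slit_P(3)] by simp_all
  have ends: "pathstart (e \<circ> C) = e (- T)" "pathfinish (e \<circ> C) = e T"
    using C by (simp_all add: pathstart_compose pathfinish_compose)
  \<comment> \<open>Here \<open>k\<close> enters: transport from \<open>e (- T)\<close> to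
    \<open>e T\<close> between the punctures agrees with transport outside the core.\<close>
  have "aM (e T) = a0 (e T)"
  proof -
    have 1: "c d + \<rho> d * a0 (e (- T)) = 0" using a0 d unfolding flat_def by metis
    have 2: "c d' = a0 (e T)" using a0 d' unfolding flat_def by (metis add.right_neutral mult_zero_right)
    have 3: "c (e \<circ> C) + \<rho> (e \<circ> C) * aM (e T) = a0 (e (- T))"
      using aM eC ends unfolding flat_def by metis
    have "c ((e \<circ> C) +++ d') = c (e \<circ> C) + \<rho> (e \<circ> C) * c d'"
      by (rule crossed_join[OF c]) (use P d' ends in simp_all)
    moreover have "c (d +++ ((e \<circ> C) +++ d')) = c d + \<rho> d * c ((e \<circ> C) +++ d')"
      by (rule crossed_join[OF c]) (use P d d' ends in simp_all)
    ultimately have 4: "c d + \<rho> d * (c (e \<circ> C) + \<rho> (e \<circ> C) * a0 (e T)) = 0"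
      using k 2 by simp
    have "\<rho> d * \<rho> (e \<circ> C) * (a0 (e T) - aM (e T)) =
        (c d + \<rho> d * (c (e \<circ> C) + \<rho> (e \<circ> C) * a0 (e T))) - (c d + \<rho> d * a0 (e (- T)))
        + \<rho> d * (a0 (e (- T)) - (c (e \<circ> C) + \<rho> (e \<circ> C) * aM (e T)))"
      by (simp add: algebra_simps)
    then have "\<rho> d * \<rho> (e \<circ> C) * (a0 (e T) - aM (e T)) = 0"
      unfolding 1 3 4 by simp
    then show ?thesis by simp
  qed
  note aM = aM this
  \<comment> \<open>On the right and on the left, agreement at \<open>e T\<close> is automatic,
    because the part of the slit disc outside the core is connected and contains both T and -
    T.\<close>
  have aR0: "aR x = a0 x" if "x \<in> e ` slit_annulus" for x
  proof (rule flat_unique[OF flat_mono[OF aR(1)] flat_mono[OF a0(1)] _ _ aR(2) that])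
    show "path_connected (e ` slit_annulus)"
      by (intro path_connected_continuous_image path_connected_slit_annulus continuous_on_subset[OF continuous_e])
         (auto simp: slit_annulus_def slit_right_def)
    show "e (- T) \<in> e ` slit_annulus"
      using T_in_slit by (auto simp: slit_annulus_def norm_mult)
    show "e ` slit_annulus \<subseteq> e ` slit_right" by (auto simp: slit_annulus_def)
    show "e ` slit_annulus \<subseteq> outside_core"
    proof clarify
      fix z assume "z \<in> slit_annulus"
      then have "norm z < 1" "norm z > 9/16" by (auto simp: slit_annulus_def slit_right_def)
      then show "e z \<in> outside_core" by (intro e_in_outside_core) simp_all
    qed
  qed
  have aL0: "aL x = a0 x" if "x \<in> e ` uminus ` slit_annulus" for x
  proof (rule flat_unique[OF flat_mono[OF aL(1)] flat_mono[OF a0(1)] _ _ aL(2) that])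
    show "path_connected (e ` uminus ` slit_annulus)"
      by (intro path_connected_continuous_image path_connected_slit_annulus continuous_on_subset[OF continuous_e] continuous_intros)
         (auto simp: slit_annulus_def slit_right_def)
    show "e (- T) \<in> e ` uminus ` slit_annulus"
      using T_in_slit by (auto simp: slit_annulus_def norm_mult)
    show "e ` uminus ` slit_annulus \<subseteq> e ` slit_left"
      by (auto simp: slit_left_eq slit_annulus_def)
    show "e ` uminus ` slit_annulus \<subseteq> outside_core"
    proof clarify
      fix z assume "z \<in> slit_annulus"
      then have "norm z < 1" "norm z > 9/16" by (auto simp: slit_annulus_def slit_right_def)
      then show "e (- z) \<in> outside_core" by (intro e_in_outside_core) simp_all
    qed
  qed
  have aRT: "aR (e T) = a0 (e T)"
    by (rule aR0) (use T_in_slit in \<open>auto simp: slit_annulus_def norm_mult\<close>)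
  have aLT: "aL (e T) = a0 (e T)"
    by (rule aL0) (use T_in_slit in \<open>auto simp: slit_annulus_def norm_mult image_iff intro!: bexI[of _ "- T"]\<close>)
  \<comment> \<open>The local sections agree wherever two of their domains overlap, as
    \<open>RL\<close> to \<open>M0\<close> show, so the order of the cases does not affect the
    value.\<close>
  define a where "a x = (if x \<in> outside_core then a0 x else if x \<in> e ` slit_right then aR x
    else if x \<in> e ` slit_left then aL x else aM x)" for x
  have RL: "aR (e z) = aL (e z)" if "z \<in> slit_right" "z \<in> slit_left" for z
    by (rule flat_half_discs[OF aR(1) aL(1) _ _ _ _ that])
       (use aRT aLT aR(2) aL(2) that in \<open>auto simp: slit_right_def slit_left_def\<close>)
  have RM: "aR (e z) = aM (e z)" if "z \<in> slit_right" "z \<in> slit_both" for z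
    by (rule flat_half_discs[OF aR(1) aM(1) _ _ _ _ that])
       (use aRT aM(3) aR(2) aM(2) that in \<open>auto simp: slit_right_def slit_both_def\<close>)
  have LM: "aL (e z) = aM (e z)" if "z \<in> slit_left" "z \<in> slit_both" for z
    by (rule flat_half_discs[OF aL(1) aM(1) _ _ _ _ that])
       (use aLT aM(3) aL(2) aM(2) that in \<open>auto simp: slit_left_def slit_both_def\<close>)
  have norm_out: "norm z > 9/16" if "z \<in> cball 0 1" "e z \<in> outside_core" for z
  proof (rule ccontr)
    assume "\<not> norm z > 9/16"
    then have "z \<in> cball 0 (9/16)" by simp
    then show False using that(2) unfolding outside_core_def by blast
  qed
  have R0: "aR (e z) = a0 (e z)" if "z \<in> slit_right" "e z \<in> outside_core" for z
    using norm_out[of z] that slit_subset(1) aR0[of "e z"] by (auto simp: slit_annulus_def)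
  have L0: "aL (e z) = a0 (e z)" if "z \<in> slit_left" "e z \<in> outside_core" for z
    using norm_out[of z] that slit_subset(2) aL0[of "e z"] by (auto simp: slit_annulus_def slit_left_eq)
  have M0: "aM (e z) = a0 (e z)" if "z \<in> slit_both" "e z \<in> outside_core" for z
  proof -
    have "norm z > 9/16" using norm_out[of z] that slit_subset(3) by auto
    then have "z \<in> slit_right \<or> Im z = 0" using that by (auto simp: slit_right_def slit_both_def)
    \<comment> \<open>On the real axis \<open>slit_both\<close> stays within radius 1/2, hence
      inside the core.\<close>
    moreover have "Im z \<noteq> 0"
    proof
      assume "Im z = 0"
      then have "norm z = \<bar>Re z\<bar>" by (simp add: cmod_def)
      then show False using \<open>norm z > 9/16\<close> \<open>Im z = 0\<close> that by (auto simp: slit_both_def)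
    qed
    ultimately show ?thesis using R0[of z] RM[of z] that by auto
  qed
  have e_mem: "e z \<in> e ` S \<longleftrightarrow> z \<in> S" if "z \<in> cball 0 1" "S \<in> {slit_right, slit_left, slit_both}" for z S
    using that e_image_iff[of z S] slit_subset by blast
  have aR': "aR x = a x" if "x \<in> e ` slit_right" for x
    using that R0 by (auto simp: a_def)
  have aL': "aL x = a x" if "x \<in> e ` slit_left" for x
  proof -
    obtain z where z: "z \<in> slit_left" "x = e z" using \<open>x \<in> e ` slit_left\<close> by blast
    have "z \<in> cball 0 1" using z slit_subset by blast
    then show ?thesis using z L0[of z] RL[of z] e_mem[of z] by (simp add: a_def)
  qed
  have aM': "aM x = a x" if "x \<in> e ` slit_both" for x
  proof -
    obtain z where z: "z \<in> slit_both" "x = e z" using \<open>x \<in> e ` slit_both\<close> by blast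
    have "z \<in> cball 0 1" using z slit_subset by blast
    then show ?thesis using z M0[of z] RM[of z] LM[of z] e_mem[of z] by (simp add: a_def)
  qed
  have fl: "flat c outside_core a" "flat c (e ` slit_right) a" "flat c (e ` slit_left) a" "flat c (e ` slit_both) a"
    by (rule flat_cong[OF a0(1)] flat_cong[OF aR(1) aR'] flat_cong[OF aL(1) aL'] flat_cong[OF aM(1) aM'];
        simp add: a_def)+
  have "flat c (- P) a"
  proof (rule flat_local[OF c])
    fix x assume x: "x \<notin> P"
    show "\<exists>U. open U \<and> x \<in> U \<and> flat c U a"
    proof (cases "x \<in> outside_core")
      case True
      then show ?thesis using outside_core fl by blast
    next
      case False
      then obtain z where z: "norm z \<le> 9/16" "x = e z" using x by (auto simp: outside_core_def)
      then have "z \<noteq> 1/2" "z \<noteq> - 1/2" using x e_in_P_iff[of z] by auto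
      then have "z \<in> slit_right \<or> z \<in> slit_left \<or> z \<in> slit_both"
        using z by (simp add: slit_right_def slit_left_def slit_both_def complex_eq_iff) linarith
      moreover have "open (e ` slit_right)" "open (e ` slit_left)" "open (e ` slit_both)"
        using open_e[OF open_slit(1)] open_e[OF open_slit(2)] open_e[OF open_slit(3)]
        by (simp_all add: slit_right_def slit_left_def slit_both_def)
      ultimately show ?thesis using fl z by blast
    qed
  qed
  \<comment> \<open>A global flat section that is 0 at \<open>b\<close> forces \<open>c\<close> to
    vanish on every loop at \<open>b\<close>.\<close>
  then have "c g + \<rho> g * a b = a b" using g unfolding flat_def loop_at_def by metis
  moreover have "a b = 0" using a0 outside_core by (simp add: a_def)
  ultimately show ?thesis by simp
qed

end

section \<open>The half-twist and a path between the punctures\<close>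

text \<open>The angle is \<pi> up to radius 1/2 and reaches 0 at radius 9/16. While
  \<open>model_twist\<close> moves points right up to the unit circle, this map fixes everything
  outside the core.\<close>

definition core_twist :: "complex \<Rightarrow> complex" where
  "core_twist z = z * cis (pi * min 1 (max 0 (9 - 16 * norm z)))"

definition twist_with :: "(complex \<Rightarrow> complex) \<Rightarrow> (complex \<Rightarrow> complex) \<Rightarrow> complex \<Rightarrow> complex" where
  "twist_with e F z = (if z \<in> e ` cball 0 1 then e (F (inv_into (cball 0 1) e z)) else z)"

lemma twist_along_eq: "twist_along e = twist_with e model_twist"
  by (simp add: fun_eq_iff twist_along_def twist_with_def)

text \<open>Continuity jointly in the parameter, as a homotopy requires. The closed pieces are the
  embedded disc and the complement of its interior; by invariance of domain they overlap only in the
  image of the unit circle, where \<open>F t\<close> is the identity.\<close>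

lemma continuous_on_twist_with:
  assumes e: "continuous_on (cball 0 1) e" "inj_on e (cball 0 1)"
    and F: "continuous_on (S \<times> cball 0 1) (\<lambda>(t, z). F t z)"
    and Fn: "\<And>t z. t \<in> S \<Longrightarrow> norm z \<le> 1 \<Longrightarrow> norm (F t z) \<le> 1"
    and Fb: "\<And>t z. t \<in> S \<Longrightarrow> norm z = 1 \<Longrightarrow> F t z = z"
  shows "continuous_on (S \<times> UNIV) (\<lambda>(t :: real, z). twist_with e (F t) z)"
proof -
  let ?B = "cball 0 1 :: complex set" and ?E = "e ` cball 0 1"
  let ?h = "inv_into ?B e"
  have hcont: "continuous_on ?E ?h"
    using e by (intro continuous_on_inv) auto
  have him: "?h z \<in> ?B" "e (?h z) = z" if "z \<in> ?E" for z
    using that by (rule inv_into_into, rule f_inv_into_f)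
  have "open (e ` ball 0 1)"
    by (intro invariance_of_domain continuous_on_subset[OF e(1)] inj_on_subset[OF e(2)])
       (use ball_subset_cball[of 0 1] in blast)+
  then have sub: "e ` ball 0 1 \<subseteq> interior ?E"
    by (intro interior_maximal image_mono) auto
  have fix_frontier: "twist_with e (F t) z = z" if t: "t \<in> S" and z: "z \<notin> interior ?E" for t z
  proof (cases "z \<in> ?E")
    case True
    then obtain w where w: "w \<in> ?B" "z = e w" by auto
    with z sub have "norm w = 1" by (force simp: subset_iff)
    then show ?thesis using w e Fb[OF t] by (simp add: twist_with_def)
  qed (simp add: twist_with_def)
  have "compact ?E" by (rule compact_continuous_image) (use e in auto)
  then have cE: "closed ?E" by (rule compact_imp_closed)
  have h2: "continuous_on (S \<times> ?E) (\<lambda>x. (fst x, ?h (snd x)))"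
    by (intro continuous_intros continuous_on_compose2[OF hcont]) auto
  have "continuous_on (S \<times> ?E) (\<lambda>x. F (fst x) (?h (snd x)))"
    using continuous_on_compose2[OF F h2] him by fastforce
  then have "continuous_on (S \<times> ?E) (\<lambda>x. e (F (fst x) (?h (snd x))))"
    by (rule continuous_on_compose2[OF e(1)]) (use Fn him in auto)
  then have c1: "continuous_on (S \<times> ?E) (\<lambda>(t, z). twist_with e (F t) z)"
    by (rule continuous_on_eq) (auto simp: twist_with_def)
  have c2: "continuous_on (S \<times> - interior ?E) (\<lambda>(t, z). twist_with e (F t) z)"
    by (rule continuous_on_eq[OF continuous_on_snd[OF continuous_on_id]]) (auto simp: fix_frontier)
  have "continuous_on (S \<times> ?E \<union> S \<times> - interior ?E) (\<lambda>(t, z). twist_with e (F t) z)"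
  proof (rule continuous_on_Un_local[OF _ _ c1 c2])
    have "S \<times> ?E = (S \<times> ?E \<union> S \<times> - interior ?E) \<inter> (UNIV \<times> ?E)" by auto
    then show "closedin (top_of_set (S \<times> ?E \<union> S \<times> - interior ?E)) (S \<times> ?E)"
      using cE by (metis closedin_closed closed_Times closed_UNIV)
    have "S \<times> - interior ?E = (S \<times> ?E \<union> S \<times> - interior ?E) \<inter> (UNIV \<times> - interior ?E)" by auto
    then show "closedin (top_of_set (S \<times> ?E \<union> S \<times> - interior ?E)) (S \<times> - interior ?E)"
      by (metis closedin_closed closed_Times closed_UNIV open_interior closed_Compl)
  qed
  moreover have "S \<times> ?E \<union> S \<times> - interior ?E = S \<times> UNIV" using interior_subset by auto
  ultimately show ?thesis by simp
qed

section \<open>The image of the vertical diameter under the twist\<close>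

lemma T_eq: "T = of_real (7/8) * \<i>"
  by (simp add: complex_eq_iff)

definition center_path :: "real \<Rightarrow> complex" where "center_path = linepath (- T) T"
definition right_path :: "real \<Rightarrow> complex" where "right_path = linepath (- T) (7/8) +++ linepath (7/8) T"
definition left_path :: "real \<Rightarrow> complex" where "left_path = linepath (- T) (- 7/8) +++ linepath (- 7/8) T"

lemma path_ends [simp]:
  "pathstart center_path = - T" "pathfinish center_path = T"
  "pathstart right_path = - T" "pathfinish right_path = T"
  "pathstart left_path = - T" "pathfinish left_path = T"
  by (simp_all add: center_path_def right_path_def left_path_def)

lemma center_path_in: "path_in slit_both center_path"
proof -
  have "closed_segment (- T) T \<subseteq> ball 0 1" by (intro closed_segment_subset) auto
  moreover have "Re z = 0" if "z \<in> closed_segment (- T) T" for z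
    using that by (auto simp: in_segment)
  ultimately show ?thesis by (force simp: center_path_def slit_both_def)
qed

text \<open>The squared norm is 49/64 times (1 - u)^2 + u^2, which lies between 1/2 and 1; and
  49/128 exceeds (9/16)^2.\<close>

lemma norm_segment_corner:
  fixes a b :: complex
  assumes z: "z \<in> closed_segment a b" and ab: "inner a b = 0" "norm a = 7/8" "norm b = 7/8"
  shows "9/16 < norm z" "norm z < 1"
proof -
  obtain u where u: "0 \<le> u" "u \<le> 1" "z = (1 - u) *\<^sub>R a + u *\<^sub>R b" using z by (auto simp: in_segment)
  have "(norm z)\<^sup>2 = ((1 - u)\<^sup>2 + u\<^sup>2) * (49/64)"
    unfolding power2_norm_eq_inner u(3)
    using ab(1) power2_norm_eq_inner[of a] power2_norm_eq_inner[of b] ab(2,3)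
    by (simp add: inner_add_left inner_add_right inner_commute power2_eq_square algebra_simps)
  moreover have "(1 - u)\<^sup>2 + u\<^sup>2 \<ge> 1/2"
    using zero_le_power2[of "2 * u - 1"] by (simp add: power2_eq_square algebra_simps)
  moreover have "(1 - u)\<^sup>2 + u\<^sup>2 \<le> 1"
    using mult_nonneg_nonneg[of u "1 - u"] u by (simp add: power2_eq_square algebra_simps)
  ultimately have "(9/16)\<^sup>2 < (norm z)\<^sup>2" "(norm z)\<^sup>2 < 1\<^sup>2" by (simp_all add: power2_eq_square)
  then show "9/16 < norm z" "norm z < 1"
    using power2_less_imp_less[of "9/16" "norm z"] power2_less_imp_less[of "norm z" 1] by simp_all
qed

lemma corner_paths_in:
  "path_in {z. 9/16 < norm z \<and> norm z < 1} right_path" "path_in {z. 9/16 < norm z \<and> norm z < 1} left_path"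
proof -
  have *: "closed_segment a b \<subseteq> {z. 9/16 < norm z \<and> norm z < 1}"
    if "inner a b = 0" "norm a = 7/8" "norm b = 7/8" for a b :: complex
    using norm_segment_corner[OF _ that] by auto
  show "path_in {z. 9/16 < norm z \<and> norm z < 1} right_path"
    unfolding right_path_def using *[of "- T" "7/8"] *[of "7/8" T]
    by (simp add: inner_complex_def)
  show "path_in {z. 9/16 < norm z \<and> norm z < 1} left_path"
    unfolding left_path_def using *[of "- T" "- 7/8"] *[of "- 7/8" T]
    by (simp add: inner_complex_def)
qed

lemma right_path_in: "path_in slit_right right_path"
proof -
  have "\<not> (Im z = 0 \<and> Re z \<le> 1/2)" if "z \<in> path_image right_path" for z
    using that by (auto simp: right_path_def path_image_join in_segment)
  then show ?thesis using corner_paths_in(1) by (force simp: path_in_def slit_right_def)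
qed

lemma left_path_in: "path_in slit_left left_path"
proof -
  have "\<not> (Im z = 0 \<and> Re z \<ge> - 1/2)" if "z \<in> path_image left_path" for z
    using that by (auto simp: left_path_def path_image_join in_segment)
  then show ?thesis using corner_paths_in(2) by (force simp: path_in_def slit_left_def)
qed

lemma core_twist_ge: "norm z \<ge> 9/16 \<Longrightarrow> core_twist z = z"
  by (simp add: core_twist_def)

lemma core_twist_le: "norm z \<le> 1/2 \<Longrightarrow> core_twist z = - z"
  by (simp add: core_twist_def)

lemma continuous_on_core_twist: "continuous_on S core_twist"
  unfolding core_twist_def cis_conv_exp by (intro continuous_intros)

lemma norm_core_twist [simp]: "norm (core_twist z) = norm z"
  by (simp add: core_twist_def norm_mult)

lemma core_twist_minus: "core_twist (- z) = - core_twist z"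
  by (simp add: core_twist_def)

text \<open>The image is r sin \<theta> - i r cos \<theta> with \<theta> between 0 and \<pi>. It is
  real only for \<theta> = \<pi>/2, and then it equals r; this exceeds 1/2, since radius 1/2 itself
  is turned by \<pi>.\<close>

lemma core_twist_slit:
  assumes r: "1/2 \<le> r" "r < 1" shows "core_twist (- (of_real r * \<i>)) \<in> slit_right"
proof -
  define \<theta> where "\<theta> = pi * min 1 (max 0 (9 - 16 * r))"
  have n: "norm (- (of_real r * \<i>)) = r" using r by (simp add: norm_mult)
  have c: "core_twist (- (of_real r * \<i>)) = - (of_real r * \<i>) * cis \<theta>"
    unfolding core_twist_def n \<theta>_def ..
  have \<theta>: "0 \<le> \<theta>" "\<theta> \<le> pi" "r = 1/2 \<Longrightarrow> \<theta> = pi"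
    by (auto simp: \<theta>_def)
  have "\<not> (Im (core_twist (- (of_real r * \<i>))) = 0 \<and> Re (core_twist (- (of_real r * \<i>))) \<le> 1/2)"
  proof
    assume *: "Im (core_twist (- (of_real r * \<i>))) = 0 \<and> Re (core_twist (- (of_real r * \<i>))) \<le> 1/2"
    then have "cos \<theta> = 0" "r * sin \<theta> \<le> 1/2" using r unfolding c by auto
    moreover have "sin \<theta> \<ge> 0" using \<theta> by (simp add: sin_ge_zero)
    ultimately have "sin \<theta> = 1" using sin_cos_squared_add[of \<theta>] by (simp add: power2_eq_1_iff)
    then have "r = 1/2" using \<open>r * sin \<theta> \<le> 1/2\<close> r by simp
    then show False using \<theta> \<open>cos \<theta> = 0\<close> by simp
  qed
  then show ?thesis using norm_core_twist[of "- (of_real r * \<i>)"] n r by (auto simp: slit_right_def)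
qed

text \<open>The twisted diameter goes from - T around the right puncture to i/2, straight down to -
  i/2, and around the left puncture to T. Each third lies in one of the slit discs, where simple
  connectedness allows it to be replaced by any path with the same ends.\<close>

lemma twisted_center_path:
  "homotopic_paths (ball 0 1 - {1/2, - 1/2}) (core_twist \<circ> center_path)
     ((right_path +++ reversepath center_path) +++ left_path)"
proof -
  let ?S = "ball 0 1 - {1/2, - 1/2 :: complex}"
  define s where "s = core_twist \<circ> center_path"
  have cp: "center_path t = of_real (7/8 * (2 * t - 1)) * \<i>" for t
    by (simp add: center_path_def linepath_def complex_eq_iff algebra_simps)
  have ncp: "norm (center_path t) = \<bar>7/8 * (2 * t - 1)\<bar>" for t
    unfolding cp by (simp only: norm_mult norm_of_real norm_ii mult_1_right)
  have ps: "path s"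
    unfolding s_def by (intro path_continuous_image continuous_on_core_twist) (simp add: center_path_def)
  \<comment> \<open>At the times 3/14 and 11/14 \<open>center_path\<close> has radius 1/2; in
    between, the twist is the rotation by \<pi>.\<close>
  have s1: "s t \<in> slit_right" if "t \<in> {0..3/14}" for t
  proof -
    have "center_path t = - (of_real (7/8 * (1 - 2 * t)) * \<i>)" unfolding cp by (simp add: complex_eq_iff field_simps)
    then show ?thesis unfolding s_def comp_def using core_twist_slit[of "7/8 * (1 - 2 * t)"] that by simp
  qed
  have s3: "s t \<in> slit_left" if "t \<in> {11/14..1}" for t
  proof -
    have "core_twist (- center_path t) \<in> slit_right"
      unfolding cp using core_twist_slit[of "7/8 * (2 * t - 1)"] that by simp
    then have "- core_twist (center_path t) \<in> slit_right" by (simp add: core_twist_minus)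
    then show ?thesis unfolding s_def slit_left_eq comp_def by (metis add.inverse_inverse image_eqI)
  qed
  have s2e: "s t = - center_path t" if "t \<in> {3/14..11/14}" for t
  proof -
    have "\<bar>7/8 * (2 * t - 1)\<bar> \<le> 1/2" using that by (simp add: abs_le_iff)
    then have "norm (center_path t) \<le> 1/2" unfolding ncp .
    then show ?thesis by (simp add: s_def core_twist_le)
  qed
  have s2: "s t \<in> slit_both" if "t \<in> {3/14..11/14}" for t
  proof -
    have "\<bar>7/8 * (2 * t - 1)\<bar> < 1" using that by (simp add: abs_less_iff)
    then have "norm (center_path t) < 1" unfolding ncp .
    then show ?thesis unfolding s2e[OF that] by (simp add: slit_both_def) (simp add: cp)
  qed
  have sub: "slit_right \<subseteq> ?S" "slit_left \<subseteq> ?S" "slit_both \<subseteq> ?S"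
    by (auto simp: slit_right_def slit_left_def slit_both_def)
  have P: "path_in slit_right (subpath 0 (3/14) s)" "path_in slit_both (subpath (3/14) (11/14) s)"
    "path_in slit_left (subpath (11/14) 1 s)"
    using s1 s2 s3 ps unfolding path_in_def by (auto simp: path_image_subpath)
  define h :: complex where "h = \<i> / 2"
  have v: "s 0 = - T" "s (3/14) = h" "s (11/14) = - h" "s 1 = T"
    using s2e[of "3/14"] s2e[of "11/14"] by (simp_all add: cp h_def) (simp_all add: s_def cp core_twist_ge norm_mult T_eq)
  \<comment> \<open>The detours \<open>t\<close> and \<open>w\<close> lead from the cutting points
    \<open>h\<close> and \<open>- h\<close> to T and - T, and cancel in the final
    concatenation.\<close>
  define t where "t = linepath h T"
  define w where "w = linepath (- h) (- T)"
  have seg: "closed_segment (of_real x * \<i>) (of_real y * \<i>) \<subseteq> V"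
    if "\<And>u. u \<in> closed_segment x y \<Longrightarrow> of_real u * \<i> \<in> V" for x y V
  proof
    fix z assume "z \<in> closed_segment (of_real x * \<i>) (of_real y * \<i>)"
    then obtain u where u: "0 \<le> u" "u \<le> 1" "z = (1 - u) *\<^sub>R (of_real x * \<i>) + u *\<^sub>R (of_real y * \<i>)"
      by (auto simp: in_segment)
    then have "z = of_real ((1 - u) *\<^sub>R x + u *\<^sub>R y) * \<i>" by (simp add: scaleR_conv_of_real algebra_simps)
    moreover have "(1 - u) *\<^sub>R x + u *\<^sub>R y \<in> closed_segment x y" using u by (auto simp: in_segment)
    ultimately show "z \<in> V" using that by metis
  qed
  have t: "path_in slit_right t" "path_in slit_both t"
    unfolding t_def T_eq h_def using seg[of "1/2" "7/8" slit_right] seg[of "1/2" "7/8" slit_both]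
    by (auto simp: slit_right_def slit_both_def norm_mult closed_segment_eq_real_ivl)
  have w: "path_in slit_left w" "path_in slit_both w"
    unfolding w_def T_eq h_def using seg[of "- 1/2" "- 7/8" slit_left] seg[of "- 1/2" "- 7/8" slit_both]
    by (auto simp: slit_left_def slit_both_def norm_mult closed_segment_eq_real_ivl)
  have tw: "pathstart t = h" "pathfinish t = T" "pathstart w = - h" "pathfinish w = - T"
    by (simp_all add: t_def w_def)
  note sc = simply_connected_slit
  have 1: "homotopic_paths ?S (subpath 0 (3/14) s) (right_path +++ reversepath t)"
    by (rule homotopic_paths_subset[OF simply_connected_homotopic[OF sc(1)] sub(1)])
       (use P t right_path_in v tw in auto)
  have 2: "homotopic_paths ?S (subpath (3/14) (11/14) s) ((t +++ reversepath center_path) +++ reversepath w)"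
    by (rule homotopic_paths_subset[OF simply_connected_homotopic[OF sc(3)] sub(3)])
       (use P t w center_path_in v tw in auto)
  have 3: "homotopic_paths ?S (subpath (11/14) 1 s) (w +++ left_path)"
    by (rule homotopic_paths_subset[OF simply_connected_homotopic[OF sc(2)] sub(2)])
       (use P w left_path_in v tw in auto)
  have all: "path_in ?S t" "path_in ?S w" "path_in ?S right_path" "path_in ?S left_path" "path_in ?S center_path"
    using t w right_path_in left_path_in center_path_in sub path_in_mono by blast+
  have imS: "path_image s \<subseteq> ?S"
  proof (clarsimp simp only: path_image_def)
    fix t :: real assume "t \<in> {0..1}"
    then consider "t \<in> {0..3/14}" | "t \<in> {3/14..11/14}" | "t \<in> {11/14..1}" by fastforce
    then show "s t \<in> ?S" using s1[of t] s2[of t] s3[of t] sub by cases blast+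
  qed
  have "homotopic_paths ?S s (subpath 0 (3/14) s +++ subpath (3/14) 1 s)"
    using homotopic_join_subpaths[OF ps imS, of 0 "3/14" 1] homotopic_paths_sym by (simp add: subpath_trivial)
  also have "homotopic_paths ?S \<dots> (subpath 0 (3/14) s +++ (subpath (3/14) (11/14) s +++ subpath (11/14) 1 s))"
    by (intro homotopic_paths_join homotopic_paths_sym[OF homotopic_join_subpaths])
       (use ps imS path_in_mono[OF P(1) sub(1)] in \<open>auto simp: path_in_def\<close>)
  also have "homotopic_paths ?S \<dots>
      ((right_path +++ reversepath t) +++ (((t +++ reversepath center_path) +++ reversepath w) +++ (w +++ left_path)))"
    by (intro homotopic_paths_join 1 2 3) (auto simp: v tw)
  also have "homotopic_paths ?S \<dots>
      ((right_path +++ reversepath t) +++ ((t +++ reversepath center_path) +++ left_path))"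
    by (rule homotopic_paths_join[OF _ homotopic_paths_cancel_middle])
       (use all tw in \<open>auto simp: path_in_def subset_path_image_join\<close>)
  also have "homotopic_paths ?S \<dots> ((right_path +++ reversepath center_path) +++ left_path)"
    using all tw by (intro homotopic_paths_cancel) auto
  finally show ?thesis by (simp add: s_def)
qed

section \<open>The action of homeomorphisms and half-twists\<close>

context punctured_plane
begin

definition plane_homeo :: "(complex \<Rightarrow> complex) \<Rightarrow> bool" where
  "plane_homeo h \<longleftrightarrow> continuous_on UNIV h \<and> inj h \<and> h ` P = P \<and> (\<forall>z. norm z \<ge> 1 \<longrightarrow> h z = z)"

lemma plane_homeo_Compl:
  assumes h: "plane_homeo h" shows "h ` (- P) \<subseteq> - P"
proof (rule image_subsetI)
  fix x assume x: "x \<in> - P"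
  have "h ` P = P" "inj h" using h by (simp_all add: plane_homeo_def)
  then show "h x \<in> - P" using x by (metis ComplD ComplI inj_image_mem_iff)
qed

lemma plane_homeo_homotopic:
  "plane_homeo h \<Longrightarrow> homotopic_paths (- P) p q \<Longrightarrow> homotopic_paths (- P) (h \<circ> p) (h \<circ> q)"
  by (rule homotopic_paths_continuous_image)
     (use plane_homeo_Compl in \<open>auto simp: plane_homeo_def intro: continuous_on_subset\<close>)

lemma loop_at_homeo: "plane_homeo h \<Longrightarrow> norm b \<ge> 1 \<Longrightarrow> loop_at b g \<Longrightarrow> loop_at b (h \<circ> g)"
  unfolding loop_at_def
  using path_in_compose[of "- P" g h "- P"] plane_homeo_Compl[of h]
  by (auto simp: plane_homeo_def pathstart_compose pathfinish_compose intro: continuous_on_subset)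

text \<open>As \<open>h\<close> is injective, \<open>h (g x + t v) - h (p + t v)\<close> never vanishes, and for large \<open>t v\<close> it is
  \<open>g x - p\<close>, because \<open>h\<close> is the identity far out.\<close>

lemma winding_number_homeo:
  assumes h: "plane_homeo h" and g: "path g" "pathstart g = pathfinish g" and p: "p \<notin> path_image g"
  shows "winding_number (h \<circ> g) (h p) = winding_number g p"
proof -
  have hc: "continuous_on S h" for S using h continuous_on_subset unfolding plane_homeo_def by blast
  have hi: "h x = h y \<longleftrightarrow> x = y" for x y using h unfolding plane_homeo_def inj_def by blast
  have gc: "continuous_on {0..1} g" using g by (simp add: path_def)
  have "bounded (insert p (path_image g))" using bounded_path_image[OF g(1)] by simp
  then obtain B where B: "B > 0" "\<And>x. x \<in> insert p (path_image g) \<Longrightarrow> norm x \<le> B"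
    using bounded_pos by metis
  \<comment> \<open>The length B + 1 pushes every point of norm at most B out of the open unit disc,
    to where \<open>h\<close> is the identity.\<close>
  define v where "v = complex_of_real (B + 1)"
  have v: "norm (x + v) \<ge> 1" if "norm x \<le> B" for x
  proof -
    have "norm v = B + 1" unfolding v_def norm_of_real using B by simp
    then show ?thesis using norm_triangle_ineq4[of "x + v" x] that by simp
  qed
  have far: "h (x + v) = x + v" if "x \<in> insert p (path_image g)" for x
    using v[OF B(2)[OF that]] h by (simp add: plane_homeo_def)
  have "homotopic_loops (- {0}) (\<lambda>x. h (g x) - h p) (\<lambda>x. g x - p)"
    unfolding homotopic_loops
  proof (intro exI[of _ "\<lambda>(t, x). h (g x + of_real t * v) - h (p + of_real t * v)"] conjI ballI)
    have gc2: "continuous_on ({0..1::real} \<times> {0..1}) (\<lambda>x. g (snd x))"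
      by (rule continuous_on_compose2[OF gc continuous_on_snd[OF continuous_on_id]]) auto
    show "continuous_on ({0..1::real} \<times> {0..1}) (\<lambda>(t, x). h (g x + of_real t * v) - h (p + of_real t * v))"
      unfolding case_prod_unfold
      by (intro continuous_intros continuous_on_compose2[OF hc[of UNIV]] gc2) auto
    show "(\<lambda>(t, x). h (g x + of_real t * v) - h (p + of_real t * v)) \<in> {0..1} \<times> {0..1} \<rightarrow> - {0}"
      using p by (auto simp: hi path_image_def)
    fix x :: real assume x: "x \<in> {0..1}"
    show "(case (0::real, x) of (t, x) \<Rightarrow> h (g x + of_real t * v) - h (p + of_real t * v)) = h (g x) - h p"
      by simp
    have "g x \<in> path_image g" using x by (simp add: path_image_def)
    then show "(case (1::real, x) of (t, x) \<Rightarrow> h (g x + of_real t * v) - h (p + of_real t * v)) = g x - p"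
      using far by simp
    show "pathfinish ((\<lambda>(t, x). h (g x + complex_of_real t * v) - h (p + of_real t * v)) \<circ> Pair x) =
        pathstart ((\<lambda>(t, x). h (g x + of_real t * v) - h (p + of_real t * v)) \<circ> Pair x)"
      using g(2) by (simp add: pathfinish_def pathstart_def)
  qed
  from winding_number_homotopic_loops[OF this] show ?thesis
    by (simp add: winding_number_offset[of "h \<circ> g"] winding_number_offset[of g])
qed

lemma turns_homeo:
  assumes h: "plane_homeo h" and g: "loop_at b g"
  shows "turns (h \<circ> g) = turns g"
proof -
  have "turns (h \<circ> g) = (\<Sum>p\<in>h ` P. winding_number (h \<circ> g) p)"
    using h by (simp add: turns_def plane_homeo_def)
  also have "\<dots> = (\<Sum>p\<in>P. winding_number (h \<circ> g) (h p))"
    using h by (subst sum.reindex) (auto simp: plane_homeo_def intro: inj_on_subset)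
  also have "\<dots> = turns g"
    unfolding turns_def
    by (rule sum.cong[OF refl], rule winding_number_homeo[OF h])
       (use g path_in_avoid in \<open>auto simp: loop_at_def\<close>)
  finally show ?thesis .
qed

lemma \<rho>_homeo: "plane_homeo h \<Longrightarrow> loop_at b g \<Longrightarrow> \<rho> (h \<circ> g) = \<rho> g"
  by (simp add: \<rho>_def turns_homeo)

text \<open>Pulling back does not change the coefficients: \<open>h\<close> permutes the punctures
  and preserves winding numbers of loops, so \<rho> is invariant.\<close>

lemma crossed_at_homeo:
  assumes c: "crossed_at b c" and h: "plane_homeo h" and b: "norm b \<ge> 1"
  shows "crossed_at b (\<lambda>g. c (h \<circ> g))"
  unfolding crossed_at_def
proof (intro conjI allI impI)
  fix g g' assume g: "loop_at b g" "loop_at b g'"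
  note hg = loop_at_homeo[OF h b g(1)] loop_at_homeo[OF h b g(2)]
  show "c (h \<circ> g) = c (h \<circ> g')" if "homotopic_paths (- P) g g'"
    using crossed_at_homotopic[OF c plane_homeo_homotopic[OF h that] hg(1)] .
  show "c (h \<circ> (g +++ g')) = c (h \<circ> g) + \<rho> g * c (h \<circ> g')"
    using crossed_at_join[OF c hg] \<rho>_homeo[OF h g(1)] by (simp add: path_compose_join)
qed

lemma crossed_at_lincomb:
  "crossed_at b c \<Longrightarrow> crossed_at b c' \<Longrightarrow> crossed_at b (\<lambda>g. x * c g + y * c' g)"
  unfolding crossed_at_def by (auto simp: algebra_simps)

end

section \<open>How a half-twist changes a crossed homomorphism\<close>

definition twist_stage :: "real \<Rightarrow> complex \<Rightarrow> complex" where
  "twist_stage t z =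
     z * cis (pi * ((1 - t) * min 1 (2 - 2 * norm z) + t * min 1 (max 0 (9 - 16 * norm z))))"

lemma norm_twist_stage [simp]: "norm (twist_stage t z) = norm z"
  by (simp add: twist_stage_def norm_mult)

text \<open>Both interpolated angles are \<pi> at radius 1/2. Hence every stage swaps the two
  punctures, and the homotopy from \<open>model_twist\<close> to \<open>core_twist\<close> avoids
  \<open>P\<close>.\<close>

lemma twist_stage_half: "norm z = 1/2 \<Longrightarrow> twist_stage t z = - z"
  by (simp add: twist_stage_def)

context embedded_disc
begin

lemma twist_stage_P:
  assumes "x \<notin> P" shows "twist_with e (twist_stage t) x \<notin> P"
proof (cases "x \<in> e ` cball 0 1")
  case True
  then obtain z where z: "z \<in> cball 0 1" "x = e z" by blast
  have i: "inv_into (cball 0 1) e (e z) = z" using z inj_e by simp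
  have F: "twist_stage t z \<in> cball 0 1" using z by simp
  have "twist_stage t z \<noteq> 1/2 \<and> twist_stage t z \<noteq> - 1/2"
  proof (cases "norm z = 1/2")
    case True
    have "- z \<noteq> 1/2 \<and> - z \<noteq> - 1/2" using assms z e_in_P_iff[OF z(1)]
      by (metis add.inverse_inverse minus_divide_left)
    then show ?thesis using True by (simp add: twist_stage_half)
  next
    case False
    then have "norm (twist_stage t z) \<noteq> norm (1/2 :: complex)" "norm (twist_stage t z) \<noteq> norm (- 1/2 :: complex)"
      by (simp_all add: norm_divide)
    then show ?thesis by metis
  qed
  then show ?thesis using z i e_in_P_iff[OF F] by (simp add: twist_with_def)
qed (use assms in \<open>simp add: twist_with_def\<close>)

abbreviation "twist \<equiv> twist_along e"
abbreviation "reduced_twist \<equiv> twist_with e core_twist"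

lemma homotopic_twist:
  assumes g: "loop_at b g"
  shows "homotopic_paths (- P) (twist \<circ> g) (reduced_twist \<circ> g)"
proof -
  let ?H = "\<lambda>(t, z). twist_with e (twist_stage t) z"
  have ends: "twist_stage 0 = model_twist" "twist_stage 1 = core_twist"
    by (auto simp: fun_eq_iff twist_stage_def model_twist_def core_twist_def)
  have gc: "continuous_on {0..1} g" using g by (simp add: loop_at_def path_in_def path_def)
  have gc2: "continuous_on ({0..1::real} \<times> {0..1::real}) (\<lambda>x. (fst x, g (snd x)))"
    by (intro continuous_intros continuous_on_compose2[OF gc]) auto
  have Hc: "continuous_on ({0..1} \<times> UNIV) ?H"
  proof (rule continuous_on_twist_with[OF continuous_e inj_e])
    show "continuous_on ({0..1} \<times> cball 0 1) (\<lambda>(t, z). twist_stage t z)"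
      unfolding case_prod_unfold twist_stage_def cis_conv_exp by (intro continuous_intros)
    show "twist_stage t z = z" if "norm z = 1" for t z using that by (simp add: twist_stage_def)
  qed simp
  show ?thesis
    unfolding homotopic_paths
  proof (intro exI[of _ "\<lambda>(t, x). twist_with e (twist_stage t) (g x)"] conjI ballI)
    show "continuous_on ({0..1} \<times> {0..1}) (\<lambda>(t, x). twist_with e (twist_stage t) (g x))"
      using continuous_on_compose2[OF Hc gc2] by (force simp: case_prod_unfold)
    show "(\<lambda>(t, x). twist_with e (twist_stage t) (g x)) \<in> {0..1} \<times> {0..1} \<rightarrow> - P"
    proof clarsimp
      fix t x :: real assume "0 \<le> x" "x \<le> 1" and P: "twist_with e (twist_stage t) (g x) \<in> P"
      then have "g x \<notin> P" using loop_atD(1)[OF g] by (auto simp: path_in_def path_image_def image_subset_iff)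
      then show False using twist_stage_P P by blast
    qed
    show "pathstart ((\<lambda>(t, x). twist_with e (twist_stage t) (g x)) \<circ> Pair t) = pathstart (twist \<circ> g)"
      "pathfinish ((\<lambda>(t, x). twist_with e (twist_stage t) (g x)) \<circ> Pair t) = pathfinish (twist \<circ> g)" for t
      using g b by (simp_all add: loop_at_def pathstart_def pathfinish_def twist_with_def twist_along_eq)
  qed (simp_all add: ends twist_along_eq)
qed

lemma reduced_twist_outside:
  assumes p: "path_in outside_core p"
  shows "homotopic_paths (- P) p (reduced_twist \<circ> p)"
proof (rule homotopic_paths_eq)
  show "path p" "path_image p \<subseteq> - P" using p outside_core by (auto simp: path_in_def)
  fix t :: real assume "t \<in> {0..1}"
  then have t: "p t \<in> outside_core" using p by (auto simp: path_in_def path_image_def)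
  have "reduced_twist (p t) = p t"
  proof (cases "p t \<in> e ` cball 0 1")
    case True
    then obtain z where z: "z \<in> cball 0 1" "p t = e z" by blast
    have "norm z \<ge> 9/16"
    proof (rule ccontr)
      assume "\<not> norm z \<ge> 9/16"
      then have "z \<in> cball 0 (9/16)" by simp
      then show False using t z unfolding outside_core_def by blast
    qed
    then show ?thesis using z inj_e by (simp add: twist_with_def core_twist_ge)
  qed (simp add: twist_with_def)
  then show "p t = (reduced_twist \<circ> p) t" by simp
qed

text \<open>The twist may move \<open>p\<close> in the annulus around the core, but up to homotopy
  it is \<open>reduced_twist\<close>, which fixes \<open>p\<close> pointwise.\<close>

lemma crossed_at_twist_outside:
  assumes c: "crossed_at b c" and p: "path_in outside_core p" "pathstart p = b" "pathfinish p = b"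
  shows "c (twist \<circ> p) = c p"
proof -
  have l: "loop_at b p" using path_in_mono[OF p(1) outside_core(4)] p(2,3) by (simp add: loop_at_def)
  have "homotopic_paths (- P) p (twist \<circ> p)"
    using homotopic_twist[OF l] reduced_twist_outside[OF p(1)] homotopic_paths_sym homotopic_paths_trans by blast
  then show ?thesis using crossed_at_homotopic[OF c _ l] by simp
qed

text \<open>This is \<rho> of a loop around the puncture \<open>e (1/2)\<close> and no other; its
  direction depends on whether \<open>e\<close> preserves the orientation.\<close>

definition twist_factor :: complex where
  "twist_factor = exp (2 * of_real pi * \<i> * of_real \<mu> * turns (e \<circ> (right_path +++ reversepath center_path)))"

lemma e_path_in: "path_in S p \<Longrightarrow> S \<subseteq> cball 0 1 \<Longrightarrow> e ` S \<subseteq> T' \<Longrightarrow> path_in T' (e \<circ> p)"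
  by (rule path_in_compose[OF _ continuous_on_subset[OF continuous_e]])

lemma e_paths: "path_in outside_core (e \<circ> right_path)" "path_in outside_core (e \<circ> left_path)"
  "path_in (- P) (e \<circ> center_path)"
proof -
  show "path_in outside_core (e \<circ> right_path)"
    by (rule e_path_in[OF corner_paths_in(1)]) (auto intro: e_in_outside_core)
  show "path_in outside_core (e \<circ> left_path)"
    by (rule e_path_in[OF corner_paths_in(2)]) (auto intro: e_in_outside_core)
  show "path_in (- P) (e \<circ> center_path)"
    by (rule e_path_in[OF center_path_in slit_subset(3) e_slit_P(3)])
qed

lemma e_path_ends [simp]:
  "pathstart (e \<circ> p) = e (pathstart p)" "pathfinish (e \<circ> p) = e (pathfinish p)"
  by (simp_all add: pathstart_compose pathfinish_compose)

lemma twist_factor_eq: "twist_factor = \<rho> (e \<circ> right_path) / \<rho> (e \<circ> center_path)"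
proof -
  have P: "path_in (- P) (e \<circ> right_path)" "path_in (- P) (e \<circ> center_path)"
    using e_paths outside_core path_in_mono by blast+
  have "twist_factor = \<rho> ((e \<circ> right_path) +++ reversepath (e \<circ> center_path))"
    unfolding twist_factor_def \<rho>_def path_compose_join path_compose_reversepath ..
  then show ?thesis using P by (simp add: \<rho>_join \<rho>_reversepath divide_inverse)
qed

text \<open>By \<open>twisted_center_path\<close> the image loop runs through right, reversed center
  and left. Expand by the cocycle rule: the part before left has \<rho> equal to
  \<open>twist_factor\<close> relative to \<open>d\<close>, and the terms in \<open>c' d\<close> and
  \<open>c' d'\<close> regroup because the coefficients 1, - \<open>twist_factor\<close>,
  \<open>twist_factor\<close> add up to 1.\<close>

lemma twist_formula:
  assumes c: "crossed_at b c"
    and d: "path_in outside_core d" "pathstart d = b" "pathfinish d = e (- T)"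
    and d': "path_in outside_core d'" "pathstart d' = e T" "pathfinish d' = b"
  shows "c (twist \<circ> (d +++ ((e \<circ> center_path) +++ d'))) =
     c (d +++ ((e \<circ> right_path) +++ d')) - twist_factor * c (d +++ ((e \<circ> center_path) +++ d'))
     + twist_factor * c (d +++ ((e \<circ> left_path) +++ d'))"
proof -
  obtain c' where c': "crossed c'" "\<And>g. loop_at b g \<Longrightarrow> c' g = c g"
    using crossed_extend[OF c b(1)] by blast
  let ?k = "\<lambda>p. d +++ ((e \<circ> p) +++ d')"
  let ?q = "(right_path +++ reversepath center_path) +++ left_path"
  have P: "path_in (- P) d" "path_in (- P) d'" "path_in (- P) (e \<circ> right_path)" "path_in (- P) (e \<circ> left_path)"
    "path_in (- P) (e \<circ> center_path)"
    using d d' e_paths outside_core path_in_mono by blast+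
  have eq: "e \<circ> ?q = ((e \<circ> right_path) +++ reversepath (e \<circ> center_path)) +++ (e \<circ> left_path)"
    by (simp add: path_compose_join path_compose_reversepath)
  have q: "path_in (- P) (e \<circ> ?q)" unfolding eq using P by simp
  have l: "loop_at b (?k center_path)" "loop_at b (?k right_path)" "loop_at b (?k left_path)" "loop_at b (?k ?q)"
    using P q d d' by (simp_all add: loop_at_def)
  have 1: "homotopic_paths (- P) (e \<circ> (core_twist \<circ> center_path)) (e \<circ> ?q)"
  proof (rule homotopic_paths_continuous_image[OF twisted_center_path])
    show "continuous_on (ball 0 1 - {1/2, - 1/2}) e"
      by (rule continuous_on_subset[OF continuous_e]) auto
    show "e \<in> ball 0 1 - {1/2, - 1/2} \<rightarrow> - P" using e_in_P_iff by auto
  qed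
  have cb: "center_path t \<in> cball 0 1" if "t \<in> {0..1}" for t
    using center_path_in slit_subset(3) that unfolding path_in_def path_image_def by blast
  have 2: "homotopic_paths (- P) (e \<circ> (core_twist \<circ> center_path)) (reduced_twist \<circ> (e \<circ> center_path))"
    by (rule homotopic_paths_eq)
       (use path_in_homotopic[OF 1] cb inj_e in \<open>auto simp: path_in_def twist_with_def\<close>)
  have 3: "homotopic_paths (- P) (reduced_twist \<circ> (e \<circ> center_path)) (e \<circ> ?q)"
    using homotopic_paths_trans[OF homotopic_paths_sym[OF 2] 1] .
  have ends: "pathstart (reduced_twist \<circ> (e \<circ> center_path)) = e (- T)" "pathfinish (reduced_twist \<circ> (e \<circ> center_path)) = e T"
    "pathstart (reduced_twist \<circ> d') = e T" "pathfinish (reduced_twist \<circ> d) = e (- T)"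
    using homotopic_paths_imp_pathstart[OF 3] homotopic_paths_imp_pathfinish[OF 3]
      homotopic_paths_imp_pathstart[OF reduced_twist_outside[OF d'(1)]]
      homotopic_paths_imp_pathfinish[OF reduced_twist_outside[OF d(1)]] d d'
    by simp_all
  have "homotopic_paths (- P) (reduced_twist \<circ> ?k center_path) (?k ?q)"
    unfolding path_compose_join using ends
    by (intro homotopic_paths_join 3[unfolded path_compose_join] homotopic_paths_sym[OF reduced_twist_outside] d(1) d'(1)) simp_all
  then have "homotopic_paths (- P) (twist \<circ> ?k center_path) (?k ?q)"
    using homotopic_twist[OF l(1)] homotopic_paths_trans by blast
  then have "c (twist \<circ> ?k center_path) = c (?k ?q)"
    using crossed_at_homotopic[OF c homotopic_paths_sym l(4)] by metis
  also have "\<dots> = c' (?k ?q)" using c'(2) l by simp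
  also have "\<dots> = c' d + \<rho> d * (c' (e \<circ> right_path) + \<rho> (e \<circ> right_path) * (- inverse (\<rho> (e \<circ> center_path)) * c' (e \<circ> center_path))
      + \<rho> (e \<circ> right_path) * inverse (\<rho> (e \<circ> center_path)) * (c' (e \<circ> left_path) + \<rho> (e \<circ> left_path) * c' d'))"
    unfolding eq using P d d'
    by (simp add: crossed_join[OF c'(1)] crossed_reversepath[OF c'(1)] \<rho>_join \<rho>_reversepath algebra_simps)
  also have "\<dots> = c' (?k right_path) - twist_factor * c' (?k center_path) + twist_factor * c' (?k left_path)"
    unfolding twist_factor_eq using P d d'
    by (simp add: crossed_join[OF c'(1)] \<rho>_join field_simps)
  finally show ?thesis using c'(2) l by simp
qed

text \<open>With \<open>\<phi> = c \<circ> s - c\<close> for the half-twist \<open>s\<close> and \<open>q\<close> its factor, \<open>\<phi> \<circ> s + q \<phi>\<close> vanishes on the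
  generating loops. So \<open>s\<close> acts on \<open>\<phi>\<close> as \<open>- q\<close>, and \<open>c \<circ> s\<^sup>m - c\<close> is a geometric sum.\<close>

lemma twist_power:
  assumes c: "crossed_at b c" and g: "loop_at b g"
    and h: "plane_homeo twist" and nb: "norm b \<ge> 1"
    and q: "(- twist_factor) ^ m = 1" "- twist_factor \<noteq> 1"
  shows "c ((twist ^^ m) \<circ> g) = c g"
proof -
  \<comment> \<open>The coefficients 1 and - 1 are written out to match
    \<open>crossed_at_lincomb\<close>.\<close>
  define \<phi> where "\<phi> g = 1 * c (twist \<circ> g) + (- 1) * c g" for g
  define \<psi> where "\<psi> g = 1 * \<phi> (twist \<circ> g) + twist_factor * \<phi> g" for g
  have c\<phi>: "crossed_at b \<phi>"
    unfolding \<phi>_def by (intro crossed_at_lincomb crossed_at_homeo[OF c h nb] c)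
  have c\<psi>: "crossed_at b \<psi>"
    unfolding \<psi>_def by (intro crossed_at_lincomb crossed_at_homeo[OF c\<phi> h nb] c\<phi>)
  have out: "\<phi> p = 0" if "path_in outside_core p" "pathstart p = b" "pathfinish p = b" for p
    using crossed_at_twist_outside[OF c that] by (simp add: \<phi>_def)
  have out': "\<psi> p = 0" if "path_in outside_core p" "pathstart p = b" "pathfinish p = b" for p
    using crossed_at_twist_outside[OF c\<phi> that] out[OF that] by (simp add: \<psi>_def)
  obtain \<psi>' where \<psi>': "crossed \<psi>'" "\<And>g. loop_at b g \<Longrightarrow> \<psi>' g = \<psi> g"
    using crossed_extend[OF c\<psi> b(1)] by blast
  obtain d where d: "path_in outside_core d" "pathstart d = b" "pathfinish d = e (- T)"
    using path_connected_path_in[OF outside_core(2,3) e_T_outside(2)] .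
  obtain d' where d': "path_in outside_core d'" "pathstart d' = e T" "pathfinish d' = b"
    using path_connected_path_in[OF outside_core(2) e_T_outside(1) outside_core(3)] .
  let ?k = "\<lambda>p. d +++ ((e \<circ> p) +++ d')"
  \<comment> \<open>Both loops avoid the core, so in \<open>twist_formula\<close> for \<phi> only
    the center term survives: \<phi> is multiplied by - \<open>twist_factor\<close> on the one
    remaining generator.\<close>
  have "\<phi> (?k right_path) = 0" "\<phi> (?k left_path) = 0"
    by (rule out; use e_paths d d' in simp)+
  then have "\<psi> (?k center_path) = 0"
    using twist_formula[OF c\<phi> d d'] by (simp add: \<psi>_def)
  moreover have "loop_at b (?k center_path)"
    using e_paths d d' path_in_mono[OF d(1) outside_core(4)] path_in_mono[OF d'(1) outside_core(4)]
    by (simp add: loop_at_def)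
  ultimately have k: "\<psi>' (?k center_path) = 0" using \<psi>' by simp
  have van: "\<psi> g = 0" if "loop_at b g" for g
  proof -
    have "\<psi>' g = 0"
    proof (rule crossed_vanish[OF \<psi>'(1) _ d d' center_path_in _ _ k that])
      fix p assume p: "path_in outside_core p" "pathstart p = b" "pathfinish p = b"
      then have "loop_at b p" using outside_core path_in_mono by (auto simp: loop_at_def)
      then show "\<psi>' p = 0" using \<psi>'(2) out'[OF p] by simp
    qed simp_all
    then show ?thesis using \<psi>'(2)[OF that] by simp
  qed
  define s where "s j = (twist ^^ j) \<circ> g" for j
  have s: "s 0 = g" "s (Suc j) = twist \<circ> s j" for j by (simp_all add: s_def comp_assoc)
  have ls: "loop_at b (s j)" for j
    by (induction j) (simp_all only: s g loop_at_homeo[OF h nb])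
  have \<phi>s: "\<phi> (s j) = (- twist_factor) ^ j * \<phi> g" for j
  proof (induction j)
    case (Suc j)
    have "\<phi> (twist \<circ> s j) = - twist_factor * \<phi> (s j)"
      using van[OF ls[of j]] unfolding \<psi>_def by (simp only: add_eq_0_iff2 mult_1 mult_minus_left)
    then show ?case unfolding s(2) Suc by (simp only: power_Suc mult.assoc)
  qed (simp add: s)
  have "c (s j) = c g + (\<Sum>i<j. (- twist_factor) ^ i) * \<phi> g" for j
  proof (induction j)
    case (Suc j)
    have "c (s (Suc j)) = c (s j) + \<phi> (s j)" by (simp add: s \<phi>_def)
    then show ?case using Suc \<phi>s[of j] by (simp add: algebra_simps)
  qed (simp add: s)
  moreover have "(\<Sum>i<m. (- twist_factor) ^ i) = 0"
    using q by (subst geometric_sum) auto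
  ultimately show ?thesis by (simp add: s_def)
qed

end

section \<open>The factor of a half-twist\<close>

definition half_circuit :: "real \<Rightarrow> complex" where
  "half_circuit = right_path +++ reversepath center_path"

definition half_triangle :: "complex set" where
  "half_triangle = convex hull {- T, 7/8, T}"

lemma path_image_half_circuit: "path_image half_circuit = frontier half_triangle"
proof -
  have "path_image half_circuit = closed_segment (- T) (7/8) \<union> closed_segment (7/8) T \<union> closed_segment T (- T)"
    by (simp add: half_circuit_def right_path_def center_path_def path_image_join closed_segment_commute)
  also have "\<dots> = frontier half_triangle"
    unfolding half_triangle_def by (rule frontier_of_triangle[symmetric]) simp
  finally show ?thesis .
qed

lemma simple_path_half_circuit: "simple_path half_circuit"
proof -
  have Re0: "Re z = 0" if "z \<in> closed_segment T (- T)" for z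
    using that by (auto simp: in_segment)
  have A: "z = - T" if "z \<in> closed_segment (- T) (7/8)" "Re z = 0" for z
    using that by (auto simp: in_segment)
  have B: "z = T" if "z \<in> closed_segment (7/8) T" "Re z = 0" for z
    using that by (auto simp: in_segment)
  have C: "z = 7/8" if C1: "z \<in> closed_segment (- T) (7/8)" and C2: "z \<in> closed_segment (7/8) T" for z
  proof -
    obtain u where u: "0 \<le> u" "u \<le> 1" "z = (1 - u) *\<^sub>R (- T) + u *\<^sub>R (7/8)" using iffD1[OF in_segment(1) C1] by blast
    obtain v where v: "0 \<le> v" "v \<le> 1" "z = (1 - v) *\<^sub>R (7/8) + v *\<^sub>R T" using iffD1[OF in_segment(1) C2] by blast
    have "Im z = u * (7/8) - 7/8" unfolding u(3) by (simp add: field_simps)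
    moreover have "Im z = v * (7/8)" unfolding v(3) by simp
    ultimately have "v = 0" using u(2) v(1) by linarith
    then show ?thesis using v by simp
  qed
  have "arc (linepath (- T) (7/8))" "arc (linepath (7/8) T)" "arc (linepath T (- T))"
    by (rule arc_linepath; simp add: complex_eq_iff)+
  moreover from this have "arc right_path"
    unfolding right_path_def by (intro arc_join) (use C in auto)
  ultimately show ?thesis
    unfolding half_circuit_def
    by (intro simple_path_join_loop)
       (use A B Re0 in \<open>auto simp: right_path_def center_path_def path_image_join arc_reversepath\<close>)
qed

lemma half_triangle:
  "compact half_triangle" "convex half_triangle" "half_triangle \<subseteq> cball 0 1" "- 1/2 \<notin> half_triangle"
  "1/2 \<in> interior half_triangle"
proof -
  show "compact half_triangle" unfolding half_triangle_def by (simp add: compact_convex_hull)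
  show "convex half_triangle" unfolding half_triangle_def by simp
  show "half_triangle \<subseteq> cball 0 1" unfolding half_triangle_def by (rule hull_minimal) auto
  have "half_triangle \<subseteq> {z. Re z \<ge> 0}"
    unfolding half_triangle_def by (rule hull_minimal) (auto simp: convex_halfspace_Re_ge)
  then show "- 1/2 \<notin> half_triangle" by auto
  have "1/2 \<in> half_triangle"
    unfolding half_triangle_def convex_hull_3
    by (rule CollectI, rule exI[of _ "3/14"], rule exI[of _ "4/7"], rule exI[of _ "3/14"])
       (simp add: complex_eq_iff)
  moreover have "1/2 \<notin> closed_segment (- T) (7/8) \<union> closed_segment (7/8) T \<union> closed_segment T (- T)"
    by (auto simp: in_segment complex_eq_iff)
  ultimately show "1/2 \<in> interior half_triangle"
    unfolding half_triangle_def by (subst interior_of_triangle) simp_all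
qed

context embedded_disc
begin

text \<open>The image of the open triangle is open by invariance of domain, and its frontier lies in
  the image of the boundary. So the component of \<open>e (1/2)\<close> off the curve cannot leave
  this bounded image.\<close>

lemma e_half_inside: "e (1/2) \<in> inside (path_image (e \<circ> half_circuit))"
proof -
  let ?I = "interior half_triangle"
  let ?S = "e ` frontier half_triangle"
  have sub: "?I \<subseteq> ball 0 1" using interior_mono[OF half_triangle(3)] by simp
  have cl: "closed half_triangle" using half_triangle(1) compact_imp_closed by blast
  have fr: "frontier half_triangle = half_triangle - ?I" using cl by (simp add: frontier_def)
  have frs: "frontier half_triangle \<subseteq> cball 0 1" "?I \<subseteq> cball 0 1"
    using fr half_triangle(3) interior_subset by blast+
  have oI: "open (e ` ?I)" by (rule open_e[OF open_interior sub])
  have cT: "compact (e ` half_triangle)"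
    using half_triangle continuous_e continuous_on_subset by (blast intro: compact_continuous_image)
  have "closure (e ` ?I) \<subseteq> e ` half_triangle"
    using cT compact_imp_closed interior_subset by (intro closure_minimal) auto
  then have F: "frontier (e ` ?I) \<subseteq> ?S"
    unfolding frontier_def[of "e ` ?I"] interior_open[OF oI] fr using image_diff_subset[of e half_triangle ?I] by fast
  have x: "e (1/2) \<notin> ?S"
    using e_image_iff[of "1/2" "frontier half_triangle"] frs half_triangle(5) by (simp add: fr)
  define C where "C = connected_component_set (- ?S) (e (1/2))"
  have "e (1/2) \<in> C" using x by (simp add: C_def)
  moreover have "C \<inter> frontier (e ` ?I) = {}"
    using F connected_component_subset[of "- ?S" "e (1/2)"] unfolding C_def by blast
  moreover have "connected C" by (simp add: C_def)
  ultimately have "C \<subseteq> e ` ?I"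
    using connected_Int_frontier[of C "e ` ?I"] imageI[OF half_triangle(5), of e] by fast
  then have "bounded C"
    using cT compact_imp_bounded interior_subset by (metis bounded_subset image_mono)
  then show ?thesis
    using x by (simp add: inside_def path_image_compose path_image_half_circuit C_def)
qed

text \<open>The curve contracts inside the image of the triangle, which contains no puncture other
  than \<open>e (1/2)\<close>; around all others it therefore does not wind.\<close>

lemma turns_e_half_circuit: "turns (e \<circ> half_circuit) = winding_number (e \<circ> half_circuit) (e (1/2))"
proof -
  have ph: "path half_circuit" using simple_path_half_circuit simple_path_imp_path by blast
  have H: "path_in half_triangle half_circuit"
    unfolding path_in_def path_image_half_circuit
    using ph half_triangle(1) compact_imp_closed frontier_subset_closed by blast
  have sc: "simply_connected (e ` half_triangle)"
    using simply_connected_e half_triangle convex_imp_simply_connected by blast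
  have eH: "path_in (e ` half_triangle) (e \<circ> half_circuit)"
    by (rule e_path_in[OF H]) (use half_triangle in auto)
  have ends: "pathstart half_circuit = - T" "pathfinish half_circuit = - T"
    by (simp_all add: half_circuit_def)
  have hc: "homotopic_paths (e ` half_triangle) (e \<circ> half_circuit) (linepath (e (- T)) (e (- T)))"
    by (rule simply_connected_homotopic[OF sc eH])
       (use path_in_ends[OF eH] in \<open>simp_all add: ends\<close>)
  have "winding_number (e \<circ> half_circuit) p = 0" if p: "p \<in> P" "p \<noteq> e (1/2)" for p
  proof -
    have "p \<notin> e ` half_triangle"
    proof
      assume "p \<in> e ` half_triangle"
      then obtain z where z: "z \<in> half_triangle" "p = e z" by blast
      then have "e z \<in> P" "z \<in> cball 0 1" using p(1) half_triangle(3) by blast+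
      then have "z = 1/2 \<or> z = - 1/2" using e_in_P_iff by blast
      then show False using z p(2) half_triangle(4) by metis
    qed
    then have "homotopic_paths (- {p}) (e \<circ> half_circuit) (linepath (e (- T)) (e (- T)))"
      and "p \<noteq> e (- T)"
      using homotopic_paths_subset[OF hc, of "- {p}"] path_in_ends[OF eH] ends by auto
    then show ?thesis using winding_number_homotopic_paths by (metis winding_number_trivial)
  qed
  moreover have "e (1/2) \<in> P" using e_in_P_iff[of "1/2"] by simp
  ultimately show ?thesis
    unfolding turns_def using finite_P by (simp add: sum.remove[of P "e (1/2)"])
qed

lemma turns_half_circuit_cases: "turns (e \<circ> half_circuit) = 1 \<or> turns (e \<circ> half_circuit) = - 1"
proof -
  have "path_image half_circuit \<subseteq> cball 0 1"
    unfolding path_image_half_circuit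
    using half_triangle compact_imp_closed frontier_subset_closed by blast
  then have "simple_path (e \<circ> half_circuit)"
    using simple_path_continuous_image[OF simple_path_half_circuit]
      continuous_on_subset[OF continuous_e] inj_on_subset[OF inj_e] by blast
  then show ?thesis
    using simple_closed_path_winding_number_inside e_half_inside turns_e_half_circuit by metis
qed

lemma twist_factor_half_circuit:
  "twist_factor = exp (2 * of_real pi * \<i> * of_real \<mu> * turns (e \<circ> half_circuit))"
  by (simp add: twist_factor_def half_circuit_def)

lemma twist_factor_cases: "twist_factor = cis (2 * pi * \<mu>) \<or> twist_factor = cis (- (2 * pi * \<mu>))"
  using turns_half_circuit_cases
  by (auto simp: twist_factor_half_circuit cis_conv_exp algebra_simps)

end

section \<open>A crossed homomorphism counting crossings of a half-line\<close>

text \<open>The difference of two continuous logarithms takes values in the discrete set of integer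
  multiples of 2 \<pi> i, so it is constant on a connected set.\<close>

lemma equal_exp_unique:
  fixes f g :: "'a :: topological_space \<Rightarrow> complex"
  assumes S: "connected S" and f: "continuous_on S f" and g: "continuous_on S g"
    and eq: "\<And>s. s \<in> S \<Longrightarrow> exp (f s) = exp (g s)" and x: "x \<in> S" "f x = g x" and y: "y \<in> S"
  shows "f y = g y"
proof -
  have int: "\<exists>n::int. f s - g s = 2 * of_int n * of_real pi * \<i>" if s: "s \<in> S" for s
  proof -
    obtain n :: int where "f s = g s + of_real (of_int (2 * n) * pi) * \<i>"
      using eq[OF s] unfolding exp_eq by blast
    then show ?thesis by (intro exI[of _ n]) simp
  qed
  have "(\<lambda>s. f s - g s) constant_on S"
  proof (rule continuous_discrete_range_constant[OF S])
    show "continuous_on S (\<lambda>s. f s - g s)" by (intro continuous_intros f g)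
    fix s assume s: "s \<in> S"
    show "\<exists>e>0. \<forall>t. t \<in> S \<and> f t - g t \<noteq> f s - g s \<longrightarrow> e \<le> norm (f t - g t - (f s - g s))"
    proof (intro exI[of _ "2 * pi"] conjI allI impI)
      fix t assume t: "t \<in> S \<and> f t - g t \<noteq> f s - g s"
      obtain k where k: "f t - g t = 2 * of_int k * of_real pi * \<i>" using int t by blast
      obtain l where l: "f s - g s = 2 * of_int l * of_real pi * \<i>" using int[OF s] by blast
      have "k \<noteq> l" using t k l by auto
      have "f t - g t - (f s - g s) = of_real (2 * pi * of_int (k - l)) * \<i>"
        unfolding k l by (simp add: algebra_simps)
      then have "norm (f t - g t - (f s - g s)) = \<bar>2 * pi * of_int (k - l)\<bar>"
        by (simp only: norm_mult norm_of_real norm_ii mult_1_right)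
      also have "\<dots> = 2 * pi * \<bar>of_int (k - l)\<bar>" by (simp add: abs_mult)
      also have "\<dots> \<ge> 2 * pi * 1"
        using \<open>k \<noteq> l\<close> by (intro mult_left_mono) auto
      finally show "2 * pi \<le> norm (f t - g t - (f s - g s))" by simp
    qed simp
  qed
  then show ?thesis using x y unfolding constant_on_def by (metis eq_iff_diff_eq_0)
qed

lemma continuous_logarithm_convex:
  fixes S :: "'a :: real_normed_vector set"
  assumes "convex S" "continuous_on S f" "\<And>s. s \<in> S \<Longrightarrow> f s \<noteq> 0"
  shows "\<exists>l. continuous_on S l \<and> (\<forall>s\<in>S. f s = exp (l s :: complex))"
proof -
  obtain l where "continuous_on S l" "\<And>s. s \<in> S \<Longrightarrow> f s = exp (l s)"
    using continuous_logarithm_on_contractible[OF assms(2) convex_imp_contractible[OF assms(1)] assms(3)]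
    by blast
  then show ?thesis by blast
qed

lemma winding_number_exp:
  assumes \<psi>: "continuous_on {0..1} \<psi>" and g: "\<And>t. t \<in> {0..1} \<Longrightarrow> g t = exp (\<psi> t)"
  shows "winding_number g 0 = (\<psi> 1 - \<psi> 0) / (2 * of_real pi * \<i>)"
proof -
  have "winding_number g 0 = winding_number (exp \<circ> \<psi>) 0"
    by (rule winding_number_cong) (use g in auto)
  also have "\<dots> = (pathfinish \<psi> - pathstart \<psi>) / (2 * of_real pi * \<i>)"
    by (rule winding_number_compose_exp) (use \<psi> in \<open>simp add: path_def\<close>)
  finally show ?thesis by (simp add: pathfinish_def pathstart_def)
qed

section \<open>Lifting paths to the infinite cyclic cover\<close>

context punctured_plane
begin

text \<open>A lift of \<open>g\<close> to the infinite cyclic cover, recorded by the logarithm of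
  the product. The factors are p - z and not z - p because the former have nonnegative real part to
  the left of all punctures, where the principal logarithm then applies.\<close>

definition log_lift :: "(real \<Rightarrow> complex) \<Rightarrow> (real \<Rightarrow> complex) \<Rightarrow> bool" where
  "log_lift g \<theta> \<longleftrightarrow> continuous_on {0..1} \<theta> \<and> (\<forall>t\<in>{0..1}. exp (\<theta> t) = (\<Prod>p\<in>P. p - g t))"

lemma log_lift_unique:
  assumes "log_lift g \<theta>" "log_lift g \<theta>'" "\<theta> 0 = \<theta>' 0" "t \<in> {0..1}"
  shows "\<theta> t = \<theta>' t"
  by (rule equal_exp_unique[of "{0..1}" \<theta> \<theta>' 0]) (use assms in \<open>auto simp: log_lift_def\<close>)

lemma log_lift_exists:
  assumes g: "path_in (- P) g" and w: "exp w = (\<Prod>p\<in>P. p - g 0)"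
  obtains \<theta> where "log_lift g \<theta>" "\<theta> 0 = w"
proof -
  have gc: "continuous_on {0..1} g" using g by (simp add: path_in_def path_def)
  have nz: "(\<Prod>p\<in>P. p - g t) \<noteq> 0" if "t \<in> {0..1}" for t
    using g that finite_P by (auto simp: path_in_def path_image_def image_subset_iff)
  have "continuous_on {0..1} (\<lambda>t. \<Prod>p\<in>P. p - g t)" by (intro continuous_intros gc)
  then have "\<exists>l. continuous_on {0..1} l \<and> (\<forall>t\<in>{0..1}. (\<Prod>p\<in>P. p - g t) = exp (l t))"
    by (rule continuous_logarithm_convex[OF convex_real_interval(5)]) (use nz in auto)
  then obtain l where l: "continuous_on {0..1} l" "\<And>t. t \<in> {0..1} \<Longrightarrow> (\<Prod>p\<in>P. p - g t) = exp (l t)"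
    by blast
  have "exp (w - l 0) = 1" using w l(2)[of 0] by (simp add: exp_diff)
  then have "log_lift g (\<lambda>t. l t + (w - l 0))"
    unfolding log_lift_def using l by (auto simp: exp_add intro!: continuous_intros)
  then show ?thesis using that by force
qed

lemma log_lift_shift: "log_lift g \<theta> \<Longrightarrow> exp w = 1 \<Longrightarrow> log_lift g (\<lambda>t. \<theta> t + w)"
  unfolding log_lift_def by (auto simp: exp_add intro!: continuous_intros)

text \<open>Continuous logarithms of the single factors add up to a second lift, whose increment is
  visibly the total winding; two lifts differ by a constant.\<close>

lemma log_lift_turns:
  assumes g: "path_in (- P) g" and \<theta>: "log_lift g \<theta>"
  shows "\<theta> 1 - \<theta> 0 = 2 * of_real pi * \<i> * turns g"
proof -
  have gc: "continuous_on {0..1} g" using g by (simp add: path_in_def path_def)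
  have "\<exists>l. continuous_on {0..1} l \<and> (\<forall>t\<in>{0..1}. p - g t = exp (l t))" if p: "p \<in> P" for p
  proof -
    have nz: "p - g t \<noteq> 0" if "t \<in> {0..1}" for t
      using g that p by (auto simp: path_in_def path_image_def image_subset_iff)
    have "continuous_on {0..1} (\<lambda>t. p - g t)" by (intro continuous_intros gc)
    then show ?thesis
      by (rule continuous_logarithm_convex[OF convex_real_interval(5)]) (use nz in auto)
  qed
  then obtain l where l: "\<And>p. p \<in> P \<Longrightarrow> continuous_on {0..1} (l p)"
    "\<And>p t. p \<in> P \<Longrightarrow> t \<in> {0..1} \<Longrightarrow> p - g t = exp (l p t)" by metis
  have wn: "winding_number g p = (l p 1 - l p 0) / (2 * of_real pi * \<i>)" if p: "p \<in> P" for p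
  proof -
    \<comment> \<open>The summand i \<pi> accounts for the sign between p - g t and g t - p.\<close>
    have "winding_number (\<lambda>t. g t - p) 0 = ((l p 1 + \<i> * of_real pi) - (l p 0 + \<i> * of_real pi)) / (2 * of_real pi * \<i>)"
    proof (rule winding_number_exp)
      show "continuous_on {0..1} (\<lambda>t. l p t + \<i> * of_real pi)" by (intro continuous_intros l(1) p)
      show "g t - p = exp (l p t + \<i> * of_real pi)" if "t \<in> {0..1}" for t
        using l(2)[OF p that] by (simp add: exp_add exp_pi_i' algebra_simps)
    qed
    then show ?thesis by (simp add: winding_number_offset[of g])
  qed
  define L where "L t = (\<Sum>p\<in>P. l p t)" for t
  have "log_lift g L"
    unfolding log_lift_def
  proof (intro conjI ballI)
    show "continuous_on {0..1} L" unfolding L_def by (intro continuous_intros l(1))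
    show "exp (L t) = (\<Prod>p\<in>P. p - g t)" if "t \<in> {0..1}" for t
      using l(2) that finite_P by (simp add: L_def exp_sum)
  qed
  note LL = this
  have "exp (\<theta> 0) = exp (L 0)" using \<theta> LL by (simp add: log_lift_def)
  then have e1: "exp (\<theta> 0 - L 0) = 1" by (simp add: exp_diff)
  have "\<theta> 1 = L 1 + (\<theta> 0 - L 0)"
    by (rule log_lift_unique[OF \<theta> log_lift_shift[OF LL e1]]) simp_all
  moreover have "2 * of_real pi * \<i> * turns g = L 1 - L 0"
    unfolding turns_def L_def sum_subtractf[symmetric] sum_distrib_left
    by (rule sum.cong[OF refl]) (simp add: wn)
  ultimately show ?thesis by simp
qed

lemma log_lift_join:
  assumes "log_lift g \<theta>" "log_lift h \<eta>" "pathfinish g = pathstart h" "\<theta> 1 = \<eta> 0"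
  shows "log_lift (g +++ h) (\<theta> +++ \<eta>)"
proof -
  have "path (\<theta> +++ \<eta>)"
    using assms by (intro path_join_imp) (auto simp: log_lift_def path_def pathfinish_def pathstart_def)
  then show ?thesis
    using assms by (auto simp: log_lift_def path_def joinpaths_def)
qed

lemma turns_integer: "loop_at b g \<Longrightarrow> turns g \<in> \<int>"
  unfolding turns_def
  by (intro Ints_sum integer_winding_number) (auto simp: loop_at_def dest: path_in_avoid)

end

locale leftmost_puncture = punctured_plane P \<mu> for P \<mu> +
  fixes a :: complex and m :: nat
  assumes a_in_P: "a \<in> P" and leftmost: "\<And>p. p \<in> P \<Longrightarrow> Re a \<le> Re p"
    and m_pos: "m > 0" and \<mu>_eq: "\<mu> = 1/2 + 1 / real m"
begin

text \<open>Left of \<open>a\<close> the product \<open>\<Prod>p\<in>P. p - z\<close> has the logarithm \<open>log_left\<close>, so there the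
  \<open>2 m\<close>-fold cyclic cover splits into sheets, and \<open>on_sheet k\<close> is the indicator of the \<open>k\<close>-th one. On
  this sheet \<open>crossing k\<close> winds once around \<open>0\<close> from one side of the half-line to the left of \<open>a\<close> to
  the other; elsewhere it is \<open>1\<close>.\<close>

definition log_left :: "complex \<Rightarrow> complex" where
  "log_left z = (\<Sum>p\<in>P. Ln (p - z))"

definition sheet_angle :: "int \<Rightarrow> real" where
  "sheet_angle k = 2 * pi * of_int k / of_nat (2 * m)"

definition on_sheet :: "int \<Rightarrow> complex \<Rightarrow> complex" where
  "on_sheet k r = (\<Sum>j<2 * m. (r * cis (- sheet_angle k)) ^ j) / of_nat (2 * m)"

definition sheet_root :: "complex \<Rightarrow> complex \<Rightarrow> complex" where
  "sheet_root z y = exp ((y - log_left z) / of_nat (2 * m))"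

definition crossing :: "int \<Rightarrow> complex \<Rightarrow> complex \<Rightarrow> complex" where
  "crossing k z y =
    (if Re z \<le> Re a then 1 + on_sheet k (sheet_root z y) * (- cnj (a - z) / (a - z) - 1) else 1)"

lemma left_Re: "Re z \<le> Re a \<Longrightarrow> p \<in> P \<Longrightarrow> Re (p - z) \<ge> 0"
  using leftmost[of p] by simp

lemma left_nonzero:
  assumes "Re z \<le> Re a" "z \<notin> P" "p \<in> P" shows "p - z \<notin> \<real>\<^sub>\<le>\<^sub>0"
proof
  assume "p - z \<in> \<real>\<^sub>\<le>\<^sub>0"
  then have "p = z" using left_Re[OF assms(1,3)] by (auto simp: complex_nonpos_Reals_iff complex_eq_iff)
  then show False using assms by simp
qed

lemma exp_log_left:
  assumes "z \<notin> P" shows "exp (log_left z) = (\<Prod>p\<in>P. p - z)"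
proof -
  have "p - z \<noteq> 0" if "p \<in> P" for p using assms that by auto
  then show ?thesis unfolding log_left_def using finite_P by (subst exp_sum) (auto intro!: prod.cong)
qed

lemma sheet_root_power:
  assumes "z \<notin> P" "exp y = (\<Prod>p\<in>P. p - z)"
  shows "sheet_root z y ^ (2 * m) = 1"
proof -
  have "sheet_root z y ^ (2 * m) = exp (y - log_left z)"
    unfolding sheet_root_def exp_of_nat_mult[symmetric] using m_pos by simp
  also have "\<dots> = 1" unfolding exp_diff assms(2) exp_log_left[OF assms(1)]
    using assms(1) finite_P by auto
  finally show ?thesis .
qed

lemma sheet_angle_simps:
  "sheet_angle (k + of_nat (2 * m)) = sheet_angle k + 2 * pi"
  "sheet_angle (k - 1) = sheet_angle k - 2 * pi / of_nat (2 * m)"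
  "of_nat (2 * m) * sheet_angle k = 2 * pi * of_int k"
  using m_pos by (simp_all add: sheet_angle_def field_simps)

lemma cis_sheet_angle_power: "cis (sheet_angle k) ^ (2 * m) = 1"
  by (simp only: Complex.DeMoivre sheet_angle_simps(3)) (simp add: cis_multiple_2pi)

text \<open>A geometric sum over a root of unity. Defining the indicator by this polynomial makes it
  continuous in \<open>r\<close>, which a case distinction would hide.\<close>

lemma on_sheet_cases:
  assumes "r ^ (2 * m) = 1"
  shows "on_sheet k r = (if r = cis (sheet_angle k) then 1 else 0)"
proof -
  define w where "w = r * cis (- sheet_angle k)"
  have w: "w = r / cis (sheet_angle k)" unfolding w_def cis_inverse[symmetric] divide_inverse ..
  then have "w ^ (2 * m) = 1" unfolding w power_divide assms cis_sheet_angle_power by simp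
  then have "w \<noteq> 1 \<Longrightarrow> (\<Sum>j<2 * m. w ^ j) = 0" using geometric_sum[of w "2 * m"] by simp
  moreover have "w = 1 \<longleftrightarrow> r = cis (sheet_angle k)" unfolding w by (simp add: divide_eq_1_iff)
  ultimately show ?thesis unfolding on_sheet_def w_def[symmetric] using m_pos by (cases "w = 1") simp_all
qed

lemma on_sheet_periodic: "on_sheet (k + of_nat (2 * m)) r = on_sheet k r"
proof -
  have "cis (- sheet_angle (k + of_nat (2 * m))) = cis (- sheet_angle k)"
    unfolding sheet_angle_simps minus_add_distrib cis_mult[symmetric] by (simp add: complex_eq_iff)
  then show ?thesis by (simp only: on_sheet_def)
qed

lemma on_sheet_shift:
  "on_sheet k (r * cis (2 * pi / of_nat (2 * m))) = on_sheet (k - 1) r"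
proof -
  have "r * cis (2 * pi / of_nat (2 * m)) * cis (- sheet_angle k) = r * cis (- sheet_angle (k - 1))"
    unfolding sheet_angle_simps by (simp only: mult.assoc cis_mult) simp
  then show ?thesis by (simp only: on_sheet_def)
qed

text \<open>On the vertical line through \<open>a\<close> the number a - z is imaginary, so the
  quotient in \<open>crossing\<close> is 1. Both branches of its definition therefore agree there,
  which makes it continuous across the line.\<close>

lemma crossing_right:
  assumes "z \<notin> P" "Re z \<ge> Re a" shows "crossing k z y = 1"
proof (cases "Re z = Re a")
  case True
  then have "cnj (a - z) = - (a - z)" by (simp add: complex_eq_iff)
  moreover have "a - z \<noteq> 0" using assms(1) a_in_P by auto
  ultimately show ?thesis by (simp add: crossing_def divide_eq_minus_1_iff)
qed (use assms in \<open>simp add: crossing_def\<close>)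

lemma crossing_cases:
  assumes "z \<notin> P" "exp y = (\<Prod>p\<in>P. p - z)" "Re z \<le> Re a"
  shows "crossing k z y = (if sheet_root z y = cis (sheet_angle k) then - cnj (a - z) / (a - z) else 1)"
  using assms(3) on_sheet_cases[OF sheet_root_power[OF assms(1,2)], of k] by (simp add: crossing_def)

lemma crossing_nonzero:
  assumes "z \<notin> P" "exp y = (\<Prod>p\<in>P. p - z)"
  shows "crossing k z y \<noteq> 0"
proof (cases "Re z \<le> Re a")
  case True
  have "a - z \<noteq> 0" using assms(1) a_in_P by auto
  then show ?thesis using crossing_cases[OF assms True] by simp
qed (simp add: crossing_def)

lemma continuous_on_sheet_root:
  fixes z :: "'a :: topological_space \<Rightarrow> complex"
  assumes z: "continuous_on S z" and y: "continuous_on S y"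
    and zP: "\<And>s. s \<in> S \<Longrightarrow> z s \<notin> P" "\<And>s. s \<in> S \<Longrightarrow> Re (z s) \<le> Re a"
  shows "continuous_on S (\<lambda>s. sheet_root (z s) (y s))"
  unfolding sheet_root_def log_left_def
  using m_pos zP left_nonzero by (intro continuous_intros z y) auto

lemma continuous_on_crossing:
  fixes z :: "'a :: topological_space \<Rightarrow> complex"
  assumes z: "continuous_on S z" and y: "continuous_on S y" and S: "closed S"
    and zP: "\<And>s. s \<in> S \<Longrightarrow> z s \<notin> P"
  shows "continuous_on S (\<lambda>s. crossing k (z s) (y s))"
proof -
  let ?L = "{s \<in> S. Re (z s) \<le> Re a}" and ?R = "{s \<in> S. Re a \<le> Re (z s)}"
  have cz: "continuous_on S (\<lambda>s. Re (z s))" by (intro continuous_intros z)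
  have cl: "closed ?L" "closed ?R"
    using continuous_closed_preimage[OF cz S, of "{..Re a}"] continuous_closed_preimage[OF cz S, of "{Re a..}"]
    by (simp_all add: vimage_def Int_def)
  have az: "a - z s \<noteq> 0" if "s \<in> S" for s using zP[OF that] a_in_P by auto
  have zL: "continuous_on ?L z" "continuous_on ?L y"
    using z y by (auto elim: continuous_on_subset)
  have "continuous_on ?L (\<lambda>s. 1 + on_sheet k (sheet_root (z s) (y s)) * (- cnj (a - z s) / (a - z s) - 1))"
    unfolding on_sheet_def using az zP
    by (intro continuous_intros continuous_on_sheet_root zL) (use m_pos in auto)
  then have 1: "continuous_on ?L (\<lambda>s. crossing k (z s) (y s))"
    by (rule continuous_on_eq) (simp add: crossing_def)
  have 2: "continuous_on ?R (\<lambda>s. crossing k (z s) (y s))"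
    by (rule continuous_on_eq[OF continuous_on_const[of _ 1]]) (simp add: crossing_right zP)
  have "continuous_on (?L \<union> ?R) (\<lambda>s. crossing k (z s) (y s))"
    by (rule continuous_on_closed_Un[OF cl 1 2])
  moreover have "?L \<union> ?R = S" by auto
  ultimately show ?thesis by simp
qed

lemma log_lift_crossing:
  assumes g: "path_in (- P) g" and \<theta>: "log_lift g \<theta>"
  shows "path (\<lambda>t. crossing k (g t) (\<theta> t))" "0 \<notin> path_image (\<lambda>t. crossing k (g t) (\<theta> t))"
proof -
  have gP: "g t \<notin> P" if "t \<in> {0..1}" for t
    using g that by (auto simp: path_in_def path_image_def image_subset_iff)
  show "path (\<lambda>t. crossing k (g t) (\<theta> t))"
    unfolding path_def
    by (rule continuous_on_crossing) (use g \<theta> gP in \<open>auto simp: path_in_def path_def log_lift_def\<close>)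
  show "0 \<notin> path_image (\<lambda>t. crossing k (g t) (\<theta> t))"
    using crossing_nonzero[OF gP] \<theta> by (force simp: path_image_def log_lift_def)
qed

definition crossing_number :: "(real \<Rightarrow> complex) \<Rightarrow> (real \<Rightarrow> complex) \<Rightarrow> int \<Rightarrow> complex" where
  "crossing_number g \<theta> k = winding_number (\<lambda>t. crossing k (g t) (\<theta> t)) 0"

definition crossing_sum :: "(real \<Rightarrow> complex) \<Rightarrow> (real \<Rightarrow> complex) \<Rightarrow> complex" where
  "crossing_sum g \<theta> = (\<Sum>k<2 * m. cis (2 * pi * \<mu> * real k) * crossing_number g \<theta> (int k))"

lemma crossing_number_cong:
  "(\<And>t. t \<in> {0..1} \<Longrightarrow> \<theta> t = \<theta>' t) \<Longrightarrow> crossing_number g \<theta> k = crossing_number g \<theta>' k"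
  unfolding crossing_number_def by (rule winding_number_cong) simp

lemma crossing_sum_cong:
  "(\<And>t. t \<in> {0..1} \<Longrightarrow> \<theta> t = \<theta>' t) \<Longrightarrow> crossing_sum g \<theta> = crossing_sum g \<theta>'"
  unfolding crossing_sum_def using crossing_number_cong[of \<theta> \<theta>' g] by simp

lemma crossing_number_join:
  assumes g: "path_in (- P) g" "log_lift g \<theta>" and h: "path_in (- P) h" "log_lift h \<eta>"
    and e: "pathfinish g = pathstart h" "\<theta> 1 = \<eta> 0"
  shows "crossing_number (g +++ h) (\<theta> +++ \<eta>) k = crossing_number g \<theta> k + crossing_number h \<eta> k"
proof -
  have "(\<lambda>t. crossing k ((g +++ h) t) ((\<theta> +++ \<eta>) t)) =
      (\<lambda>t. crossing k (g t) (\<theta> t)) +++ (\<lambda>t. crossing k (h t) (\<eta> t))"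
    by (auto simp: joinpaths_def)
  then show ?thesis
    unfolding crossing_number_def
    using log_lift_crossing[OF g, of k] log_lift_crossing[OF h, of k] e
    by (simp add: winding_number_join pathstart_def pathfinish_def)
qed

lemma crossing_sum_join:
  assumes "path_in (- P) g" "log_lift g \<theta>" "path_in (- P) h" "log_lift h \<eta>"
    "pathfinish g = pathstart h" "\<theta> 1 = \<eta> 0"
  shows "crossing_sum (g +++ h) (\<theta> +++ \<eta>) = crossing_sum g \<theta> + crossing_sum h \<eta>"
  unfolding crossing_sum_def by (simp add: crossing_number_join[OF assms] algebra_simps sum.distrib)

lemma crossing_sum_right:
  assumes g: "path_in (- P) g" and r: "\<And>z. z \<in> path_image g \<Longrightarrow> Re a \<le> Re z"
  shows "crossing_sum g \<theta> = 0"
proof -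
  have "crossing_number g \<theta> k = winding_number (linepath 1 1) 0" for k
    unfolding crossing_number_def
  proof (rule winding_number_cong)
    fix t :: real assume "0 \<le> t" "t \<le> 1"
    then have "g t \<in> path_image g" by (simp add: path_image_def)
    then show "crossing k (g t) (\<theta> t) = linepath 1 1 t"
      using crossing_right[of "g t" k] r g by (auto simp: path_in_def linepath_def)
  qed
  then show ?thesis by (simp add: crossing_sum_def)
qed

text \<open>The weight \<open>exp (2 \<pi> i \<mu> k)\<close> has period \<open>2 m\<close> because \<open>2 m \<mu> = m + 2\<close>.\<close>

lemma crossing_sum_shift1:
  "crossing_sum g (\<lambda>t. \<theta> t + 2 * of_real pi * \<i>) = cis (2 * pi * \<mu>) * crossing_sum g \<theta>"
proof -
  define F where "F k = cis (2 * pi * \<mu> * of_int k) * crossing_number g \<theta> k" for k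
  \<comment> \<open>Adding 2 \<pi> i to the logarithm leads to the next sheet.\<close>
  have "sheet_root z (y + 2 * of_real pi * \<i>) = sheet_root z y * cis (2 * pi / of_nat (2 * m))" for z y
    unfolding sheet_root_def cis_conv_exp exp_add[symmetric] using m_pos by (simp add: field_simps)
  then have "crossing k z (y + 2 * of_real pi * \<i>) = crossing (k - 1) z y" for k z y
    by (simp only: crossing_def on_sheet_shift)
  then have s: "crossing_number g (\<lambda>t. \<theta> t + 2 * of_real pi * \<i>) k = crossing_number g \<theta> (k - 1)" for k
    by (simp only: crossing_number_def)
  have per: "F (k + of_nat (2 * m)) = F k" for k
  proof -
    have "2 * pi * \<mu> * of_int (k + of_nat (2 * m)) = 2 * pi * \<mu> * of_int k + 2 * pi * of_int (int m + 2)"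
      using m_pos by (simp add: \<mu>_eq field_simps)
    then have "cis (2 * pi * \<mu> * of_int (k + of_nat (2 * m))) = cis (2 * pi * \<mu> * of_int k)"
      by (simp only: cis_mult[symmetric] cis_multiple_2pi Ints_of_int) simp
    moreover have "crossing_number g \<theta> (k + of_nat (2 * m)) = crossing_number g \<theta> k"
      unfolding crossing_number_def crossing_def on_sheet_periodic ..
    ultimately show ?thesis by (simp only: F_def)
  qed
  have "crossing_sum g (\<lambda>t. \<theta> t + 2 * of_real pi * \<i>) = (\<Sum>k<2 * m. cis (2 * pi * \<mu>) * F (int k - 1))"
    unfolding crossing_sum_def s
    by (rule sum.cong[OF refl]) (simp add: F_def cis_mult mult.assoc[symmetric], simp add: algebra_simps)
  also have "\<dots> = cis (2 * pi * \<mu>) * (\<Sum>k<2 * m. F (int k - 1))" by (simp only: sum_distrib_left)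
  \<comment> \<open>Both sums run over a full period of \<open>F\<close>: the term at - 1 is the one
    at 2 m - 1.\<close>
  also have "(\<Sum>k<2 * m. F (int k - 1)) = (\<Sum>k<2 * m. F (int k))"
  proof -
    obtain l where l: "2 * m = Suc l" using m_pos by (metis Suc_pred nat_0_less_mult_iff pos2)
    have "(\<Sum>k<Suc l. F (int k - 1)) = F (- 1) + (\<Sum>k<l. F (int k))"
      by (subst sum.lessThan_Suc_shift) simp
    also have "F (- 1) = F (int l)" using per[of "- 1"] l by simp
    finally show ?thesis unfolding l by simp
  qed
  finally show ?thesis by (simp add: crossing_sum_def F_def)
qed

lemma crossing_sum_shift:
  "crossing_sum g (\<lambda>t. \<theta> t + 2 * of_real pi * \<i> * of_int w) = cis (2 * pi * \<mu> * of_int w) * crossing_sum g \<theta>"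
proof (induction w rule: int_induct[of _ 0])
  case (step1 w)
  have "(\<lambda>t. \<theta> t + 2 * of_real pi * \<i> * of_int w + 2 * of_real pi * \<i>) = (\<lambda>t. \<theta> t + 2 * of_real pi * \<i> * of_int (w + 1))"
    by (simp add: algebra_simps)
  then have "crossing_sum g (\<lambda>t. \<theta> t + 2 * of_real pi * \<i> * of_int (w + 1)) =
      cis (2 * pi * \<mu>) * (cis (2 * pi * \<mu> * of_int w) * crossing_sum g \<theta>)"
    using crossing_sum_shift1[of g "\<lambda>t. \<theta> t + 2 * of_real pi * \<i> * of_int w"] step1 by metis
  also have "\<dots> = cis (2 * pi * \<mu> * of_int (w + 1)) * crossing_sum g \<theta>"
    unfolding mult.assoc[symmetric] cis_mult by (simp add: algebra_simps)
  finally show ?case .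
next
  case (step2 w)
  have "(\<lambda>t. \<theta> t + 2 * of_real pi * \<i> * of_int (w - 1) + 2 * of_real pi * \<i>) = (\<lambda>t. \<theta> t + 2 * of_real pi * \<i> * of_int w)"
    by (simp add: algebra_simps)
  then have "cis (2 * pi * \<mu>) * crossing_sum g (\<lambda>t. \<theta> t + 2 * of_real pi * \<i> * of_int (w - 1)) =
      cis (2 * pi * \<mu> * of_int w) * crossing_sum g \<theta>"
    using crossing_sum_shift1[of g "\<lambda>t. \<theta> t + 2 * of_real pi * \<i> * of_int (w - 1)"] step2 by metis
  also have "cis (2 * pi * \<mu> * of_int w) = cis (2 * pi * \<mu>) * cis (2 * pi * \<mu> * of_int (w - 1))"
    unfolding cis_mult by (simp add: algebra_simps)
  finally show ?case by simp
qed simp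

end

section \<open>Reflections and invariant hermitian forms\<close>

text \<open>The functionals \<open>l\<^sub>i\<close> are eigenvectors of reflections satisfying the braid relations. The
  invariant hermitian form obtained by summing over the orbit \<open>A\<close> has Gram matrix \<open>h\<close> on the
  diagonal, \<open>- h / (1 + q)\<close> next to it and \<open>0\<close> in the corners, which is not positive semidefinite
  unless \<open>h = 0\<close>.\<close>

lemma reflections_vanish:
  fixes l1 l2 l3 :: "'a \<Rightarrow> complex" and q :: complex
  assumes A: "finite A"
    and s: "bij_betw s1 A A" "bij_betw s2 A A" "bij_betw s3 A A"
    and q: "norm q = 1" "q \<noteq> - 1" "(norm (1 + q))\<^sup>2 < 2"
    and s1: "\<And>c. c \<in> A \<Longrightarrow> l1 (s1 c) = - q * l1 c" "\<And>c. c \<in> A \<Longrightarrow> l2 (s1 c) = l2 c + q * l1 c"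
      "\<And>c. c \<in> A \<Longrightarrow> l3 (s1 c) = l3 c"
    and s2: "\<And>c. c \<in> A \<Longrightarrow> l1 (s2 c) = l1 c + l2 c" "\<And>c. c \<in> A \<Longrightarrow> l2 (s2 c) = - q * l2 c"
      "\<And>c. c \<in> A \<Longrightarrow> l3 (s2 c) = l3 c + q * l2 c"
    and s3: "\<And>c. c \<in> A \<Longrightarrow> l2 (s3 c) = l2 c + l3 c" "\<And>c. c \<in> A \<Longrightarrow> l3 (s3 c) = - q * l3 c"
    and c: "c \<in> A"
  shows "l1 c = 0"
proof -
  define H where "H f g = (\<Sum>c\<in>A. f c * cnj (g c))" for f g :: "'a \<Rightarrow> complex"
  have inv: "H f g = (\<Sum>c\<in>A. f (s c) * cnj (g (s c)))" if "bij_betw s A A" for f g s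
    unfolding H_def by (rule sum.reindex_bij_betw[OF that, symmetric])
  have qc: "q * cnj q = 1" using q(1) complex_norm_square[of q] by simp
  have q1: "1 + q \<noteq> 0" using q(2) by (simp add: add_eq_0_iff)
  have solve: "(1 + q) * x = - y" if "x = - q * x - y" for x y
  proof -
    have "(1 + q) * x = (x - (- q * x - y)) - y" by (simp add: algebra_simps)
    also have "\<dots> = 0 - y" by (simp only: iffD1[OF eq_iff_diff_eq_0 that])
    finally show ?thesis by simp
  qed
  have solve': "(1 + q) * x = - y" if "q * x = - 1 * x - 1 * y" for x y
  proof -
    have "(1 + q) * x = (q * x - (- 1 * x - 1 * y)) - y" by (simp add: algebra_simps)
    also have "\<dots> = 0 - y" by (simp only: iffD1[OF eq_iff_diff_eq_0 that])
    finally show ?thesis by simp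
  qed
  \<comment> \<open>Every reflection gives linear equations for entries of the Gram matrix; for this
    entry it is (1 + q) H = 0.\<close>
  have "H l1 l3 = (\<Sum>c\<in>A. - q * (l1 c * cnj (l3 c)))"
    unfolding inv[OF s(1)] by (rule sum.cong[OF refl]) (simp add: s1)
  also have "\<dots> = - q * H l1 l3" by (simp only: H_def sum_distrib_left)
  finally have "(1 + q) * H l1 l3 = 0" by (simp add: distrib_right eq_neg_iff_add_eq_0)
  then have H13: "H l1 l3 = 0" using q1 by simp
  have "H l1 l2 = (\<Sum>c\<in>A. - q * (l1 c * cnj (l2 c)) - q * cnj q * (l1 c * cnj (l1 c)))"
    unfolding inv[OF s(1)] by (rule sum.cong[OF refl]) (simp add: s1 algebra_simps)
  also have "\<dots> = - q * H l1 l2 - H l1 l1"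
    unfolding qc by (simp add: H_def sum_distrib_left sum_subtractf)
  finally have e12: "(1 + q) * H l1 l2 = - H l1 l1" by (rule solve)
  \<comment> \<open>The same entry, now by invariance under the neighbouring reflection. Comparing
    the two results makes the diagonal entries equal.\<close>
  have "H l1 l2 = (\<Sum>c\<in>A. - cnj q * (l1 c * cnj (l2 c)) - cnj q * (l2 c * cnj (l2 c)))"
    unfolding inv[OF s(2)] by (rule sum.cong[OF refl]) (simp add: s2 algebra_simps)
  also have "\<dots> = - cnj q * H l1 l2 - cnj q * H l2 l2"
    by (simp add: H_def sum_distrib_left sum_subtractf)
  finally have "q * H l1 l2 = - (q * cnj q) * H l1 l2 - (q * cnj q) * H l2 l2"
    by (metis (no_types, lifting) minus_mult_commute mult.assoc right_diff_distrib)
  then have e12': "(1 + q) * H l1 l2 = - H l2 l2" unfolding qc by (rule solve')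
  have "H l2 l3 = (\<Sum>c\<in>A. - q * (l2 c * cnj (l3 c)) - q * cnj q * (l2 c * cnj (l2 c)))"
    unfolding inv[OF s(2)] by (rule sum.cong[OF refl]) (simp add: s2 algebra_simps)
  also have "\<dots> = - q * H l2 l3 - H l2 l2"
    unfolding qc by (simp add: H_def sum_distrib_left sum_subtractf)
  finally have e23: "(1 + q) * H l2 l3 = - H l2 l2" by (rule solve)
  have "H l2 l3 = (\<Sum>c\<in>A. - cnj q * (l2 c * cnj (l3 c)) - cnj q * (l3 c * cnj (l3 c)))"
    unfolding inv[OF s(3)] by (rule sum.cong[OF refl]) (simp add: s3 algebra_simps)
  also have "\<dots> = - cnj q * H l2 l3 - cnj q * H l3 l3"
    by (simp add: H_def sum_distrib_left sum_subtractf)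
  finally have "q * H l2 l3 = - (q * cnj q) * H l2 l3 - (q * cnj q) * H l3 l3"
    by (metis (no_types, lifting) minus_mult_commute mult.assoc right_diff_distrib)
  then have e23': "(1 + q) * H l2 l3 = - H l3 l3" unfolding qc by (rule solve')
  define h where "h = (\<Sum>c\<in>A. (norm (l1 c))\<^sup>2)"
  define a where "a = - 1 / (1 + q)"
  have Hn: "H f f = of_real (\<Sum>c\<in>A. (norm (f c))\<^sup>2)" for f
    unfolding H_def of_real_sum by (rule sum.cong[OF refl]) (simp only: complex_norm_square)
  have h: "H l1 l1 = of_real h" "H l2 l2 = of_real h" "H l3 l3 = of_real h"
    using e12 e12' e23 e23' Hn[of l1] by (simp_all add: h_def)
  have sym: "H g f = cnj (H f g)" for f g
    by (simp add: H_def mult.commute)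
  have G: "H l1 l2 = a * of_real h" "H l2 l3 = a * of_real h"
    using e12 e23 q1 unfolding h a_def by (simp_all add: field_simps)
  have G': "H l2 l1 = cnj a * of_real h" "H l3 l2 = cnj a * of_real h" "H l3 l1 = 0"
    unfolding sym[where g = l2 and f = l1] sym[where g = l3 and f = l2] sym[where g = l3 and f = l1] G H13
    by simp_all
  \<comment> \<open>For h \<noteq> 0 this is \<open>l2\<close> minus its projections to the
    orthogonal vectors \<open>l1\<close> and \<open>l3\<close>, the candidate for a vector of
    negative square.\<close>
  define v where "v c = l2 c - cnj a * l1 c - a * l3 c" for c
  have "H v v = H l2 l2 - a * H l2 l1 - cnj a * H l2 l3
      - cnj a * H l1 l2 + cnj a * a * H l1 l1 + cnj a * cnj a * H l1 l3
      - a * H l3 l2 + a * a * H l3 l1 + a * cnj a * H l3 l3"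
    unfolding H_def v_def
    by (simp add: sum_distrib_left sum_subtractf[symmetric] sum.distrib[symmetric] algebra_simps)
  also have "\<dots> = of_real h * (1 - 2 * (a * cnj a))"
    unfolding G G' h H13 by (simp add: algebra_simps)
  also have "a * cnj a = of_real ((norm a)\<^sup>2)" using complex_norm_square[of a] by simp
  finally have "of_real (\<Sum>c\<in>A. (norm (v c))\<^sup>2) = (of_real (h * (1 - 2 * (norm a)\<^sup>2)) :: complex)"
    unfolding Hn by simp
  then have "h * (1 - 2 * (norm a)\<^sup>2) = (\<Sum>c\<in>A. (norm (v c))\<^sup>2)" by (simp only: of_real_eq_iff)
  then have "h * (1 - 2 * (norm a)\<^sup>2) \<ge> 0" by (simp add: sum_nonneg)
  \<comment> \<open>Here |1 + q|^2 < 2 enters, through |a| = 1 / |1 + q|.\<close>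
  moreover have "1 - 2 * (norm a)\<^sup>2 < 0"
    using q(3) q1 by (simp add: a_def norm_divide power_divide field_simps)
  ultimately have "h \<le> 0" by (simp add: zero_le_mult_iff)
  moreover have "h \<ge> (norm (l1 c))\<^sup>2"
    unfolding h_def using A c by (intro member_le_sum) auto
  ultimately have "(norm (l1 c))\<^sup>2 \<le> 0" by linarith
  then show ?thesis by simp
qed

section \<open>The crossing cocycle\<close>

context leftmost_puncture
begin

text \<open>A path that stays left of \<open>a\<close> remains in one sheet \<open>k0\<close>, and
  there it passes the half-line once. So the sum consists of a single term, a root of unity up to
  sign.\<close>

lemma crossing_sum_left:
  assumes g: "path_in (- P) g" and \<theta>: "log_lift g \<theta>"
    and left: "\<And>z. z \<in> path_image g \<Longrightarrow> Re z \<le> Re a"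
    and top: "Re (g 0) = Re a" "Im a < Im (g 0)" and bot: "Re (g 1) = Re a" "Im (g 1) < Im a"
  shows "crossing_sum g \<theta> \<noteq> 0"
proof -
  have gP: "g t \<notin> P" "Re (g t) \<le> Re a" "a - g t \<noteq> 0" "a - g t \<notin> \<real>\<^sub>\<le>\<^sub>0" if t: "t \<in> {0..1}" for t
  proof -
    have i: "g t \<in> path_image g" using t by (simp add: path_image_def)
    show 1: "g t \<notin> P" using i g by (auto simp: path_in_def)
    show 2: "Re (g t) \<le> Re a" using left[OF i] .
    show "a - g t \<noteq> 0" using 1 a_in_P by auto
    show "a - g t \<notin> \<real>\<^sub>\<le>\<^sub>0" using left_nonzero[OF 2 1 a_in_P] .
  qed
  have gc: "continuous_on {0..1} g" using g by (simp add: path_in_def path_def)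
  have \<theta>c: "continuous_on {0..1} \<theta>" and \<theta>e: "\<And>t. t \<in> {0..1} \<Longrightarrow> exp (\<theta> t) = (\<Prod>p\<in>P. p - g t)"
    using \<theta> by (auto simp: log_lift_def)
  \<comment> \<open>The difference from the logarithm \<open>log_left\<close> is a continuous
    logarithm of 1, hence constant: the path does not change sheets.\<close>
  define d where "d t = \<theta> t - log_left (g t)" for t
  have ed: "exp (d t) = 1" if t: "t \<in> {0..1}" for t
    unfolding d_def exp_diff \<theta>e[OF t] exp_log_left[OF gP(1)[OF t]] using gP(1)[OF t] finite_P by auto
  have dc: "d t = d 0" if t: "t \<in> {0..1}" for t
  proof (rule equal_exp_unique[of "{0..1}" d "\<lambda>_. d 0" 0 t])
    have "continuous_on {0..1} (\<lambda>t. log_left (g t))"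
      unfolding log_left_def using gP left_nonzero by (intro continuous_intros gc) auto
    then show "continuous_on {0..1} d" unfolding d_def by (intro continuous_intros \<theta>c)
  qed (use t ed in auto)
  define r where "r = exp (d 0 / of_nat (2 * m))"
  have root: "sheet_root (g t) (\<theta> t) = r" if t: "t \<in> {0..1}" for t
    using dc[OF t] by (simp add: sheet_root_def r_def d_def)
  have r1: "r ^ (2 * m) = 1"
    using sheet_root_power[OF gP(1) \<theta>e, of 0] root[of 0] by simp
  have bij: "bij_betw (\<lambda>k. cis (2 * pi * real k / real (2 * m))) {..<2 * m} {z. z ^ (2 * m) = 1}"
    by (rule Complex.bij_betw_roots_unity) (use m_pos in simp)
  then have "r \<in> (\<lambda>k. cis (2 * pi * real k / real (2 * m))) ` {..<2 * m}"
    using r1 by (simp add: bij_betw_def)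
  then obtain k0 where k0: "k0 < 2 * m" "r = cis (sheet_angle (int k0))"
    by (auto simp: sheet_angle_def)
  have inj: "r = cis (sheet_angle (int k)) \<longleftrightarrow> k = k0" if "k < 2 * m" for k
    using bij_betw_imp_inj_on[OF bij] that k0 unfolding inj_on_def by (auto simp: sheet_angle_def)
  \<comment> \<open>A logarithm of - cnj (a - z) / (a - z), equal to i (\<pi> - 2 arg (a - z)). From
    above \<open>a\<close> to below it, the argument of a - z grows from - \<pi>/2 to \<pi>/2, so
    \<psi> falls from 2 \<pi> i to 0.\<close>
  define \<psi> where "\<psi> t = \<i> * of_real pi + cnj (Ln (a - g t)) - Ln (a - g t)" for t
  have "crossing_number g \<theta> (int k0) = (\<psi> 1 - \<psi> 0) / (2 * of_real pi * \<i>)"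
    unfolding crossing_number_def
  proof (rule winding_number_exp)
    show "continuous_on {0..1} \<psi>" unfolding \<psi>_def using gP by (intro continuous_intros gc) auto
    fix t :: real assume t: "t \<in> {0..1}"
    have "exp (\<psi> t) = - cnj (a - g t) / (a - g t)"
      using gP(3)[OF t] by (simp add: \<psi>_def exp_add exp_diff exp_cnj[symmetric])
    then show "crossing (int k0) (g t) (\<theta> t) = exp (\<psi> t)"
      using crossing_cases[OF gP(1)[OF t] \<theta>e[OF t] gP(2)[OF t], of "int k0"] root[OF t] k0 by simp
  qed
  also have "\<dots> = - 1"
  proof -
    define y where "y = Im (g 0) - Im a"
    have "y > 0" "a - g 0 = of_real y * (- \<i>)" using top by (simp_all add: y_def complex_eq_iff)
    then have "Ln (a - g 0) = of_real (ln y) - \<i> * (of_real pi / 2)"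
      using Ln_times_of_real[of y "- \<i>"] by (simp add: Ln_of_real)
    then have 0: "\<psi> 0 = 2 * of_real pi * \<i>" by (simp add: \<psi>_def)
    define x where "x = Im a - Im (g 1)"
    have "x > 0" "a - g 1 = of_real x * \<i>" using bot by (simp_all add: x_def complex_eq_iff)
    then have "Ln (a - g 1) = of_real (ln x) + \<i> * (of_real pi / 2)"
      using Ln_times_of_real[of x "\<i>"] by (simp add: Ln_of_real)
    then have 1: "\<psi> 1 = 0" by (simp add: \<psi>_def)
    show ?thesis unfolding 0 1 by simp
  qed
  finally have n0: "crossing_number g \<theta> (int k0) = - 1" .
  have n: "crossing_number g \<theta> (int k) = 0" if k: "k < 2 * m" "k \<noteq> k0" for k
  proof -
    have "crossing_number g \<theta> (int k) = winding_number (linepath 1 1) 0"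
      unfolding crossing_number_def
    proof (rule winding_number_cong)
      fix t :: real assume "0 \<le> t" "t \<le> 1"
      then have t: "t \<in> {0..1}" by simp
      show "crossing (int k) (g t) (\<theta> t) = linepath 1 1 t"
        using crossing_cases[OF gP(1)[OF t] \<theta>e[OF t] gP(2)[OF t], of "int k"] root[OF t] inj k
        by (simp add: linepath_def)
    qed
    then show ?thesis by simp
  qed
  have "crossing_sum g \<theta> = (\<Sum>k<2 * m. if k = k0 then - cis (2 * pi * \<mu> * real k) else 0)"
    unfolding crossing_sum_def by (rule sum.cong[OF refl]) (use n n0 in auto)
  also have "\<dots> = - cis (2 * pi * \<mu> * real k0)" using k0(1) by (subst sum.delta) auto
  finally show ?thesis by simp
qed

definition base_log :: "complex \<Rightarrow> complex" where
  "base_log b = Ln (\<Prod>p\<in>P. p - b)"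

text \<open>Crossings of the half-line are counted along the lift that starts at a fixed point over
  \<open>b\<close>. The lift is unique on the unit interval, so the choice does not matter
  (\<open>crossing_cocycle_eq\<close>).\<close>

definition crossing_cocycle :: "complex \<Rightarrow> (real \<Rightarrow> complex) \<Rightarrow> complex" where
  "crossing_cocycle b g = crossing_sum g (SOME \<theta>. log_lift g \<theta> \<and> \<theta> 0 = base_log b)"

lemma exp_base_log: "b \<notin> P \<Longrightarrow> exp (base_log b) = (\<Prod>p\<in>P. p - b)"
  unfolding base_log_def using finite_P by (intro exp_Ln) auto

lemma crossing_cocycle_eq:
  assumes "log_lift g \<theta>" "\<theta> 0 = base_log b"
  shows "crossing_cocycle b g = crossing_sum g \<theta>"
proof -
  define \<eta> where "\<eta> = (SOME \<theta>. log_lift g \<theta> \<and> \<theta> 0 = base_log b)"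
  have \<eta>: "log_lift g \<eta>" "\<eta> 0 = base_log b"
    using someI[of "\<lambda>\<theta>. log_lift g \<theta> \<and> \<theta> 0 = base_log b" \<theta>] assms by (auto simp: \<eta>_def)
  have "crossing_sum g \<eta> = crossing_sum g \<theta>"
    by (rule crossing_sum_cong) (use log_lift_unique[OF \<eta>(1) assms(1)] \<eta>(2) assms(2) in auto)
  then show ?thesis by (simp add: crossing_cocycle_def \<eta>_def)
qed

lemma loop_lift:
  assumes "path_in (- P) g" "pathstart g = b"
  obtains \<theta> where "log_lift g \<theta>" "\<theta> 0 = base_log b"
proof (rule log_lift_exists[OF assms(1)])
  have "b \<notin> P" using path_in_ends[OF assms(1)] assms(2) by simp
  then show "exp (base_log b) = (\<Prod>p\<in>P. p - g 0)"
    using exp_base_log assms(2) by (simp add: pathstart_def)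
qed

text \<open>The logarithm lifts the whole homotopy square. Composing it with
  \<open>crossing k\<close> gives a homotopy of loops avoiding 0, closed because
  \<open>crossing k\<close> is 1 at \<open>b\<close>, which does not lie left of
  \<open>a\<close>.\<close>

lemma crossing_cocycle_homotopic:
  assumes b: "Re a \<le> Re b" and g: "loop_at b g" and gg': "homotopic_paths (- P) g g'"
  shows "crossing_cocycle b g = crossing_cocycle b g'"
proof -
  let ?Q = "{0..1::real} \<times> {0..1::real}"
  obtain h where hc: "continuous_on ?Q h" and hP: "h \<in> ?Q \<rightarrow> - P"
    and h0: "\<And>x. x \<in> {0..1} \<Longrightarrow> h (0, x) = g x" and h1: "\<And>x. x \<in> {0..1} \<Longrightarrow> h (1, x) = g' x"
    and he: "\<And>t. t \<in> {0..1} \<Longrightarrow> pathstart (h \<circ> Pair t) = pathstart g \<and> pathfinish (h \<circ> Pair t) = pathfinish g"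
    using gg' unfolding homotopic_paths by blast
  have hb: "h (t, 0) = b" "h (t, 1) = b" if "t \<in> {0..1}" for t
    using he[OF that] g by (simp_all add: loop_at_def pathstart_def pathfinish_def)
  have bP: "b \<notin> P" using path_in_ends loop_atD[OF g] by force
  have hP': "h s \<notin> P" if "s \<in> ?Q" for s using hP that by auto
  have "continuous_on ?Q (\<lambda>s. \<Prod>p\<in>P. p - h s)" by (intro continuous_intros hc)
  then have "\<exists>l. continuous_on ?Q l \<and> (\<forall>s\<in>?Q. (\<Prod>p\<in>P. p - h s) = exp (l s))"
    by (rule continuous_logarithm_convex[OF convex_Times[OF convex_real_interval(5) convex_real_interval(5)]])
       (use hP' finite_P in force)
  then obtain l where l: "continuous_on ?Q l" "\<And>s. s \<in> ?Q \<Longrightarrow> (\<Prod>p\<in>P. p - h s) = exp (l s)"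
    by blast
  \<comment> \<open>Normalised at one corner, the lift equals \<open>base_log b\<close> along the
    whole edge that is mapped to \<open>b\<close>, so its first and last slices are the lifts used
    by the cocycle.\<close>
  define \<Theta> where "\<Theta> s = l s + (base_log b - l (0, 0))" for s
  have "exp (l (0, 0)) = exp (base_log b)"
    using l(2)[of "(0, 0)"] hb[of 0] exp_base_log[OF bP] by simp
  then have \<Theta>e: "exp (\<Theta> s) = (\<Prod>p\<in>P. p - h s)" if "s \<in> ?Q" for s
    using l(2)[OF that] by (simp add: \<Theta>_def exp_add exp_diff)
  have \<Theta>c: "continuous_on ?Q \<Theta>" unfolding \<Theta>_def by (intro continuous_intros l(1))
  have \<Theta>0: "\<Theta> (t, 0) = base_log b" if t: "t \<in> {0..1}" for t
  proof (rule equal_exp_unique[of "{0..1}" "\<lambda>t. \<Theta> (t, 0)" "\<lambda>_. base_log b" 0 t])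
    show "continuous_on {0..1} (\<lambda>t. \<Theta> (t, 0))"
      by (rule continuous_on_compose2[OF \<Theta>c]) (auto intro!: continuous_intros)
    show "\<Theta> (0, 0) = base_log b" by (simp add: \<Theta>_def)
    show "exp (\<Theta> (s, 0)) = exp (base_log b)" if "s \<in> {0..1}" for s
      using \<Theta>e[of "(s, 0)"] that hb exp_base_log[OF bP] by simp
  qed (use t in auto)
  have slice: "continuous_on {0..1} (\<lambda>t. \<Theta> (s, t))" if "s \<in> {0..1}" for s
    by (rule continuous_on_compose2[OF \<Theta>c]) (use that in \<open>auto intro!: continuous_intros\<close>)
  have lift: "log_lift g (\<lambda>t. \<Theta> (0, t))" "log_lift g' (\<lambda>t. \<Theta> (1, t))"
    using slice \<Theta>e h0 h1 by (auto simp: log_lift_def)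
  have "crossing_number g (\<lambda>t. \<Theta> (0, t)) k = crossing_number g' (\<lambda>t. \<Theta> (1, t)) k" for k
    unfolding crossing_number_def
  proof (rule winding_number_homotopic_loops)
    show "homotopic_loops (- {0}) (\<lambda>t. crossing k (g t) (\<Theta> (0, t))) (\<lambda>t. crossing k (g' t) (\<Theta> (1, t)))"
      unfolding homotopic_loops
    proof (intro exI[of _ "\<lambda>s. crossing k (h s) (\<Theta> s)"] conjI ballI)
      show "continuous_on ?Q (\<lambda>s. crossing k (h s) (\<Theta> s))"
        by (rule continuous_on_crossing[OF hc \<Theta>c]) (use hP' in \<open>auto intro: closed_Times\<close>)
      show "(\<lambda>s. crossing k (h s) (\<Theta> s)) \<in> ?Q \<rightarrow> - {0}"
        using crossing_nonzero[OF hP' \<Theta>e] by auto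
      show "pathfinish ((\<lambda>s. crossing k (h s) (\<Theta> s)) \<circ> Pair t) = pathstart ((\<lambda>s. crossing k (h s) (\<Theta> s)) \<circ> Pair t)"
        if "t \<in> {0..1}" for t
        using hb[OF that] crossing_right[OF bP b] by (simp add: pathstart_def pathfinish_def)
    qed (simp_all add: h0 h1)
  qed
  then have "crossing_sum g (\<lambda>t. \<Theta> (0, t)) = crossing_sum g' (\<lambda>t. \<Theta> (1, t))"
    by (simp add: crossing_sum_def)
  then show ?thesis
    using crossing_cocycle_eq[OF lift(1)] crossing_cocycle_eq[OF lift(2)] \<Theta>0 by simp
qed

text \<open>After \<open>g\<close>, the lift of \<open>h\<close> starts 2 \<pi> i times
  \<open>turns g\<close> higher, and by \<open>crossing_sum_shift\<close> this multiplies its sum by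
  \<rho> g.\<close>

lemma crossed_at_crossing_cocycle:
  assumes b: "Re a \<le> Re b" shows "crossed_at b (crossing_cocycle b)"
  unfolding crossed_at_def
proof (intro conjI allI impI)
  fix g h assume g: "loop_at b g" and h: "loop_at b h"
  show "crossing_cocycle b g = crossing_cocycle b h" if "homotopic_paths (- P) g h"
    by (rule crossing_cocycle_homotopic[OF b g that])
  obtain \<theta> where \<theta>: "log_lift g \<theta>" "\<theta> 0 = base_log b" using loop_lift loop_atD[OF g] by metis
  obtain \<eta> where \<eta>: "log_lift h \<eta>" "\<eta> 0 = base_log b" using loop_lift loop_atD[OF h] by metis
  obtain w where w: "turns g = of_int w" using turns_integer[OF g] by (auto elim: Ints_cases)
  let ?s = "2 * of_real pi * \<i> * of_int w"
  have "exp ?s = 1" using exp_integer_2pi[of "of_int w"] by (simp add: mult_ac)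
  then have \<eta>': "log_lift h (\<lambda>t. \<eta> t + ?s)" by (rule log_lift_shift[OF \<eta>(1)])
  have e: "\<theta> 1 = \<eta> 0 + ?s"
    using log_lift_turns[OF loop_atD(1)[OF g] \<theta>(1)] \<theta>(2) \<eta>(2) w by (simp add: algebra_simps)
  have "log_lift (g +++ h) (\<theta> +++ (\<lambda>t. \<eta> t + ?s))"
    by (rule log_lift_join[OF \<theta>(1) \<eta>']) (use e g h in \<open>auto simp: loop_at_def\<close>)
  then have "crossing_cocycle b (g +++ h) = crossing_sum (g +++ h) (\<theta> +++ (\<lambda>t. \<eta> t + ?s))"
    by (rule crossing_cocycle_eq) (simp add: joinpaths_def \<theta>)
  also have "\<dots> = crossing_sum g \<theta> + crossing_sum h (\<lambda>t. \<eta> t + ?s)"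
    by (rule crossing_sum_join) (use \<theta> \<eta>' g h e in \<open>auto simp: loop_at_def\<close>)
  also have "crossing_sum h (\<lambda>t. \<eta> t + ?s) = \<rho> g * crossing_sum h \<eta>"
    unfolding crossing_sum_shift \<rho>_def w by (simp add: cis_conv_exp algebra_simps)
  finally show "crossing_cocycle b (g +++ h) = crossing_cocycle b g + \<rho> g * crossing_cocycle b h"
    using crossing_cocycle_eq[OF \<theta>] crossing_cocycle_eq[OF \<eta>] by simp
qed

lemma crossing_cocycle_right:
  assumes g: "loop_at b g" and r: "\<And>z. z \<in> path_image g \<Longrightarrow> Re a \<le> Re z"
  shows "crossing_cocycle b g = 0"
proof -
  obtain \<theta> where \<theta>: "log_lift g \<theta>" "\<theta> 0 = base_log b" using loop_lift loop_atD[OF g] by metis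
  show ?thesis unfolding crossing_cocycle_eq[OF \<theta>] by (rule crossing_sum_right[OF loop_atD(1)[OF g] r])
qed

lemma crossing_cocycle_nonzero:
  assumes u: "path_in (- P) u" "pathstart u = b" and ur: "\<And>z. z \<in> path_image u \<Longrightarrow> Re a \<le> Re z"
    and g: "path_in (- P) g" "pathstart g = pathfinish u"
    and left: "\<And>z. z \<in> path_image g \<Longrightarrow> Re z \<le> Re a"
    and top: "Re (g 0) = Re a" "Im a < Im (g 0)" and bot: "Re (g 1) = Re a" "Im (g 1) < Im a"
  shows "crossing_cocycle b (u +++ g) \<noteq> 0"
proof -
  obtain \<theta> where \<theta>: "log_lift u \<theta>" "\<theta> 0 = base_log b" using loop_lift[OF u] .
  have "exp (\<theta> 1) = (\<Prod>p\<in>P. p - g 0)"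
    using \<theta>(1) g(2) by (simp add: log_lift_def pathstart_def pathfinish_def)
  then obtain \<eta> where \<eta>: "log_lift g \<eta>" "\<eta> 0 = \<theta> 1" using log_lift_exists[OF g(1)] by metis
  have "log_lift (u +++ g) (\<theta> +++ \<eta>)"
    by (rule log_lift_join[OF \<theta>(1) \<eta>(1)]) (use g \<eta> in auto)
  then have "crossing_cocycle b (u +++ g) = crossing_sum (u +++ g) (\<theta> +++ \<eta>)"
    by (rule crossing_cocycle_eq) (simp add: joinpaths_def \<theta>)
  also have "\<dots> = crossing_sum u \<theta> + crossing_sum g \<eta>"
    by (rule crossing_sum_join) (use \<theta> \<eta> u g in auto)
  also have "\<dots> = crossing_sum g \<eta>" using crossing_sum_right[OF u(1) ur] by simp
  finally show ?thesis using crossing_sum_left[OF g(1) \<eta>(1) left top bot] by simp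
qed

end

section \<open>The standard half-twists\<close>

lemma homotopic_paths_assoc4:
  assumes "path_in S p" "path_in S q" "path_in S r" "path_in S s"
    and "pathfinish p = pathstart q" "pathfinish q = pathstart r" "pathfinish r = pathstart s"
  shows "homotopic_paths S (p +++ (q +++ (r +++ s))) ((p +++ (q +++ r)) +++ s)"
proof -
  note P = assms[unfolded path_in_def]
  have "homotopic_paths S (p +++ (q +++ (r +++ s))) (p +++ ((q +++ r) +++ s))"
    by (rule homotopic_paths_join[OF _ homotopic_paths_assoc]) (use P in auto)
  also have "homotopic_paths S \<dots> ((p +++ (q +++ r)) +++ s)"
    by (rule homotopic_paths_assoc) (use P in \<open>auto simp: subset_path_image_join\<close>)
  finally show ?thesis .
qed

locale braid_setup =
  fixes n m :: nat
  assumes n: "n \<ge> 4" and m: "m \<ge> 5"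
begin

definition gap_width :: real where "gap_width = 2 / (real n + 1)"
abbreviation "\<delta> \<equiv> gap_width"
abbreviation "P \<equiv> marked_points n"
abbreviation "\<mu> \<equiv> 1/2 + 1 / real m"

text \<open>The midpoint between the marked points number j and j + 1.\<close>

definition mid :: "nat \<Rightarrow> real" where "mid j = (real j + 1/2) * \<delta> - 1"

text \<open>Radius \<delta> puts - 1/2 and 1/2 on the marked points number j and j + 1, and leaves
  the next ones at distance 3/2 \<delta> from the centre.\<close>

definition std_disc :: "nat \<Rightarrow> complex \<Rightarrow> complex" where
  "std_disc j z = of_real (mid j) + of_real \<delta> * z"

text \<open>Below the unit disc, on the vertical line through the leftmost puncture. A loop through
  a gap j \<ge> 1 thus has no point left of this line before \<open>return_path\<close>, which alone
  passes the half-line.\<close>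

abbreviation "basept \<equiv> Complex (\<delta> - 1) (- 2)"
abbreviation "toppt \<equiv> Complex (\<delta> - 1) 2"

definition return_path :: "real \<Rightarrow> complex" where
  "return_path = linepath toppt (- 2) +++ linepath (- 2) basept"

text \<open>The \<open>0\<close>-th gap extends to \<open>- \<infinity>\<close>, so that the return path passes through it.\<close>

definition gap :: "nat \<Rightarrow> complex set" where
  "gap j = {z. Im z = 0 \<longrightarrow> (j = 0 \<or> real j * \<delta> - 1 < Re z) \<and> Re z < (real j + 1) * \<delta> - 1}"

definition via :: "nat \<Rightarrow> (real \<Rightarrow> complex) \<Rightarrow> real \<Rightarrow> complex" where
  "via j p = linepath basept (std_disc j (- T)) +++ ((std_disc j \<circ> p) +++ linepath (std_disc j T) toppt)"

text \<open>The brackets are set so that the loop has the form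
  \<open>d +++ ((e \<circ> p) +++ d')\<close> of \<open>twist_formula\<close>, with
  \<open>return_path\<close> inside \<open>d'\<close>.\<close>

definition via_loop :: "nat \<Rightarrow> (real \<Rightarrow> complex) \<Rightarrow> real \<Rightarrow> complex" where
  "via_loop j p = linepath basept (std_disc j (- T)) +++ ((std_disc j \<circ> p) +++ (linepath (std_disc j T) toppt +++ return_path))"

abbreviation "gap_loop j \<equiv> via_loop j center_path"

lemma \<delta>: "0 < \<delta>" "\<delta> \<le> 2/5" "(real n + 1) * \<delta> = 2" "5 * \<delta> \<le> 2"
  using n by (simp_all add: gap_width_def field_simps)

lemma marked_points_eq: "P = (\<lambda>k. of_real (real k * \<delta> - 1)) ` {1..n}"
  by (simp add: marked_points_def gap_width_def mult.commute)

lemma marked_pointE: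
  assumes "p \<in> P" obtains k where "1 \<le> k" "k \<le> n" "p = of_real (real k * \<delta> - 1)"
  using assms unfolding marked_points_eq by auto

lemma Re_marked_point: "p \<in> P \<Longrightarrow> \<delta> - 1 \<le> Re p \<and> Re p < 1 \<and> Im p = 0"
proof -
  assume "p \<in> P"
  then obtain k where k: "1 \<le> k" "k \<le> n" "p = of_real (real k * \<delta> - 1)" by (rule marked_pointE)
  have "1 * \<delta> \<le> real k * \<delta>" "real k * \<delta> < (real n + 1) * \<delta>" using k \<delta>(1) by (auto intro: mult_right_mono mult_strict_right_mono)
  then show ?thesis using k \<delta>(3) by simp
qed

lemma norm_marked_point: "p \<in> P \<Longrightarrow> norm p < 1"
  using Re_marked_point[of p] \<delta>(1) by (simp add: cmod_eq_Re abs_less_iff)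

sublocale leftmost_puncture P \<mu> "of_real (\<delta> - 1)" m
proof
  show "finite P" by (simp add: marked_points_def)
  show "of_real (\<delta> - 1) \<in> P" unfolding marked_points_eq by (rule image_eqI[of _ _ 1]) (use n in auto)
  show "Re (of_real (\<delta> - 1)) \<le> Re p" if "p \<in> P" for p using Re_marked_point[OF that] by simp
qed (use m in auto)

lemma basept: "norm basept \<ge> 1" "basept \<notin> P"
proof -
  show "norm basept \<ge> 1" using abs_Im_le_cmod[of basept] by simp
  then show "basept \<notin> P" using norm_marked_point by fastforce
qed

lemma Re_Im_std_disc [simp]: "Re (std_disc j z) = mid j + \<delta> * Re z" "Im (std_disc j z) = \<delta> * Im z"
  by (simp_all add: std_disc_def)

lemma continuous_on_std_disc: "continuous_on S (std_disc j)"
  unfolding std_disc_def by (intro continuous_intros)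

lemma std_disc_ball:
  assumes j: "j \<in> {1, 2, 3}" shows "std_disc j ` cball 0 1 \<subseteq> ball 0 1"
proof clarsimp
  fix z :: complex assume z: "norm z \<le> 1"
  have "norm (std_disc j z) \<le> \<bar>mid j\<bar> + \<delta> * norm z"
    unfolding std_disc_def using norm_triangle_ineq[of "of_real (mid j)" "of_real \<delta> * z"] \<delta>(1)
    by (simp add: norm_mult)
  also have "\<dots> \<le> \<bar>mid j\<bar> + \<delta>" using z \<delta>(1) by (simp add: mult_left_le)
  also have "\<dots> < 1" using j \<delta> by (auto simp: mid_def abs_less_iff algebra_simps)
  finally show "norm (std_disc j z) < 1" .
qed

lemma embedded_std_disc:
  assumes j: "j \<in> {1, 2, 3}" shows "embedded_disc P (std_disc j) basept"
proof
  show "continuous_on (cball 0 1) (std_disc j)" by (rule continuous_on_std_disc)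
  show "inj_on (std_disc j) (cball 0 1)" using \<delta>(1) by (auto simp: inj_on_def std_disc_def)
  have h: "std_disc j (1/2) = of_real (real (j + 1) * \<delta> - 1)" "std_disc j (- 1/2) = of_real (real j * \<delta> - 1)"
    by (simp_all add: complex_eq_iff mid_def algebra_simps)
  have "std_disc j (1/2) \<in> P" "std_disc j (- 1/2) \<in> P"
    unfolding h marked_points_eq
    by (rule image_eqI[OF refl], use j n in auto)+
  moreover have "p = std_disc j (1/2) \<or> p = std_disc j (- 1/2)" if p: "p \<in> std_disc j ` cball 0 1" "p \<in> P" for p
  proof -
    obtain z where z: "norm z \<le> 1" "p = std_disc j z" using p by auto
    obtain k where k: "p = of_real (real k * \<delta> - 1)" using p(2) by (rule marked_pointE)
    have "\<delta> * (real k - real j - 1/2) = \<delta> * Re z"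
      using arg_cong[OF trans[OF k[symmetric] z(2)], of Re] by (simp add: mid_def algebra_simps)
    then have "real k - real j - 1/2 = Re z" using \<delta>(1) by (metis less_irrefl mult_left_cancel)
    moreover have "\<bar>Re z\<bar> \<le> 1" using z abs_Re_le_cmod[of z] by linarith
    ultimately have "\<bar>real k - real j - 1/2\<bar> \<le> 1" by simp
    then have "k = j + 1 \<or> k = j" by linarith
    then show ?thesis unfolding h k by auto
  qed
  ultimately show "std_disc j ` cball 0 1 \<inter> P = {std_disc j (1/2), std_disc j (- 1/2)}" by force
  show "basept \<notin> P" by (rule basept)
  show "basept \<notin> std_disc j ` cball 0 1" using std_disc_ball[OF j] basept(1) by force
qed

lemma gap_subset: "gap j \<subseteq> - P"
proof
  fix z assume z: "z \<in> gap j"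
  show "z \<in> - P"
  proof
    assume "z \<in> P"
    then obtain k where k: "1 \<le> k" "z = of_real (real k * \<delta> - 1)" by (rule marked_pointE)
    then have "j = 0 \<or> real j * \<delta> < real k * \<delta>" "real k * \<delta> < (real j + 1) * \<delta>"
      using z by (auto simp: gap_def)
    then have "j = 0 \<or> real j < real k" "real k < real j + 1" using \<delta>(1) by simp_all
    then show False using k by auto
  qed
qed

lemma simply_connected_gap: "simply_connected (gap j)"
proof -
  let ?I = "{r. (j = 0 \<or> real j * \<delta> - 1 < r) \<and> r < (real j + 1) * \<delta> - 1}"
  have I: "convex ?I"
  proof (cases "j = 0")
    case True
    then have "?I = {..<\<delta> - 1}" by auto
    then show ?thesis by simp
  next
    case False
    then have "?I = {real j * \<delta> - 1<..<(real j + 1) * \<delta> - 1}" by auto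
    then show ?thesis by (simp only: convex_real_interval)
  qed
  have mI: "mid j \<in> ?I" using \<delta>(1) by (simp add: mid_def)
  have "closed_segment (of_real (mid j)) x \<subseteq> gap j" if x: "x \<in> gap j" for x
  proof
    fix y assume "y \<in> closed_segment (of_real (mid j)) x"
    then obtain u where u: "0 \<le> u" "u \<le> 1" "y = (1 - u) *\<^sub>R of_real (mid j) + u *\<^sub>R x"
      by (auto simp: in_segment)
    have "Re y \<in> ?I" if y: "Im y = 0"
    proof (cases "u = 0")
      case True
      then show ?thesis using mI u by simp
    next
      case False
      then have "Re x \<in> ?I" using x y u by (simp add: gap_def)
      from convexD_alt[OF I mI this u(1,2)] show ?thesis unfolding u(3) by simp
    qed
    then show "y \<in> gap j" by (simp add: gap_def)
  qed
  moreover have "of_real (mid j) \<in> gap j" using mI by (simp add: gap_def)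
  ultimately have "starlike (gap j)" unfolding starlike_def by blast
  then show ?thesis by (rule starlike_imp_simply_connected)
qed

text \<open>Passing a disc to the right of its two punctures means passing through the next gap, and
  to the left through the previous one. This turns \<open>twist_formula\<close> into a relation
  between neighbouring gap loops.\<close>

lemma std_disc_gap: "std_disc j ` slit_right \<subseteq> gap (j + 1)" "std_disc (j + 1) ` slit_left \<subseteq> gap j"
  "std_disc j ` slit_both \<subseteq> gap j"
proof -
  have m: "x < y \<Longrightarrow> \<delta> * x < \<delta> * y" for x y using \<delta>(1) by simp
  have *: "1/2 < Re z \<Longrightarrow> norm z < 1 \<Longrightarrow> \<delta> * (1/2) < \<delta> * Re z \<and> \<delta> * Re z < \<delta> * 1"
    "Re z < - 1/2 \<Longrightarrow> norm z < 1 \<Longrightarrow> \<delta> * Re z < \<delta> * (- 1/2) \<and> \<delta> * (- 1) < \<delta> * Re z"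
    "\<bar>Re z\<bar> < 1/2 \<Longrightarrow> \<delta> * (- 1/2) < \<delta> * Re z \<and> \<delta> * Re z < \<delta> * (1/2)" for z
    by ((intro conjI m; use abs_Re_le_cmod[of z] in linarith)+)
  have gapI: "z \<in> gap i"
    if "Im z = 0 \<Longrightarrow> real i * \<delta> - 1 < Re z \<and> Re z < real i * \<delta> + \<delta> - 1" for z i
    using that by (auto simp: gap_def algebra_simps)
  have midj: "mid j = real j * \<delta> + \<delta> / 2 - 1" "mid (j + 1) = real j * \<delta> + \<delta> + \<delta> / 2 - 1"
    "real (j + 1) * \<delta> = real j * \<delta> + \<delta>" by (simp_all add: mid_def algebra_simps)
  show "std_disc j ` slit_right \<subseteq> gap (j + 1)"
  proof (rule image_subsetI, rule gapI)
    fix z assume z: "z \<in> slit_right" "Im (std_disc j z) = 0"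
    then have "1/2 < Re z" "norm z < 1" using \<delta>(1) by (auto simp: slit_right_def)
    from *(1)[OF this] show "real (j + 1) * \<delta> - 1 < Re (std_disc j z) \<and> Re (std_disc j z) < real (j + 1) * \<delta> + \<delta> - 1"
      unfolding midj Re_Im_std_disc using \<delta>(1) by linarith
  qed
  show "std_disc (j + 1) ` slit_left \<subseteq> gap j"
  proof (rule image_subsetI, rule gapI)
    fix z assume z: "z \<in> slit_left" "Im (std_disc (j + 1) z) = 0"
    then have "Re z < - 1/2" "norm z < 1" using \<delta>(1) by (auto simp: slit_left_def)
    from *(2)[OF this] show "real j * \<delta> - 1 < Re (std_disc (j + 1) z) \<and> Re (std_disc (j + 1) z) < real j * \<delta> + \<delta> - 1"
      unfolding midj Re_Im_std_disc using \<delta>(1) by linarith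
  qed
  show "std_disc j ` slit_both \<subseteq> gap j"
  proof (rule image_subsetI, rule gapI)
    fix z assume z: "z \<in> slit_both" "Im (std_disc j z) = 0"
    then have "\<bar>Re z\<bar> < 1/2" using \<delta>(1) by (auto simp: slit_both_def)
    from *(3)[OF this] show "real j * \<delta> - 1 < Re (std_disc j z) \<and> Re (std_disc j z) < real j * \<delta> + \<delta> - 1"
      unfolding midj Re_Im_std_disc using \<delta>(1) by linarith
  qed
qed

lemma segment_lower: "z \<in> closed_segment basept (std_disc j (- T)) \<Longrightarrow> Im z \<le> - (7/8 * \<delta>)"
proof -
  have "closed_segment basept (std_disc j (- T)) \<subseteq> {z. Im z \<le> - (7/8 * \<delta>)}"
    using \<delta> by (intro closed_segment_subset) (auto simp: convex_halfspace_Im_le)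
  then show "z \<in> closed_segment basept (std_disc j (- T)) \<Longrightarrow> Im z \<le> - (7/8 * \<delta>)" by blast
qed

lemma segment_upper: "z \<in> closed_segment (std_disc j T) toppt \<Longrightarrow> Im z \<ge> 7/8 * \<delta>"
proof -
  have "closed_segment (std_disc j T) toppt \<subseteq> {z. Im z \<ge> 7/8 * \<delta>}"
    using \<delta> by (intro closed_segment_subset convex_halfspace_Im_ge) auto
  then show "z \<in> closed_segment (std_disc j T) toppt \<Longrightarrow> Im z \<ge> 7/8 * \<delta>" by blast
qed

lemma return_path: "path return_path" "pathstart return_path = toppt" "pathfinish return_path = basept"
  by (simp_all add: return_path_def)

text \<open>The first bound places the path in the wedge left of - 2 + |Im z|. It keeps the path
  away from the unit disc, and lets it meet the real axis only where Re z \<le> - 2, inside the gap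
  number 0.\<close>

lemma return_path_image:
  assumes z: "z \<in> path_image return_path" shows "Re z + 2 \<le> \<bar>Im z\<bar>" "Re z \<le> \<delta> - 1" "norm z \<ge> 1"
proof -
  have 1: "closed_segment toppt (- 2) \<subseteq> {z. inner (1 - \<i>) z \<le> - 2}"
    using \<delta> by (intro closed_segment_subset convex_halfspace_le) (auto simp: inner_complex_def)
  have 2: "closed_segment (- 2) basept \<subseteq> {z. inner (1 + \<i>) z \<le> - 2}"
    using \<delta> by (intro closed_segment_subset convex_halfspace_le) (auto simp: inner_complex_def)
  have 3: "closed_segment toppt (- 2) \<subseteq> {z. Re z \<le> \<delta> - 1}" "closed_segment (- 2) basept \<subseteq> {z. Re z \<le> \<delta> - 1}"
    using \<delta> by (intro closed_segment_subset; auto simp: convex_halfspace_Re_le)+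
  have z': "z \<in> closed_segment toppt (- 2) \<or> z \<in> closed_segment (- 2) basept"
    using z by (simp add: return_path_def path_image_join)
  then show i: "Re z + 2 \<le> \<bar>Im z\<bar>" using 1 2 by (auto simp: inner_complex_def)
  show "Re z \<le> \<delta> - 1" using z' 3 by blast
  show "norm z \<ge> 1" using i abs_Re_le_cmod[of z] abs_Im_le_cmod[of z] by linarith
qed

lemma return_path_in: "path_in (- P) return_path" "path_in (gap 0) return_path"
proof -
  show "path_in (- P) return_path"
    unfolding path_in_def using return_path(1) return_path_image(3) norm_marked_point by fastforce
  show "path_in (gap 0) return_path"
    unfolding path_in_def gap_def using return_path(1) return_path_image(1) \<delta> by fastforce
qed

lemma std_disc_path_ends [simp]:
  "pathstart (std_disc j \<circ> p) = std_disc j (pathstart p)" "pathfinish (std_disc j \<circ> p) = std_disc j (pathfinish p)"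
  by (simp_all add: pathstart_compose pathfinish_compose)

lemma via_ends:
  assumes "pathstart p = - T" "pathfinish p = T"
  shows "pathstart (via j p) = basept" "pathfinish (via j p) = toppt"
    "pathstart (via_loop j p) = basept" "pathfinish (via_loop j p) = basept"
  using assms by (simp_all add: via_def via_loop_def return_path)

lemma via_in:
  assumes p: "path_in S p" "pathstart p = - T" "pathfinish p = T" and S: "std_disc i ` S \<subseteq> gap j"
  shows "path_in (gap j) (linepath basept (std_disc i (- T)))" "path_in (gap j) (std_disc i \<circ> p)"
    "path_in (gap j) (linepath (std_disc i T) toppt)" "path_in (gap j) (via i p)"
proof -
  show 1: "path_in (gap j) (linepath basept (std_disc i (- T)))"
    using segment_lower[of _ i] \<delta>(1) by (force simp: gap_def)
  show 2: "path_in (gap j) (std_disc i \<circ> p)"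
    by (rule path_in_compose[OF p(1) continuous_on_std_disc S])
  show 3: "path_in (gap j) (linepath (std_disc i T) toppt)"
    using segment_upper[of _ i] \<delta>(1) by (force simp: gap_def)
  show "path_in (gap j) (via i p)"
    unfolding via_def using 1 2 3 p by simp
qed

lemma via_in_Compl:
  assumes "path_in S p" "pathstart p = - T" "pathfinish p = T" "std_disc i ` S \<subseteq> gap j"
  shows "path_in (- P) (linepath basept (std_disc i (- T)))" "path_in (- P) (std_disc i \<circ> p)"
    "path_in (- P) (linepath (std_disc i T) toppt)" "path_in (- P) (via i p)"
  using via_in[OF assms] path_in_mono[OF _ gap_subset] by blast+

lemma via_loop_homotopic:
  assumes p: "path_in S p" "pathstart p = - T" "pathfinish p = T" and S: "std_disc i ` S \<subseteq> gap j"
  shows "homotopic_paths (- P) (via_loop i p) (via i p +++ return_path)"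
  unfolding via_loop_def via_def
  by (rule homotopic_paths_assoc4)
     (use via_in_Compl[OF assms] return_path return_path_in p in simp_all)

text \<open>Both paths have the same ends and lie in the simply connected set
  \<open>gap j\<close>.\<close>

lemma via_homotopic:
  assumes p: "path_in S p" "pathstart p = - T" "pathfinish p = T" and S: "std_disc i ` S \<subseteq> gap j"
  shows "homotopic_paths (- P) (via i p) (via j center_path)"
  by (rule homotopic_paths_subset[OF simply_connected_homotopic[OF simply_connected_gap[of j]] gap_subset])
     (use via_in(4)[OF assms] via_in(4)[OF center_path_in _ _ std_disc_gap(3)] via_ends p in auto)

lemma via_loop_gap_loop:
  assumes p: "path_in S p" "pathstart p = - T" "pathfinish p = T" and S: "std_disc i ` S \<subseteq> gap j"
  shows "homotopic_paths (- P) (via_loop i p) (gap_loop j)"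
proof -
  have r: "homotopic_paths (- P) return_path return_path"
    using return_path_in by (simp add: path_in_def)
  have "homotopic_paths (- P) (via_loop i p) (via i p +++ return_path)"
    by (rule via_loop_homotopic[OF assms])
  also have "homotopic_paths (- P) \<dots> (via j center_path +++ return_path)"
    by (rule homotopic_paths_join[OF via_homotopic[OF assms] r]) (simp add: via_ends p return_path)
  also have "homotopic_paths (- P) \<dots> (gap_loop j)"
    by (rule homotopic_paths_sym[OF via_loop_homotopic[OF center_path_in _ _ std_disc_gap(3)]]) simp_all
  finally show ?thesis .
qed

section \<open>Values of crossed homomorphisms on the gap loops\<close>

lemma loop_at_gap_loop: "loop_at basept (gap_loop j)"
  using path_in_homotopic[OF via_loop_gap_loop[OF center_path_in _ _ std_disc_gap(3)]] via_ends[of center_path j]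
  by (simp add: loop_at_def)

text \<open>The whole loop, including \<open>return_path\<close>, lies in the simply connected gap
  number 0, so it is contractible.\<close>

lemma crossed_at_gap_loop_0:
  assumes c: "crossed_at basept c" shows "c (gap_loop 0) = 0"
proof -
  have "path_in (gap 0) (gap_loop 0)"
    unfolding via_loop_def
    using via_in[OF center_path_in _ _ std_disc_gap(3)[of 0]] return_path return_path_in(2) by simp
  moreover from this have "basept \<in> gap 0" using path_in_ends via_ends[of center_path 0] by fastforce
  ultimately have "homotopic_paths (gap 0) (gap_loop 0) (linepath basept basept)"
    by (intro simply_connected_homotopic[OF simply_connected_gap]) (simp_all add: via_ends)
  then have "homotopic_paths (- P) (gap_loop 0) (linepath basept basept)"
    using gap_subset homotopic_paths_subset by blast
  then have "c (gap_loop 0) = c (linepath basept basept)"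
    using crossed_at_homotopic[OF c _ loop_at_gap_loop] by blast
  then show ?thesis using crossed_at_const[OF c basept(2)] by simp
qed

text \<open>The standard discs are translates of one another. After subtraction of the puncture the
  winding number no longer depends on j, so all standard half-twists share this factor.\<close>

definition q :: complex where
  "q = exp (2 * of_real pi * \<i> * of_real \<mu> * winding_number (\<lambda>t. of_real \<delta> * (half_circuit t - 1/2)) 0)"

lemma twist_factor_std_disc:
  assumes j: "j \<in> {1, 2, 3}" shows "embedded_disc.twist_factor P \<mu> (std_disc j) = q"
proof -
  interpret E: embedded_disc P \<mu> "std_disc j" basept by (rule embedded_std_disc[OF j])
  have "(\<lambda>t. (std_disc j \<circ> half_circuit) t - std_disc j (1/2)) = (\<lambda>t. of_real \<delta> * (half_circuit t - 1/2))"
    by (simp add: std_disc_def algebra_simps fun_eq_iff)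
  then have "turns (std_disc j \<circ> half_circuit) = winding_number (\<lambda>t. of_real \<delta> * (half_circuit t - 1/2)) 0"
    unfolding E.turns_e_half_circuit by (subst winding_number_offset) simp
  then show ?thesis unfolding E.twist_factor_half_circuit q_def by simp
qed

lemma q_cases: "q = cis (2 * pi * \<mu>) \<or> q = cis (- (2 * pi * \<mu>))"
proof -
  interpret E: embedded_disc P \<mu> "std_disc 1" basept by (rule embedded_std_disc) simp
  show ?thesis using E.twist_factor_cases twist_factor_std_disc[of 1] by simp
qed

text \<open>The alternatives cover the pieces of gap loops: connecting segments,
  \<open>return_path\<close>, and the diameters of other discs.\<close>

lemma std_outside_core:
  assumes j: "j \<in> {1, 2, 3}"
  shows "\<bar>Im z\<bar> \<ge> 7/8 * \<delta> \<or> norm z \<ge> 1 \<or> (\<exists>i. i \<noteq> j \<and> Re z = mid i) \<Longrightarrow> z \<notin> P \<Longrightarrow>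
    z \<in> embedded_disc.outside_core P (std_disc j)"
proof -
  interpret E: embedded_disc P \<mu> "std_disc j" basept by (rule embedded_std_disc[OF j])
  assume z: "\<bar>Im z\<bar> \<ge> 7/8 * \<delta> \<or> norm z \<ge> 1 \<or> (\<exists>i. i \<noteq> j \<and> Re z = mid i)" "z \<notin> P"
  have "z \<notin> std_disc j ` cball 0 (9/16)"
  proof
    assume "z \<in> std_disc j ` cball 0 (9/16)"
    then obtain w where w: "norm w \<le> 9/16" "z = std_disc j w" by auto
    have R: "\<bar>Re w\<bar> \<le> 9/16" "\<bar>Im w\<bar> \<le> 9/16" using w abs_Re_le_cmod[of w] abs_Im_le_cmod[of w] by linarith+
    from z(1) show False
    proof (elim disjE exE conjE)
      assume "\<bar>Im z\<bar> \<ge> 7/8 * \<delta>"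
      then have "\<delta> * (7/8) \<le> \<delta> * \<bar>Im w\<bar>" using w \<delta>(1) by (simp add: abs_mult)
      then have "7/8 \<le> \<bar>Im w\<bar>" using \<delta>(1) by (simp only: mult_le_cancel_left_pos)
      then show False using R by simp
    next
      assume "norm z \<ge> 1"
      moreover have "w \<in> cball 0 1" using w by simp
      ultimately show False using std_disc_ball[OF j] w(2) by force
    next
      fix i assume i: "i \<noteq> j" "Re z = mid i"
      then have "\<delta> * (real i - real j) = \<delta> * Re w" using w by (simp add: mid_def algebra_simps)
      then have "real i - real j = Re w" using \<delta>(1) by simp
      then show False using R i(1) by linarith
    qed
  qed
  then show "z \<in> E.outside_core" using z(2) by (simp add: E.outside_core_def)
qed

lemma std_paths_outside_core:
  assumes j: "j \<in> {1, 2, 3}"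
  shows "path_in (embedded_disc.outside_core P (std_disc j)) (linepath basept (std_disc i (- T)))"
    "path_in (embedded_disc.outside_core P (std_disc j)) (linepath (std_disc i T) toppt)"
    "path_in (embedded_disc.outside_core P (std_disc j)) return_path"
    "i \<noteq> j \<Longrightarrow> path_in (embedded_disc.outside_core P (std_disc j)) (std_disc i \<circ> center_path)"
proof -
  have nP: "Im z \<noteq> 0 \<Longrightarrow> z \<notin> P" for z using Re_marked_point[of z] by auto
  have "z \<in> embedded_disc.outside_core P (std_disc j)" if "z \<in> closed_segment basept (std_disc i (- T))" for z
    using segment_lower[OF that] \<delta>(1) nP[of z] by (intro std_outside_core[OF j]) auto
  then show "path_in (embedded_disc.outside_core P (std_disc j)) (linepath basept (std_disc i (- T)))" by auto
  have "z \<in> embedded_disc.outside_core P (std_disc j)" if "z \<in> closed_segment (std_disc i T) toppt" for z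
    using segment_upper[OF that] \<delta>(1) nP[of z] by (intro std_outside_core[OF j]) auto
  then show "path_in (embedded_disc.outside_core P (std_disc j)) (linepath (std_disc i T) toppt)" by auto
  have "z \<in> embedded_disc.outside_core P (std_disc j)" if "z \<in> path_image return_path" for z
    using return_path_image(3)[OF that] norm_marked_point[of z] by (intro std_outside_core[OF j]) auto
  then show "path_in (embedded_disc.outside_core P (std_disc j)) return_path"
    using return_path(1) by (auto simp: path_in_def)
  assume ij: "i \<noteq> j"
  have "path_in {z. z \<notin> P \<and> Re z = mid i} (std_disc i \<circ> center_path)"
  proof (rule path_in_compose[of "slit_both \<inter> {z. Re z = 0}", OF _ continuous_on_std_disc])
    have "Re z = 0" if "z \<in> closed_segment (- T) T" for z using that by (auto simp: in_segment)
    then show "path_in (slit_both \<inter> {z. Re z = 0}) center_path"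
      using center_path_in by (auto simp: path_in_def center_path_def)
    show "std_disc i ` (slit_both \<inter> {z. Re z = 0}) \<subseteq> {z. z \<notin> P \<and> Re z = mid i}"
      using std_disc_gap(3)[of i] gap_subset[of i] by auto
  qed
  moreover have "{z. z \<notin> P \<and> Re z = mid i} \<subseteq> embedded_disc.outside_core P (std_disc j)"
    using std_outside_core[OF j] ij by blast
  ultimately show "path_in (embedded_disc.outside_core P (std_disc j)) (std_disc i \<circ> center_path)"
    by (rule path_in_mono)
qed

lemma crossed_at_twist_other:
  assumes c: "crossed_at basept c" and j: "j \<in> {1, 2, 3}" "i \<noteq> j"
  shows "c (twist_along (std_disc j) \<circ> gap_loop i) = c (gap_loop i)"
proof -
  interpret E: embedded_disc P \<mu> "std_disc j" basept by (rule embedded_std_disc[OF j(1)])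
  have "path_in E.outside_core (gap_loop i)"
    unfolding via_loop_def using std_paths_outside_core[OF j(1)] j(2) return_path by simp
  then show ?thesis by (rule E.crossed_at_twist_outside[OF c]) (simp_all add: via_ends)
qed

text \<open>The Burau matrix: \<open>right_path\<close> goes through the next gap and
  \<open>left_path\<close> through the previous one.\<close>

lemma crossed_at_twist:
  assumes c: "crossed_at basept c" and j: "Suc j \<in> {1, 2, 3}"
  shows "c (twist_along (std_disc (Suc j)) \<circ> gap_loop (Suc j)) =
    c (gap_loop (Suc (Suc j))) - q * c (gap_loop (Suc j)) + q * c (gap_loop j)"
proof -
  interpret E: embedded_disc P \<mu> "std_disc (Suc j)" basept by (rule embedded_std_disc[OF j])
  have "c (twist_along (std_disc (Suc j)) \<circ> gap_loop (Suc j)) =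
      c (via_loop (Suc j) right_path) - q * c (gap_loop (Suc j)) + q * c (via_loop (Suc j) left_path)"
    unfolding via_loop_def twist_factor_std_disc[OF j, symmetric]
    by (rule E.twist_formula[OF c]) (use std_paths_outside_core[OF j] return_path in simp_all)
  moreover have "homotopic_paths (- P) (via_loop (Suc j) right_path) (gap_loop (Suc (Suc j)))"
    by (rule via_loop_gap_loop[OF right_path_in]) (use std_disc_gap(1)[of "Suc j"] in simp_all)
  then have "c (via_loop (Suc j) right_path) = c (gap_loop (Suc (Suc j)))"
    using crossed_at_homotopic[OF c homotopic_paths_sym loop_at_gap_loop] by metis
  moreover have "homotopic_paths (- P) (via_loop (Suc j) left_path) (gap_loop j)"
    by (rule via_loop_gap_loop[OF left_path_in]) (use std_disc_gap(2)[of j] in simp_all)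
  then have "c (via_loop (Suc j) left_path) = c (gap_loop j)"
    using crossed_at_homotopic[OF c homotopic_paths_sym loop_at_gap_loop] by metis
  ultimately show ?thesis by simp
qed

abbreviation "cocycle \<equiv> crossing_cocycle basept"

lemma crossed_at_cocycle: "crossed_at basept cocycle"
  by (rule crossed_at_crossing_cocycle) simp

lemma via_right_half_plane:
  assumes "j \<ge> 1" "z \<in> path_image (via j center_path)" shows "\<delta> - 1 \<le> Re z"
proof -
  have mj: "\<delta> - 1 \<le> mid j"
  proof -
    have "1 * \<delta> \<le> real j * \<delta>" using assms(1) \<delta>(1) by (intro mult_right_mono) auto
    moreover have "mid j = real j * \<delta> + \<delta> / 2 - 1" by (simp add: mid_def algebra_simps)
    ultimately show ?thesis using \<delta>(1) by linarith
  qed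
  have "closed_segment basept (std_disc j (- T)) \<subseteq> {z. Re z \<ge> \<delta> - 1}"
    "closed_segment (std_disc j T) toppt \<subseteq> {z. Re z \<ge> \<delta> - 1}"
    using mj by (intro closed_segment_subset; simp add: convex_halfspace_Re_ge)+
  moreover have "path_image (std_disc j \<circ> center_path) \<subseteq> {z. Re z \<ge> \<delta> - 1}"
    using mj by (auto simp: path_image_compose center_path_def in_segment)
  ultimately show ?thesis using assms(2) by (auto simp: via_def path_image_join)
qed

lemma via_center_in: "path_in (- P) (via j center_path)"
  using path_in_mono[OF via_in(4)[OF center_path_in _ _ std_disc_gap(3)] gap_subset] by simp

text \<open>Up to \<open>toppt\<close> the loop has no point left of the leftmost puncture, and then
  \<open>return_path\<close> passes the half-line exactly once, from above to below.\<close>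

lemma cocycle_gap_loop_1: "cocycle (gap_loop 1) \<noteq> 0"
proof -
  have e: "pathstart (via 1 center_path) = basept" "pathfinish (via 1 center_path) = toppt"
    by (simp_all add: via_ends)
  have "cocycle (via 1 center_path +++ return_path) \<noteq> 0"
    by (rule crossing_cocycle_nonzero)
       (use via_center_in[of 1] e via_right_half_plane[of 1] return_path_in return_path
          return_path_image(2) in \<open>auto simp: pathstart_def pathfinish_def\<close>)
  moreover have "homotopic_paths (- P) (gap_loop 1) (via 1 center_path +++ return_path)"
    by (rule via_loop_homotopic[OF center_path_in _ _ std_disc_gap(3)]) simp_all
  then have "cocycle (gap_loop 1) = cocycle (via 1 center_path +++ return_path)"
    by (rule crossed_at_homotopic[OF crossed_at_cocycle _ loop_at_gap_loop])
  ultimately show ?thesis by simp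
qed

text \<open>In the first disc \<open>right_path\<close> leads through the second gap, and the
  connecting segments cancel in the quotient.\<close>

lemma q_eq: "q = \<rho> (via 2 center_path) / \<rho> (via 1 center_path)"
proof -
  interpret E: embedded_disc P \<mu> "std_disc 1" basept by (rule embedded_std_disc) simp
  have qR: "q = \<rho> (std_disc 1 \<circ> right_path) / \<rho> (std_disc 1 \<circ> center_path)"
    using twist_factor_std_disc[of 1] E.twist_factor_eq by simp
  have h: "homotopic_paths (- P) (via 1 right_path) (via 2 center_path)"
    by (rule via_homotopic[OF right_path_in]) (use std_disc_gap(1)[of 1] in \<open>simp_all add: numeral_2_eq_2\<close>)
  have "path_in (- P) (linepath basept (std_disc 1 (- T)))" "path_in (- P) (linepath (std_disc 1 T) toppt)"
    "path_in (- P) (std_disc 1 \<circ> center_path)" "path_in (- P) (std_disc 1 \<circ> right_path)"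
    using via_in_Compl[OF center_path_in _ _ std_disc_gap(3)[of 1]]
      via_in_Compl(2)[OF right_path_in _ _ std_disc_gap(1)[of 1]] by simp_all
  then have v: "\<rho> (via 1 p) = \<rho> (linepath basept (std_disc 1 (- T))) * (\<rho> (std_disc 1 \<circ> p) * \<rho> (linepath (std_disc 1 T) toppt))"
    if "p = right_path \<or> p = center_path" for p
    using that unfolding via_def by (auto simp: \<rho>_join)
  show ?thesis unfolding qR \<rho>_homotopic[OF h, symmetric] v[OF disjI1[OF refl]] v[OF disjI2[OF refl]]
    by simp
qed

text \<open>Going up through gap 2 and back through gap 1 never gets left of the leftmost puncture,
  so the cocycle is 0 on this loop. Hence both the value and \<rho> of the second path are q times
  those of the first, and \<open>return_path\<close> is common to both loops.\<close>

lemma cocycle_gap_loop_2: "cocycle (gap_loop 2) = q * cocycle (gap_loop 1)"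
proof -
  obtain c where c: "crossed c" "\<And>g. loop_at basept g \<Longrightarrow> c g = cocycle g"
    using crossed_extend[OF crossed_at_cocycle basept(2)] by blast
  let ?v = "\<lambda>j. via j center_path"
  have e: "pathstart (?v j) = basept" "pathfinish (?v j) = toppt" for j
    by (simp_all add: via_ends)
  let ?g = "?v 2 +++ reversepath (?v 1)"
  have l: "loop_at basept ?g" using via_center_in e by (simp add: loop_at_def)
  have im: "path_image ?g = path_image (?v 2) \<union> path_image (?v 1)"
    by (simp add: path_image_join e)
  have "cocycle ?g = 0"
  proof (rule crossing_cocycle_right[OF l])
    fix z assume "z \<in> path_image ?g"
    then have "z \<in> path_image (?v 2) \<or> z \<in> path_image (?v 1)" unfolding im by blast
    then have "\<delta> - 1 \<le> Re z" using via_right_half_plane[of 1 z] via_right_half_plane[of 2 z] by linarith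
    then show "Re (of_real (\<delta> - 1)) \<le> Re z" by simp
  qed
  moreover have "c ?g = c (?v 2) + \<rho> (?v 2) * c (reversepath (?v 1))"
    by (rule crossed_join[OF c(1)]) (simp_all add: via_center_in e)
  ultimately have "0 = c (?v 2) + \<rho> (?v 2) * (- inverse (\<rho> (?v 1)) * c (?v 1))"
    by (simp only: c(2)[OF l] crossed_reversepath[OF c(1) via_center_in[of 1]])
  moreover have "x = y / i * z" if "0 = x + y * (- inverse i * z)" for x y i z :: complex
    using that by (simp add: divide_inverse mult.assoc)
  ultimately have 1: "c (?v 2) = q * c (?v 1)" unfolding q_eq by blast
  have *: "cocycle (gap_loop j) = c (?v j) + \<rho> (?v j) * c return_path" for j
  proof -
    have "homotopic_paths (- P) (gap_loop j) (?v j +++ return_path)"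
      by (rule via_loop_homotopic[OF center_path_in _ _ std_disc_gap(3)]) simp_all
    then have "c (gap_loop j) = c (?v j +++ return_path)" by (rule crossed_homotopic[OF c(1)])
    also have "\<dots> = c (?v j) + \<rho> (?v j) * c return_path"
      by (rule crossed_join[OF c(1) via_center_in return_path_in(1)]) (simp add: e return_path)
    finally show ?thesis using c(2)[OF loop_at_gap_loop] by simp
  qed
  have "\<rho> (?v 2) = q * \<rho> (?v 1)" by (simp add: q_eq)
  then show ?thesis unfolding * 1 by (simp add: algebra_simps)
qed

lemma disc_homeos_plane_homeo:
  assumes h: "h \<in> disc_homeos n" shows "plane_homeo h"
  unfolding plane_homeo_def
proof (intro conjI allI impI)
  note H = disc_homeosD[OF h]
  have "continuous_on (- ball 0 1) h"
    by (rule continuous_on_eq[OF continuous_on_id]) (simp add: H(4))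
  then have "continuous_on (cball 0 1 \<union> - ball 0 1) h"
    by (intro continuous_on_closed_Un H(1)) auto
  moreover have "cball 0 1 \<union> - ball 0 1 = (UNIV :: complex set)" by auto
  ultimately show "continuous_on UNIV h" by simp
  show "inj h" using disc_homeos_bij[OF h] by (simp add: bij_def)
  show "h ` P = P" by (rule H(5))
  show "h z = z" if "norm z \<ge> 1" for z using H(4)[of z] that by simp
qed

lemma std_twist_in_disc_homeos:
  assumes j: "j \<in> {1, 2, 3}" shows "twist_along (std_disc j) \<in> disc_homeos n"
proof -
  interpret E: embedded_disc P \<mu> "std_disc j" basept by (rule embedded_std_disc[OF j])
  show ?thesis
    by (rule twist_along_in_disc_homeos[OF E.continuous_e E.inj_e std_disc_ball[OF j] E.e_P])
qed

end

section \<open>The normal subgroup acting trivially\<close>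

lemma mapping_class_pow:
  assumes s: "s \<in> disc_homeos n"
  shows "mapping_class n s [^]\<^bsub>braid_group n\<^esub> k = mapping_class n (s ^^ k) \<and> s ^^ k \<in> disc_homeos n"
proof (induction k)
  case 0
  have "\<one>\<^bsub>braid_group n\<^esub> = mapping_class n id" by (simp add: braid_group_def FactGroup_def)
  then show ?case using id_in_disc_homeos by (simp only: nat_pow_0 funpow.simps)
next
  case (Suc k)
  have "mapping_class n s [^]\<^bsub>braid_group n\<^esub> Suc k = mapping_class n (s ^^ k) \<otimes>\<^bsub>braid_group n\<^esub> mapping_class n s"
    using Suc by simp
  also have "\<dots> = mapping_class n (s ^^ k \<circ> s)" using mult_mapping_class Suc s by blast
  also have "s ^^ k \<circ> s = s ^^ Suc k" by (simp only: funpow_Suc_right)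
  finally show ?case using Suc s comp_in_disc_homeos by (simp only: funpow_Suc_right)
qed

lemma mapping_class_eq_iff:
  assumes "f \<in> disc_homeos n" "g \<in> disc_homeos n"
  shows "mapping_class n f = mapping_class n g \<longleftrightarrow> isotopic n f g"
  unfolding mapping_class_def
  using isotopic_refl[OF assms(2)] isotopic_sym isotopic_trans by blast

section \<open>The kernel of the action and the size of the orbit\<close>

context braid_setup
begin

lemma isotopic_homotopic_paths:
  assumes iso: "isotopic n f h" and g: "loop_at basept g"
  shows "homotopic_paths (- P) (f \<circ> g) (h \<circ> g)"
proof -
  let ?B = "cball 0 1 :: complex set"
  obtain H where Hc: "continuous_map (prod_topology (top_of_set {0..1::real}) (top_of_set ?B)) (top_of_set ?B) H"
    and H0: "\<And>x. H (0, x) = f x" and H1: "\<And>x. H (1, x) = h x"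
    and Ht: "\<And>t. t \<in> {0..1} \<Longrightarrow> (\<lambda>x. H (t, x)) \<in> disc_homeos n"
    using iso unfolding isotopic_def homotopic_with_def by blast
  have c1: "continuous_on ({0..1} \<times> ?B) H"
    using Hc by (simp add: prod_topology_subtopology_eu continuous_map_in_subtopology)
  have out: "H (t, z) = z" if "t \<in> {0..1}" "z \<notin> ball 0 1" for t z
    using disc_homeosD(4)[OF Ht[OF that(1)] that(2)] .
  have c2: "continuous_on ({0..1} \<times> - ball 0 1) H"
    by (rule continuous_on_eq[OF continuous_on_snd[OF continuous_on_id]]) (use out in auto)
  have "continuous_on ({0..1} \<times> ?B \<union> {0..1} \<times> - ball 0 1) H"
    by (intro continuous_on_closed_Un c1 c2 closed_Times) auto
  moreover have "{0..1::real} \<times> ?B \<union> {0..1} \<times> - ball 0 1 = {0..1} \<times> UNIV" by auto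
  ultimately have c: "continuous_on ({0..1} \<times> UNIV) H" by simp
  have gc: "continuous_on {0..1} g" using g by (simp add: loop_at_def path_in_def path_def)
  have Hb: "H (t, basept) = basept" if "t \<in> {0..1}" for t
    using basept(1) by (intro out[OF that]) simp
  have g01: "g 0 = basept" "g 1 = basept" using g by (simp_all add: loop_at_def pathstart_def pathfinish_def)
  show ?thesis
    unfolding homotopic_paths
  proof (intro exI[of _ "\<lambda>(t, x). H (t, g x)"] conjI ballI)
    have "continuous_on ({0..1::real} \<times> {0..1::real}) (\<lambda>x. (fst x, g (snd x)))"
      by (intro continuous_intros continuous_on_compose2[OF gc]) auto
    from continuous_on_compose2[OF c this]
    show "continuous_on ({0..1} \<times> {0..1}) (\<lambda>(t, x). H (t, g x))"
      by (force simp: case_prod_unfold)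
    show "(\<lambda>(t, x). H (t, g x)) \<in> {0..1} \<times> {0..1} \<rightarrow> - P"
    proof clarsimp
      fix t x :: real assume t: "0 \<le> t" "t \<le> 1" "0 \<le> x" "x \<le> 1" and P: "H (t, g x) \<in> P"
      have "g x \<in> - P" using loop_atD(1)[OF g] t by (auto simp: path_in_def path_image_def image_subset_iff)
      moreover have "plane_homeo (\<lambda>x. H (t, x))" using disc_homeos_plane_homeo Ht t by simp
      ultimately show False using plane_homeo_Compl P by blast
    qed
  qed (use H0 H1 Hb H0[of basept] Hb[of 0] g01 in \<open>auto simp: pathstart_def pathfinish_def\<close>)
qed

text \<open>Trivial action on all crossed homomorphisms, and not on \<open>cocycle\<close> alone, is
  what makes these classes a normal subgroup: conjugation by \<open>h\<close> replaces
  \<open>c\<close> by its pullback along \<open>h\<close>.\<close>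

definition acts_trivially :: "(complex \<Rightarrow> complex) \<Rightarrow> bool" where
  "acts_trivially k \<longleftrightarrow> k \<in> disc_homeos n \<and>
     (\<forall>c. crossed_at basept c \<longrightarrow> (\<forall>g. loop_at basept g \<longrightarrow> c (k \<circ> g) = c g))"

lemma loop_at_disc_homeo: "k \<in> disc_homeos n \<Longrightarrow> loop_at basept g \<Longrightarrow> loop_at basept (k \<circ> g)"
  using loop_at_homeo[OF disc_homeos_plane_homeo basept(1)] .

lemma crossed_at_disc_homeo: "k \<in> disc_homeos n \<Longrightarrow> crossed_at basept c \<Longrightarrow> crossed_at basept (\<lambda>g. c (k \<circ> g))"
  using crossed_at_homeo[OF _ disc_homeos_plane_homeo basept(1)] .

lemma crossed_at_isotopic:
  assumes "isotopic n f h" "crossed_at basept c" "loop_at basept g"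
  shows "c (f \<circ> g) = c (h \<circ> g)"
  using crossed_at_homotopic[OF assms(2) isotopic_homotopic_paths[OF assms(1,3)]]
    loop_at_disc_homeo[OF isotopic_in_disc_homeos(1)[OF assms(1)] assms(3)] .

lemma acts_trivially_normal: "mapping_class n ` {k. acts_trivially k} \<lhd> braid_group n"
proof -
  interpret B: group "braid_group n" by (rule group_braid_group)
  have one: "\<one>\<^bsub>braid_group n\<^esub> = mapping_class n id" by (simp add: braid_group_def FactGroup_def)
  have inv: "inv\<^bsub>braid_group n\<^esub> (mapping_class n h) = mapping_class n (inv_into UNIV h)" if h: "h \<in> disc_homeos n" for h
  proof (rule B.inv_equality)
    show "mapping_class n (inv_into UNIV h) \<otimes>\<^bsub>braid_group n\<^esub> mapping_class n h = \<one>\<^bsub>braid_group n\<^esub>"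
      using mult_mapping_class[OF inv_in_disc_homeos[OF h] h] disc_homeos_bij[OF h]
      by (simp add: one bij_def)
  qed (use h inv_in_disc_homeos[OF h] in \<open>auto simp: carrier_braid_group\<close>)
  have comp: "acts_trivially (k \<circ> l)" if "acts_trivially k" "acts_trivially l" for k l
    using that comp_in_disc_homeos[of k n l] loop_at_disc_homeo
    by (auto simp: acts_trivially_def comp_assoc)
  have sub: "subgroup (mapping_class n ` {k. acts_trivially k}) (braid_group n)"
  proof (rule B.subgroupI)
    show "mapping_class n ` {k. acts_trivially k} \<subseteq> carrier (braid_group n)"
      by (auto simp: carrier_braid_group acts_trivially_def)
    have "acts_trivially id" by (simp add: acts_trivially_def id_in_disc_homeos)
    then show "mapping_class n ` {k. acts_trivially k} \<noteq> {}" by blast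
  next
    fix x y assume "x \<in> mapping_class n ` {k. acts_trivially k}" "y \<in> mapping_class n ` {k. acts_trivially k}"
    then obtain k l where kl: "acts_trivially k" "x = mapping_class n k" "acts_trivially l" "y = mapping_class n l"
      by blast
    then have "x \<otimes>\<^bsub>braid_group n\<^esub> y = mapping_class n (k \<circ> l)"
      using mult_mapping_class by (auto simp: acts_trivially_def)
    then show "x \<otimes>\<^bsub>braid_group n\<^esub> y \<in> mapping_class n ` {k. acts_trivially k}"
      using comp kl by blast
  next
    fix x assume "x \<in> mapping_class n ` {k. acts_trivially k}"
    then obtain k where k: "acts_trivially k" "x = mapping_class n k" by blast
    have kd: "k \<in> disc_homeos n" using k by (simp add: acts_trivially_def)
    note id = inv_in_disc_homeos[OF kd]
    have "acts_trivially (inv_into UNIV k)"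
      unfolding acts_trivially_def
    proof (intro conjI allI impI id)
      fix c g assume c: "crossed_at basept c" and g: "loop_at basept g"
      have "c (k \<circ> (inv_into UNIV k \<circ> g)) = c (inv_into UNIV k \<circ> g)"
        using k(1) c loop_at_disc_homeo[OF id g] by (simp add: acts_trivially_def)
      moreover have "k \<circ> (inv_into UNIV k \<circ> g) = g"
        using disc_homeos_bij[OF kd] by (simp add: comp_assoc[symmetric] bij_def surj_iff)
      ultimately show "c (inv_into UNIV k \<circ> g) = c g" by simp
    qed
    then show "inv\<^bsub>braid_group n\<^esub> x \<in> mapping_class n ` {k. acts_trivially k}"
      using inv[OF kd] k by blast
  qed
  moreover have "x \<otimes>\<^bsub>braid_group n\<^esub> y \<otimes>\<^bsub>braid_group n\<^esub> inv\<^bsub>braid_group n\<^esub> x \<in> mapping_class n ` {k. acts_trivially k}"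
    if x: "x \<in> carrier (braid_group n)" and y: "y \<in> mapping_class n ` {k. acts_trivially k}" for x y
  proof -
    obtain h where h: "h \<in> disc_homeos n" "x = mapping_class n h" using x by (auto simp: carrier_braid_group)
    obtain k where k: "acts_trivially k" "y = mapping_class n k" using y by blast
    have kd: "k \<in> disc_homeos n" using k by (simp add: acts_trivially_def)
    note hi = inv_in_disc_homeos[OF h(1)]
    have "acts_trivially (h \<circ> k \<circ> inv_into UNIV h)"
      unfolding acts_trivially_def
    proof (intro conjI allI impI)
      show "h \<circ> k \<circ> inv_into UNIV h \<in> disc_homeos n" by (intro comp_in_disc_homeos h(1) kd hi)
      fix c g assume c: "crossed_at basept c" and g: "loop_at basept g"
      have "c (h \<circ> (k \<circ> (inv_into UNIV h \<circ> g))) = c (h \<circ> (inv_into UNIV h \<circ> g))"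
        using k(1) crossed_at_disc_homeo[OF h(1) c] loop_at_disc_homeo[OF hi g]
        unfolding acts_trivially_def by blast
      moreover have "h \<circ> (inv_into UNIV h \<circ> g) = g"
        using disc_homeos_bij[OF h(1)] by (simp add: comp_assoc[symmetric] bij_def surj_iff)
      ultimately show "c (h \<circ> k \<circ> inv_into UNIV h \<circ> g) = c g" by (simp add: comp_assoc)
    qed
    moreover have "x \<otimes>\<^bsub>braid_group n\<^esub> y \<otimes>\<^bsub>braid_group n\<^esub> inv\<^bsub>braid_group n\<^esub> x = mapping_class n (h \<circ> k \<circ> inv_into UNIV h)"
      using h k inv[OF h(1)] mult_mapping_class[OF h(1) kd] mult_mapping_class[OF comp_in_disc_homeos[OF h(1) kd] hi]
      by simp
    ultimately show ?thesis by blast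
  qed
  ultimately show ?thesis by (simp add: B.normal_inv_iff)
qed

text \<open>With \<phi> = 2 \<pi> / m one has - x = cis \<phi> or its inverse, and |1 + x|^2 = 2 - 2
  cos \<phi>; m \<ge> 5 makes \<phi> < \<pi>/2, so cos \<phi> is positive.\<close>

lemma factor_properties:
  assumes x: "x = cis (2 * pi * \<mu>) \<or> x = cis (- (2 * pi * \<mu>))"
  shows "norm x = 1" "x \<noteq> - 1" "(norm (1 + x))\<^sup>2 < 2" "(- x) ^ m = 1" "- x \<noteq> 1"
proof -
  define \<phi> where "\<phi> = 2 * pi / real m"
  have m\<phi>: "real m * \<phi> = 2 * pi" using m by (simp add: \<phi>_def)
  have \<phi>: "0 < \<phi>" "\<phi> < pi / 2" using m by (simp_all add: \<phi>_def field_simps)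
  have "2 * pi * \<mu> = pi + \<phi>" by (simp add: \<phi>_def algebra_simps)
  moreover have "cis (pi + \<phi>) = - cis \<phi>" "cis (- (pi + \<phi>)) = - cis (- \<phi>)"
    unfolding minus_add_distrib cis_mult[symmetric] by (simp_all add: complex_eq_iff)
  ultimately have xe: "- x = cis \<phi> \<or> - x = cis (- \<phi>)" using x by auto
  have cos: "0 < cos \<phi>" "cos \<phi> < 1"
    using cos_gt_zero[of \<phi>] cos_monotone_0_pi[of 0 \<phi>] \<phi> by auto
  show "norm x = 1" using x by auto
  have R: "Re (- x) = cos \<phi>" using xe by (metis cis.simps(1) cos_minus)
  then show "- x \<noteq> 1" using cos by (metis less_irrefl one_complex.simps(1))
  then show "x \<noteq> - 1" by auto
  have "(Re x)\<^sup>2 + (Im x)\<^sup>2 = 1" using \<open>norm x = 1\<close> cmod_power2[of x] by simp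
  moreover have "(norm (1 + x))\<^sup>2 = (1 + Re x)\<^sup>2 + (Im x)\<^sup>2" by (simp add: cmod_power2)
  ultimately have "(norm (1 + x))\<^sup>2 = 2 - 2 * cos \<phi>"
    using R by (simp add: power2_sum)
  then show "(norm (1 + x))\<^sup>2 < 2" using cos by simp
  have "(- x) ^ m = cis (2 * pi) \<or> (- x) ^ m = cis (- (2 * pi))"
    using xe m\<phi> by (auto simp: Complex.DeMoivre)
  then show "(- x) ^ m = 1" by (auto simp: complex_eq_iff)
qed

lemma half_twist_power_acts_trivially:
  assumes \<sigma>: "half_twist n \<sigma>"
  shows "\<sigma> [^]\<^bsub>braid_group n\<^esub> m \<in> mapping_class n ` {k. acts_trivially k}"
proof -
  obtain e where e: "continuous_on (cball 0 1) e" "inj_on e (cball 0 1)" "e ` cball 0 1 \<subseteq> ball 0 1"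
      "e ` cball 0 1 \<inter> P = {e (1/2), e (- 1/2)}" and \<sigma>e: "\<sigma> = mapping_class n (twist_along e)"
    using \<sigma> by (auto simp: half_twist_def)
  interpret E: embedded_disc P \<mu> e basept
    by standard (use e basept in auto)
  have s: "twist_along e \<in> disc_homeos n" by (rule twist_along_in_disc_homeos[OF e])
  note q = factor_properties[OF E.twist_factor_cases]
  have "acts_trivially (twist_along e ^^ m)"
    unfolding acts_trivially_def
    using mapping_class_pow[OF s, of m] E.twist_power[OF _ _ disc_homeos_plane_homeo[OF s] basept(1) q(4,5)]
    by blast
  then show ?thesis using mapping_class_pow[OF s, of m] \<sigma>e by blast
qed

text \<open>The value 0 off the loops makes equality of functions the same as equality on loops, so
  the orbit can be counted as a set of functions.\<close>

definition pullback :: "(complex \<Rightarrow> complex) \<Rightarrow> (real \<Rightarrow> complex) \<Rightarrow> complex" where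
  "pullback h g = (if loop_at basept g then cocycle (h \<circ> g) else 0)"

lemma infinite_pullbacks: "infinite (pullback ` disc_homeos n)"
proof
  assume fin: "finite (pullback ` disc_homeos n)"
  let ?A = "pullback ` disc_homeos n"
  define s where "s j c g = (if loop_at basept g then c (twist_along (std_disc j) \<circ> g) else 0)"
    for j and c :: "(real \<Rightarrow> complex) \<Rightarrow> complex" and g
  \<comment> \<open>The value of c o s - c on the \<open>j\<close>-th gap loop, s being the
    \<open>j\<close>-th standard half-twist, according to \<open>crossed_at_twist\<close>.\<close>
  define l where "l j c = c (gap_loop (Suc j)) - (1 + q) * c (gap_loop j) + q * c (gap_loop (j - 1))"
    for j and c :: "(real \<Rightarrow> complex) \<Rightarrow> complex"
  have crossed: "crossed_at basept c" if c: "c \<in> ?A" for c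
  proof -
    obtain h where h: "h \<in> disc_homeos n" "c = pullback h" using c by blast
    from crossed_at_disc_homeo[OF h(1) crossed_at_cocycle] show ?thesis
      unfolding crossed_at_def h(2) pullback_def using loop_at_join by simp
  qed
  have sp: "s j (pullback h) = pullback (h \<circ> twist_along (std_disc j))" if "j \<in> {1, 2, 3}" for j h
    using loop_at_disc_homeo[OF std_twist_in_disc_homeos[OF that]]
    by (auto simp: fun_eq_iff s_def pullback_def comp_assoc)
  have bij: "bij_betw (s j) ?A ?A" if j: "j \<in> {1, 2, 3}" for j
  proof -
    let ?t = "twist_along (std_disc j)"
    note t = std_twist_in_disc_homeos[OF j]
    \<comment> \<open>Surjectivity is shown with the inverse twist; injectivity then follows from
      the assumed finiteness.\<close>
    have "?A \<subseteq> s j ` ?A"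
    proof
      fix c assume "c \<in> ?A"
      then obtain h where h: "h \<in> disc_homeos n" "c = pullback h" by blast
      have "h \<circ> inv_into UNIV ?t \<circ> ?t = h"
        using disc_homeos_bij[OF t] by (simp add: comp_assoc bij_def)
      then have "c = s j (pullback (h \<circ> inv_into UNIV ?t))" using sp[OF j] h by simp
      moreover have "h \<circ> inv_into UNIV ?t \<in> disc_homeos n"
        by (intro comp_in_disc_homeos h inv_in_disc_homeos t)
      ultimately show "c \<in> s j ` ?A" by blast
    qed
    moreover have "s j ` ?A \<subseteq> ?A" using sp[OF j] comp_in_disc_homeos t by auto
    ultimately have "s j ` ?A = ?A" by blast
    then show ?thesis using fin by (simp add: bij_betw_def eq_card_imp_inj_on)
  qed
  have y: "s j c (gap_loop i) = (if i = j then c (gap_loop (Suc j)) - q * c (gap_loop j) + q * c (gap_loop (j - 1))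
      else c (gap_loop i))" if c: "c \<in> ?A" and j: "j \<in> {1, 2, 3}" for c i j
  proof -
    obtain i' where "j = Suc i'" using j by auto
    then show ?thesis
      using crossed_at_twist_other[OF crossed[OF c] j, of i] crossed_at_twist[OF crossed[OF c], of i'] j loop_at_gap_loop
      by (simp add: s_def)
  qed
  note qp = factor_properties[OF q_cases]
  have id: "pullback id \<in> ?A" using id_in_disc_homeos by blast
  have "l 1 (pullback id) = 0"
  proof (rule reflections_vanish[where q = q and A = ?A and ?s1.0 = "s 1" and ?s2.0 = "s 2" and ?s3.0 = "s 3"
        and ?l1.0 = "l 1" and c = "pullback id" and ?l2.0 = "l 2" and ?l3.0 = "l 3"])
    show "bij_betw (s 1) ?A ?A" "bij_betw (s 2) ?A ?A" "bij_betw (s 3) ?A ?A" by (rule bij; simp)+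
  qed (use fin qp id in \<open>simp_all add: l_def y algebra_simps numeral_2_eq_2 numeral_3_eq_3\<close>)
  moreover have "pullback id (gap_loop j) = cocycle (gap_loop j)" for j
    using loop_at_gap_loop by (simp add: pullback_def)
  \<comment> \<open>As the value at gap 0 is 0 and the value at gap 2 is q times that at gap 1, the
    left-hand side is minus the value at gap 1.\<close>
  ultimately have "cocycle (gap_loop 2) - (1 + q) * cocycle (gap_loop 1) + q * cocycle (gap_loop 0) = 0"
    by (simp add: l_def numeral_2_eq_2)
  then have "cocycle (gap_loop 1) = 0"
    using crossed_at_gap_loop_0[OF crossed_at_cocycle] cocycle_gap_loop_2 by (simp add: algebra_simps)
  then show False using cocycle_gap_loop_1 by simp
qed

text \<open>The pullback of \<open>cocycle\<close> along \<open>h\<close> depends only on the right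
  coset of \<open>h\<close>: an element k of the subgroup, applied after \<open>h\<close>, does not
  change values of crossed homomorphisms. So there are at least as many cosets as pullbacks.\<close>

lemma infinite_index_acts_trivially:
  assumes N: "subgroup N (braid_group n)" "N \<subseteq> mapping_class n ` {k. acts_trivially k}"
  shows "infinite (rcosets\<^bsub>braid_group n\<^esub> N)"
proof
  assume fin: "finite (rcosets\<^bsub>braid_group n\<^esub> N)"
  interpret B: group "braid_group n" by (rule group_braid_group)
  define F where "F R = pullback (SOME h. h \<in> disc_homeos n \<and> mapping_class n h \<in> R)" for R
  have "pullback h \<in> F ` (rcosets\<^bsub>braid_group n\<^esub> N)" if h: "h \<in> disc_homeos n" for h
  proof -
    let ?a = "mapping_class n h"
    let ?R = "N #>\<^bsub>braid_group n\<^esub> ?a"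
    have a: "?a \<in> carrier (braid_group n)" using h by (simp add: carrier_braid_group)
    have R: "?R \<in> rcosets\<^bsub>braid_group n\<^esub> N" using a by (auto simp: RCOSETS_def)
    define h' where "h' = (SOME h. h \<in> disc_homeos n \<and> mapping_class n h \<in> ?R)"
    have "h \<in> disc_homeos n \<and> ?a \<in> ?R" using h B.rcos_self[OF a N(1)] by simp
    then have h': "h' \<in> disc_homeos n" "mapping_class n h' \<in> ?R"
      unfolding h'_def by (metis (mono_tags, lifting) someI_ex)+
    then obtain x where x: "x \<in> N" "mapping_class n h' = x \<otimes>\<^bsub>braid_group n\<^esub> ?a"
      by (auto simp: r_coset_def)
    then obtain k where k: "acts_trivially k" "x = mapping_class n k" using N(2) by blast
    have kd: "k \<in> disc_homeos n" using k by (simp add: acts_trivially_def)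
    have "mapping_class n h' = mapping_class n (k \<circ> h)" using x k mult_mapping_class[OF kd h] by simp
    then have iso: "isotopic n h' (k \<circ> h)"
      using mapping_class_eq_iff[OF h'(1) comp_in_disc_homeos[OF kd h]] by simp
    have "cocycle (h' \<circ> g) = cocycle (h \<circ> g)" if g: "loop_at basept g" for g
      using crossed_at_isotopic[OF iso crossed_at_cocycle g] k(1) crossed_at_cocycle loop_at_disc_homeo[OF h g]
      by (simp add: acts_trivially_def comp_assoc)
    then have "pullback h' = pullback h" by (simp add: fun_eq_iff pullback_def)
    then have "pullback h = F ?R" by (simp add: F_def h'_def)
    then show ?thesis using R by blast
  qed
  then have "pullback ` disc_homeos n \<subseteq> F ` (rcosets\<^bsub>braid_group n\<^esub> N)" by blast
  then have "finite (pullback ` disc_homeos n)" using fin finite_surj by blast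
  then show False using infinite_pullbacks by simp
qed

end

lemma subgroup_normal_closure:
  assumes "group G" "S \<subseteq> carrier G" shows "subgroup (normal_closure G S) G"
proof -
  interpret group G by fact
  \<comment> \<open>The whole group belongs to the family, so the intersection is not the one over
    the empty family, which would be \<open>UNIV\<close>.\<close>
  have "carrier G \<lhd> G"
    by (simp add: normal_inv_iff subgroup_self)
  then have ne: "{N. N \<lhd> G \<and> S \<subseteq> N} \<noteq> {}" using assms(2) by blast
  show ?thesis
    unfolding normal_closure_def
    by (rule subgroups_Inter[OF _ ne]) (auto intro: normal_imp_subgroup)
qed

theorem corollary1p3:
  fixes m n :: nat and \<sigma> :: "(complex \<Rightarrow> complex) set"
  assumes "m \<ge> 5" and "n \<ge> 4"
    and "\<sigma> \<in> carrier (braid_group n)" and "half_twist n \<sigma>"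
  shows "infinite (rcosets\<^bsub>braid_group n\<^esub>
           (normal_closure (braid_group n) {\<sigma> [^]\<^bsub>braid_group n\<^esub> m}))"
proof -
  interpret braid_setup n m by standard (use assms in auto)
  interpret B: group "braid_group n" by (rule group_braid_group)
  have "normal_closure (braid_group n) {\<sigma> [^]\<^bsub>braid_group n\<^esub> m} \<subseteq> mapping_class n ` {k. acts_trivially k}"
    unfolding normal_closure_def
    using acts_trivially_normal half_twist_power_acts_trivially[OF assms(4)] by blast
  then show ?thesis
    by (intro infinite_index_acts_trivially subgroup_normal_closure group_braid_group) (use assms(3) in auto)
qed

end
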